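(* Game $\mathscr{G}$ always admits a Nash equilibrium, for any set of channel matrices $\{\mathbf{H}_{rq}\}_{r,q\in\Omega}$ and transmit powers $\{P_q\}_{q\in\Omega}$ of the users. Furthermore, the Nash equilibrium is unique if $$\rho(\widetilde{\mathbf{S}})<1 .$$
   Context: Setting. $\Omega=\{1,\ldots,Q\}$. For $r,q\in\Omega$, $\mathbf{H}_{rq}\in\mathbb{C}^{n_{R_q}\times n_{T_r}}$ are arbitrary matrices (possibly rectangular and rank deficient) with $\mathbf{H}_{qq}\neq\mathbf{0}$, $\mathbf{R}_{n_q}\in\mathbb{C}^{n_{R_q}\times n_{R_q}}$ is Hermitian positive definite, and $P_q>0$. The strategy sets are $\mathscr{Q}_q=\{\mathbf{Q}\in\mathbb{C}^{n_{T_q}\times n_{T_q}}:\mathbf{Q}\succeq\mathbf{0},\ \mathrm{Tr}(\mathbf{Q})=P_q\}$, $\mathscr{Q}_{-q}=\prod_{r\ne q}\mathscr{Q}_r$, and for $\mathbf{Q}_{-q}=(\mathbf{Q}_r)_{r\neq q}\in\mathscr{Q}_{-q}$, $\mathbf{R}_{-q}(\mathbf{Q}_{-q})=\mathbf{R}_{n_q}+\sum_{r\neq q}\mathbf{H}_{rq}\mathbf{Q}_r\mathbf{H}_{rq}^H$. Game $\mathscr{G}$: the players are $q\in\Omega$; player $q$ chooses $\mathbf{Q}_q\in\mathscr{Q}_q$ to maximize $R_q(\mathbf{Q}_q,\mathbf{Q}_{-q})=\log\det\big(\mathbf{I}+\mathbf{H}_{qq}^H\mathbf{R}_{-q}^{-1}(\mathbf{Q}_{-q})\mathbf{H}_{qq}\mathbf{Q}_q\big)$.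 A (pure-strategy) Nash equilibrium is $(\mathbf{Q}_q^\star)_{q\in\Omega}$ with $\mathbf{Q}_q^\star\in\mathscr{Q}_q$ and $R_q(\mathbf{Q}_q^\star,\mathbf{Q}_{-q}^\star)\ge R_q(\mathbf{Q}_q,\mathbf{Q}_{-q}^\star)$ for all $\mathbf{Q}_q\in\mathscr{Q}_q$ and all $q\in\Omega$. Notation. $\rho$ is the spectral radius, $(\cdot)^\sharp$ the Moore-Penrose pseudoinverse, $\mathbf{A}^{\sharp H}=(\mathbf{A}^\sharp)^H$, and $\mathcal{R}(\cdot)$, $\mathcal{N}(\cdot)$ denote range and null space. Matrix $\widetilde{\mathbf{S}}\in\mathbb{R}_+^{Q\times Q}$: $[\widetilde{\mathbf{S}}]_{qq}=0$, and for $r\neq q$, $$[\widetilde{\mathbf{S}}]_{qr}=\begin{cases}\rho\big(\mathbf{H}_{rq}^H\mathbf{H}_{qq}^{\sharp H}\mathbf{H}_{qq}^{\sharp}\mathbf{H}_{rq}\big), & \text{if }\mathrm{rank}(\mathbf{H}_{qq})=n_{R_q},\\ \rho\big(\mathbf{H}_{rq}^H\mathbf{P}_{rq}^{\star H}\mathbf{H}_{qq}^{\sharp H}\mathbf{H}_{qq}^{\sharp}\mathbf{P}_{rq}^{\star}\mathbf{H}_{rq}\big), & \text{otherwise,}\end{cases}$$ where $\mathbf{P}_{rq}^\star$ is (the $\mathbf{P}_{rq}$-component of) a solution of: maximize $\rho\big(\mathbf{H}_{rq}^H\mathbf{P}_{rq}^H\mathbf{H}_{qq}^{\sharp H}\mathbf{H}_{qq}^{\sharp}\mathbf{P}_{rq}\mathbf{H}_{rq}\big)$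 over $\mathbf{P}_{rq}\in\mathbb{C}^{n_{R_q}\times n_{R_q}}$ and $\mathbf{Q}_{-q}\in\mathscr{Q}_{-q}$ subject to $\mathbf{P}_{rq}=\mathbf{P}_{rq}^2$, $\mathcal{R}(\mathbf{P}_{rq})=\mathcal{R}(\mathbf{H}_{qq})$, $\mathcal{N}(\mathbf{P}_{rq})=\mathcal{N}\big(\mathbf{H}_{qq}^H\mathbf{R}_{-q}^{-1}(\mathbf{Q}_{-q})\big)$. *)

theory Defs
  imports
    "HOL-Library.FuncSet"
    "Jordan_Normal_Form.Schur_Decomposition"
    "Jordan_Normal_Form.Spectral_Radius"
    "Jordan_Normal_Form.DL_Rank"
    "Jordan_Normal_Form.Matrix_Kernel"
    "Jordan_Normal_Form.Gauss_Jordan_Elimination"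
begin

section \<open>Matrix preliminaries\<close>

definition hermitian_mat :: "complex mat \<Rightarrow> bool" where
  "hermitian_mat A \<longleftrightarrow> square_mat A \<and> mat_adjoint A = A"

text \<open>For Hermitian \<open>A\<close> the quadratic form is real, so taking \<open>Re\<close> loses nothing.\<close>

definition pos_semidef_mat :: "complex mat \<Rightarrow> bool" where
  "pos_semidef_mat A \<longleftrightarrow> hermitian_mat A \<and>
     (\<forall>v \<in> carrier_vec (dim_row A). 0 \<le> Re ((A *\<^sub>v v) \<bullet>c v))"

definition pos_def_mat :: "complex mat \<Rightarrow> bool" where
  "pos_def_mat A \<longleftrightarrow> hermitian_mat A \<and>
     (\<forall>v \<in> carrier_vec (dim_row A). v \<noteq> 0\<^sub>v (dim_row A) \<longrightarrow> 0 < Re ((A *\<^sub>v v) \<bullet>c v))"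

definition mat_trace :: "'a :: comm_monoid_add mat \<Rightarrow> 'a" where
  "mat_trace A = (\<Sum>i<dim_row A. A $$ (i, i))"

text \<open>Meaningful only for invertible \<open>A\<close>, otherwise unspecified.\<close>

definition mat_inv :: "complex mat \<Rightarrow> complex mat" where
  "mat_inv A = the (mat_inverse A)"

definition mat_range :: "complex mat \<Rightarrow> complex vec set" where
  "mat_range A = (\<lambda>v. A *\<^sub>v v) ` carrier_vec (dim_col A)"

text \<open>The Moore--Penrose inverse, characterised by the four Penrose equations.\<close>

definition is_pseudoinverse :: "complex mat \<Rightarrow> complex mat \<Rightarrow> bool" where
  "is_pseudoinverse A X \<longleftrightarrow>
     X \<in> carrier_mat (dim_col A) (dim_row A) \<and>
     A * X * A = A \<and> X * A * X = X \<and>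
     hermitian_mat (A * X) \<and> hermitian_mat (X * A)"

definition pseudoinverse :: "complex mat \<Rightarrow> complex mat" where
  "pseudoinverse A = (THE X. is_pseudoinverse A X)"


section \<open>Nash equilibria of strategic games\<close>

text \<open>\<open>S q\<close> is the strategy set of player \<open>q\<close>, and \<open>u q x y\<close> the payoff of \<open>q\<close> when \<open>q\<close>
  plays \<open>x\<close> and the other players play \<open>y\<close>. Profiles are extensional, so that equality
  of profiles is equality at all players.\<close>

definition nash_equilibrium ::
  "'i set \<Rightarrow> ('i \<Rightarrow> 's set) \<Rightarrow> ('i \<Rightarrow> 's \<Rightarrow> ('i \<Rightarrow> 's) \<Rightarrow> real) \<Rightarrow> ('i \<Rightarrow> 's) \<Rightarrow> bool" where
  "nash_equilibrium \<Omega> S u X \<longleftrightarrow>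
     X \<in> Pi\<^sub>E \<Omega> S \<and>
     (\<forall>q\<in>\<Omega>. \<forall>Y\<in>S q. u q (X q) (restrict X (\<Omega> - {q})) \<ge> u q Y (restrict X (\<Omega> - {q})))"


section \<open>The MIMO rate maximization game\<close>

text \<open>The data are the number \<open>Q\<close> of users, the numbers \<open>nT q\<close>, \<open>nR q\<close> of transmit and
  receive dimensions, the channels \<open>H r q\<close> (from transmitter \<open>r\<close> to receiver \<open>q\<close>, of size
  \<open>nR q\<close> by \<open>nT r\<close>), the noise covariances \<open>Rn q\<close> and the power budgets \<open>P q\<close>.\<close>

definition strategies :: "(nat \<Rightarrow> nat) \<Rightarrow> (nat \<Rightarrow> real) \<Rightarrow> nat \<Rightarrow> complex mat set" where
  "strategies nT P q =
     {X \<in> carrier_mat (nT q) (nT q). pos_semidef_mat X \<and> mat_trace X = complex_of_real (P q)}"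

definition strategies_others ::
  "nat \<Rightarrow> (nat \<Rightarrow> nat) \<Rightarrow> (nat \<Rightarrow> real) \<Rightarrow> nat \<Rightarrow> (nat \<Rightarrow> complex mat) set" where
  "strategies_others Q nT P q = Pi\<^sub>E ({1..Q} - {q}) (strategies nT P)"

text \<open>The sum over the interferers is formed entrywise, because matrices whose dimensions are
  not part of the type do not form an additive monoid.\<close>

definition interference ::
  "nat \<Rightarrow> (nat \<Rightarrow> nat) \<Rightarrow> (nat \<Rightarrow> nat \<Rightarrow> complex mat) \<Rightarrow> (nat \<Rightarrow> complex mat) \<Rightarrow>
   nat \<Rightarrow> (nat \<Rightarrow> complex mat) \<Rightarrow> complex mat" where
  "interference Q nR H Rn q Y =
     Rn q + mat (nR q) (nR q)
       (\<lambda>ij. \<Sum>r\<in>{1..Q} - {q}. (H r q * Y r * mat_adjoint (H r q)) $$ ij)"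

text \<open>The determinant is real and positive on the strategy sets, so \<open>Re\<close> is only a coercion.\<close>

definition rate ::
  "nat \<Rightarrow> (nat \<Rightarrow> nat) \<Rightarrow> (nat \<Rightarrow> nat) \<Rightarrow> (nat \<Rightarrow> nat \<Rightarrow> complex mat) \<Rightarrow> (nat \<Rightarrow> complex mat) \<Rightarrow>
   nat \<Rightarrow> complex mat \<Rightarrow> (nat \<Rightarrow> complex mat) \<Rightarrow> real" where
  "rate Q nT nR H Rn q X Y =
     ln (Re (det (1\<^sub>m (nT q) +
       mat_adjoint (H q q) * mat_inv (interference Q nR H Rn q Y) * H q q * X)))"

definition is_NE ::
  "nat \<Rightarrow> (nat \<Rightarrow> nat) \<Rightarrow> (nat \<Rightarrow> nat) \<Rightarrow> (nat \<Rightarrow> nat \<Rightarrow> complex mat) \<Rightarrow> (nat \<Rightarrow> complex mat) \<Rightarrow>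
   (nat \<Rightarrow> real) \<Rightarrow> (nat \<Rightarrow> complex mat) \<Rightarrow> bool" where
  "is_NE Q nT nR H Rn P X \<longleftrightarrow>
     nash_equilibrium {1..Q} (strategies nT P) (rate Q nT nR H Rn) X"


section \<open>The interference coupling matrix\<close>

definition proj_feasible ::
  "nat \<Rightarrow> (nat \<Rightarrow> nat) \<Rightarrow> (nat \<Rightarrow> nat) \<Rightarrow> (nat \<Rightarrow> nat \<Rightarrow> complex mat) \<Rightarrow> (nat \<Rightarrow> complex mat) \<Rightarrow>
   (nat \<Rightarrow> real) \<Rightarrow> nat \<Rightarrow> complex mat \<times> (nat \<Rightarrow> complex mat) \<Rightarrow> bool" where
  "proj_feasible Q nT nR H Rn P q = (\<lambda>(Pr, Y).
     Pr \<in> carrier_mat (nR q) (nR q) \<and>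
     Y \<in> strategies_others Q nT P q \<and>
     Pr = Pr * Pr \<and>
     mat_range Pr = mat_range (H q q) \<and>
     mat_kernel Pr =
       mat_kernel (mat_adjoint (H q q) * mat_inv (interference Q nR H Rn q Y)))"

definition proj_objective ::
  "(nat \<Rightarrow> nat \<Rightarrow> complex mat) \<Rightarrow> nat \<Rightarrow> nat \<Rightarrow> complex mat \<Rightarrow> real" where
  "proj_objective H r q Pr =
     spectral_radius (mat_adjoint (H r q) * mat_adjoint Pr * mat_adjoint (pseudoinverse (H q q))
       * pseudoinverse (H q q) * Pr * H r q)"

text \<open>The maximum is attained: for each \<open>Y\<close> there is exactly one feasible \<open>Pr\<close>, it depends
  continuously on \<open>Y\<close>, and the strategy sets are compact. Any two maximizers give the same
  entry of the matrix below, so it does not matter which one is selected.\<close>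

definition P_star ::
  "nat \<Rightarrow> (nat \<Rightarrow> nat) \<Rightarrow> (nat \<Rightarrow> nat) \<Rightarrow> (nat \<Rightarrow> nat \<Rightarrow> complex mat) \<Rightarrow> (nat \<Rightarrow> complex mat) \<Rightarrow>
   (nat \<Rightarrow> real) \<Rightarrow> nat \<Rightarrow> nat \<Rightarrow> complex mat" where
  "P_star Q nT nR H Rn P r q =
     fst (arg_max (\<lambda>(Pr, Y). proj_objective H r q Pr) (proj_feasible Q nT nR H Rn P q))"

definition S_tilde_entry ::
  "nat \<Rightarrow> (nat \<Rightarrow> nat) \<Rightarrow> (nat \<Rightarrow> nat) \<Rightarrow> (nat \<Rightarrow> nat \<Rightarrow> complex mat) \<Rightarrow> (nat \<Rightarrow> complex mat) \<Rightarrow>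
   (nat \<Rightarrow> real) \<Rightarrow> nat \<Rightarrow> nat \<Rightarrow> real" where
  "S_tilde_entry Q nT nR H Rn P q r =
     (if r = q then 0
      else if vec_space.rank (nR q) (H q q) = nR q then
        spectral_radius (mat_adjoint (H r q) * mat_adjoint (pseudoinverse (H q q))
          * pseudoinverse (H q q) * H r q)
      else
        spectral_radius (mat_adjoint (H r q) * mat_adjoint (P_star Q nT nR H Rn P r q)
          * mat_adjoint (pseudoinverse (H q q)) * pseudoinverse (H q q)
          * P_star Q nT nR H Rn P r q * H r q))"

text \<open>Users are numbered from 1, matrix indices start at 0; the entries are embedded into
  the complex numbers because \<^const>\<open>spectral_radius\<close> is defined for complex matrices.\<close>

definition S_tilde ::
  "nat \<Rightarrow> (nat \<Rightarrow> nat) \<Rightarrow> (nat \<Rightarrow> nat) \<Rightarrow> (nat \<Rightarrow> nat \<Rightarrow> complex mat) \<Rightarrow> (nat \<Rightarrow> complex mat) \<Rightarrow>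
   (nat \<Rightarrow> real) \<Rightarrow> complex mat" where
  "S_tilde Q nT nR H Rn P =
     mat Q Q (\<lambda>(i, j). complex_of_real (S_tilde_entry Q nT nR H Rn P (Suc i) (Suc j)))"

end

theory Submission
  imports "HOL-Analysis.Brouwer_Fixpoint" "HOL-Analysis.Function_Metric" Defs
begin

text \<open>
  Write \<open>T = R + H X H\<^sup>H\<close>. The rate of a user is \<open>ln det T - ln det R\<close>, which is concave in \<open>X\<close>
  with gradient \<open>G = H\<^sup>H T\<^sup>-\<^sup>1 H\<close>, so equilibria are the solutions of a variational inequality.
  Existence follows from Brouwer's theorem on finitely generated simplices together with compactness.
  The dimensions are not types here, so Brouwer's theorem is derived from Kuhn's lemma for
  coordinate functions.

  For uniqueness, let \<open>H\<^sup>#\<close> be the pseudoinverse, \<open>P\<close> the oblique projection belonging to \<open>R\<close> and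
  \<open>L = H\<^sup># P\<close>. The optimality conditions say that an equilibrium strategy is the Frobenius projection of
  \<open>- L R L\<^sup>H\<close>. For two equilibria the exact identity
  \<open>L\<^sub>1 R\<^sub>1 L\<^sub>1\<^sup>H - L\<^sub>0 R\<^sub>0 L\<^sub>0\<^sup>H = L\<^sub>1 (R\<^sub>1 - R\<^sub>0) L\<^sub>0\<^sup>H\<close> replaces a mean value argument, and each
  \<open>L\<^sub>i H\<^sub>r\<^sub>q\<close> has squared operator norm at most the coupling entry. Hence the vector \<open>e\<close> of distances
  satisfies \<open>e \<le> S e\<close> with \<open>S \<ge> 0\<close> of spectral radius below 1, so \<open>e = 0\<close>.
\<close>

text \<open>The obstacle is that \<open>H q q\<close> may be rectangular and rank deficient. Then
  \<open>H^H R^-1 H\<close> is singular, and waterfilling is a projection only among strategies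
  supported in the row space of \<open>H q q\<close>. Equilibrium strategies do lie there, because
  their multiplier is positive: the gradient has positive trace as soon as the channel is nonzero.
  The exact identity makes one entry per pair of users enough. Its outer factors belong to the two
  equilibria themselves, so both are feasible in the maximization defining the entry, and each
  contributes the square root of that entry. The entry is selected by \<open>arg_max\<close>, which
  says nothing unless the maximum is attained. Continuity of the spectral radius is bypassed: for a
  Gram matrix it is the largest squared norm over unit vectors, so a continuous function is
  maximized over a compact product. Matrix square roots and unitary diagonalization are bypassed
  too: eigenvalues of \<open>A^-1 B\<close> are quotients of quadratic forms, and the operator norm
  is compared with the spectral radius through the growth of powers.\<close>

unbundle no vec_syntax
unbundle no inner_syntax
declare index_mult_mat(1) [simp del]

section \<open>Adjoints, traces and definiteness\<close>

abbreviation adj :: "complex mat \<Rightarrow> complex mat" where "adj \<equiv> mat_adjoint"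
abbreviation tr :: "complex mat \<Rightarrow> complex" where "tr \<equiv> mat_trace"

lemma dim_adj [simp]: "dim_row (adj A) = dim_col A" "dim_col (adj A) = dim_row A"
  by (simp_all add: mat_adjoint_def mat_of_rows_def)

lemma index_adj [simp]:
  "i < dim_col A \<Longrightarrow> j < dim_row A \<Longrightarrow> adj A $$ (i, j) = cnj (A $$ (j, i))"
  by (simp add: mat_adjoint_def mat_of_rows_index)

lemma adj_carrier [simp]: "A \<in> carrier_mat n m \<Longrightarrow> adj A \<in> carrier_mat m n"
  by auto

text \<open>Takes the place of the deleted simp rule, which would turn entries of products into
  scalar products of rows and columns.\<close>

lemma index_mult: "i < dim_row A \<Longrightarrow> j < dim_col B \<Longrightarrow> dim_col A = dim_row B \<Longrightarrow>
    (A * B) $$ (i, j) = (\<Sum>k<dim_row B. A $$ (i, k) * B $$ (k, j))"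
  by (simp add: index_mult_mat(1) scalar_prod_def atLeast0LessThan)

lemma adj_adj [simp]: "adj (adj A) = A"
  by (rule eq_matI) auto

lemma adj_mult [simp]: "dim_col A = dim_row B \<Longrightarrow> adj (A * B) = adj B * adj A"
  by (rule eq_matI) (auto simp: index_mult mult.commute)

lemma adj_add [simp]: "dim_row A = dim_row B \<Longrightarrow> dim_col A = dim_col B \<Longrightarrow> adj (A + B) = adj A + adj B"
  by (rule eq_matI) auto

lemma adj_minus [simp]: "dim_row A = dim_row B \<Longrightarrow> dim_col A = dim_col B \<Longrightarrow> adj (A - B) = adj A - adj B"
  by (rule eq_matI) auto

lemma adj_smult [simp]: "adj (c \<cdot>\<^sub>m A) = cnj c \<cdot>\<^sub>m adj A"
  by (rule eq_matI) auto

lemma adj_one [simp]: "adj (1\<^sub>m n) = 1\<^sub>m n"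
  by (rule eq_matI) auto

lemma mat_assoc: "dim_col A = dim_row B \<Longrightarrow> dim_col B = dim_row C \<Longrightarrow> A * B * C = A * (B * C)"
  for A :: "complex mat"
  by (rule assoc_mult_mat[of _ "dim_row A" "dim_col A" _ "dim_row C"]) auto

lemma mat_add_mult: "dim_row A = dim_row B \<Longrightarrow> dim_col A = dim_col B \<Longrightarrow> dim_col A = dim_row C \<Longrightarrow>
    (A + B) * C = A * C + B * C" for A :: "complex mat"
  by (rule add_mult_distrib_mat[of _ "dim_row A" "dim_col A" _ _ "dim_col C"]) auto

lemma mat_mult_add: "dim_row B = dim_row C \<Longrightarrow> dim_col B = dim_col C \<Longrightarrow> dim_col A = dim_row B \<Longrightarrow>
    A * (B + C) = A * B + A * C" for A :: "complex mat"
  by (rule mult_add_distrib_mat[of _ "dim_row A" "dim_col A" _ "dim_col C"]) auto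

lemma mat_minus_mult: "dim_row A = dim_row B \<Longrightarrow> dim_col A = dim_col B \<Longrightarrow> dim_col A = dim_row C \<Longrightarrow>
    (A - B) * C = A * C - B * C" for A :: "complex mat"
  by (rule minus_mult_distrib_mat[of _ "dim_row A" "dim_col A" _ _ "dim_col C"]) auto

lemma mat_mult_minus: "dim_row B = dim_row C \<Longrightarrow> dim_col B = dim_col C \<Longrightarrow> dim_col A = dim_row B \<Longrightarrow>
    A * (B - C) = A * B - A * C" for A :: "complex mat"
  by (rule mult_minus_distrib_mat[of _ "dim_row A" "dim_col A" _ "dim_col C"]) auto

lemma mat_smult_mult: "dim_col A = dim_row B \<Longrightarrow> (c \<cdot>\<^sub>m A) * B = c \<cdot>\<^sub>m (A * B)" for A :: "complex mat"
  by (rule mult_smult_assoc_mat[of _ "dim_row A" "dim_col A" _ "dim_col B"]) auto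

lemma mat_mult_smult: "dim_col A = dim_row B \<Longrightarrow> A * (c \<cdot>\<^sub>m B) = c \<cdot>\<^sub>m (A * B)" for A :: "complex mat"
  by (rule mult_smult_distrib[of _ "dim_row A" "dim_col A" _ "dim_col B"]) auto

lemma mat_mult_one: "dim_col A = n \<Longrightarrow> A * 1\<^sub>m n = A" for A :: "complex mat"
  by (rule right_mult_one_mat[of _ "dim_row A"]) auto

lemma mat_one_mult: "dim_row A = n \<Longrightarrow> 1\<^sub>m n * A = A" for A :: "complex mat"
  by (rule left_mult_one_mat[of _ _ "dim_col A"]) auto

lemma mat_mult_zero: "dim_col A = n \<Longrightarrow> A * 0\<^sub>m n m = 0\<^sub>m (dim_row A) m" for A :: "complex mat"
  by (rule right_mult_zero_mat[of _ "dim_row A"]) auto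

lemma mat_zero_mult: "dim_row A = n \<Longrightarrow> 0\<^sub>m m n * A = 0\<^sub>m m (dim_col A)" for A :: "complex mat"
  by (rule left_mult_zero_mat[of _ _ "dim_col A"]) auto

lemmas mat_simps = mat_assoc mat_add_mult mat_mult_add mat_minus_mult mat_mult_minus
  mat_smult_mult mat_mult_smult mat_mult_one mat_one_mult mat_mult_zero mat_zero_mult

text \<open>Products are normalised to the right, so a known value of \<open>A * B\<close> no longer
  occurs as a subterm of \<open>A * (B * D)\<close>; this rule applies it nevertheless.\<close>

lemma mat_assoc_eq: "A * B = C \<Longrightarrow> dim_col A = dim_row B \<Longrightarrow> dim_col B = dim_row D \<Longrightarrow> A * (B * D) = C * D"
  for A :: "complex mat"
  using mat_assoc[of A B D] by simp

lemma mat_minus_eq_zeroD: "A - B = 0\<^sub>m n m \<Longrightarrow> dim_row A = n \<Longrightarrow> dim_row B = n \<Longrightarrow> dim_col A = m \<Longrightarrow>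
    dim_col B = m \<Longrightarrow> A = B" for A :: "complex mat"
  unfolding mat_eq_iff by auto

lemma mat_minus_self: "A - A = 0\<^sub>m (dim_row A) (dim_col A)" for A :: "complex mat"
  by (rule eq_matI) auto

lemma tr_add: "dim_row A = dim_row B \<Longrightarrow> dim_col A = dim_row A \<Longrightarrow> dim_col B = dim_row B \<Longrightarrow> tr (A + B) = tr A + tr B"
  by (simp add: mat_trace_def sum.distrib)

lemma tr_minus: "dim_row A = dim_row B \<Longrightarrow> dim_col A = dim_row A \<Longrightarrow> dim_col B = dim_row B \<Longrightarrow> tr (A - B) = tr A - tr B"
  by (simp add: mat_trace_def sum_subtractf)

lemma tr_smult: "dim_col A = dim_row A \<Longrightarrow> tr (c \<cdot>\<^sub>m A) = c * tr A"
  by (simp add: mat_trace_def sum_distrib_left)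

lemma tr_one [simp]: "tr (1\<^sub>m n) = of_nat n"
  by (simp add: mat_trace_def)

lemma tr_zero [simp]: "tr (0\<^sub>m n n) = 0"
  by (simp add: mat_trace_def)

lemma tr_adj: "dim_col A = dim_row A \<Longrightarrow> tr (adj A) = cnj (tr A)"
  by (simp add: mat_trace_def)

lemma tr_comm: "dim_col A = dim_row B \<Longrightarrow> dim_col B = dim_row A \<Longrightarrow> tr (A * B) = tr (B * A)"
  unfolding mat_trace_def
  by (simp add: index_mult)
     (subst sum.swap, simp add: mult.commute)

section \<open>Frobenius norm and trace inner product\<close>

definition fnorm2 :: "complex mat \<Rightarrow> real" where
  "fnorm2 A = (\<Sum>i<dim_row A. \<Sum>j<dim_col A. (cmod (A $$ (i, j)))\<^sup>2)"

lemma fnorm2_nonneg [simp]: "0 \<le> fnorm2 A"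
  by (simp add: fnorm2_def sum_nonneg)

lemma tr_adj_mult: "dim_row A = dim_row B \<Longrightarrow> dim_col A = dim_col B \<Longrightarrow>
   tr (adj A * B) = (\<Sum>i<dim_row A. \<Sum>j<dim_col A. cnj (A $$ (i, j)) * B $$ (i, j))"
  unfolding mat_trace_def
  by (simp add: index_mult) (subst sum.swap, simp)

lemma fnorm2_tr: "tr (adj A * A) = of_real (fnorm2 A)"
  by (simp add: tr_adj_mult fnorm2_def complex_norm_square mult.commute del: of_real_power)

lemma fnorm2_eq_0: "fnorm2 A = 0 \<longleftrightarrow> A = 0\<^sub>m (dim_row A) (dim_col A)"
  by (auto simp: fnorm2_def sum_nonneg_eq_0_iff sum_nonneg mat_eq_iff)

lemma fnorm2_adj: "fnorm2 (adj A) = fnorm2 A"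
  unfolding fnorm2_def by (simp, subst sum.swap, simp)

text \<open>Matrices are read as vectors over pairs of indices, where the inequality for
  \<open>L2_set\<close> applies.\<close>

lemma tr_cauchy_schwarz:
  assumes "dim_row A = dim_row B" "dim_col A = dim_col B"
  shows "cmod (tr (adj A * B)) \<le> sqrt (fnorm2 A) * sqrt (fnorm2 B)"
proof -
  let ?I = "{..<dim_row A} \<times> {..<dim_col A}"
  have f: "fnorm2 A = (\<Sum>p\<in>?I. (cmod (A $$ p))\<^sup>2)" "fnorm2 B = (\<Sum>p\<in>?I. (cmod (B $$ p))\<^sup>2)"
    using assms by (simp_all add: fnorm2_def sum.cartesian_product)
  have "cmod (tr (adj A * B)) = cmod (\<Sum>p\<in>?I. cnj (A $$ p) * B $$ p)"
    using assms by (simp add: tr_adj_mult sum.cartesian_product)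
  also have "\<dots> \<le> (\<Sum>p\<in>?I. \<bar>cmod (A $$ p)\<bar> * \<bar>cmod (B $$ p)\<bar>)"
    by (rule order_trans[OF norm_sum]) (simp add: norm_mult)
  also have "\<dots> \<le> L2_set (\<lambda>p. cmod (A $$ p)) ?I * L2_set (\<lambda>p. cmod (B $$ p)) ?I"
    by (rule L2_set_mult_ineq)
  finally show ?thesis by (simp add: f L2_set_def)
qed

section \<open>Definiteness expressed through traces\<close>

lemma hermitian_matD: "hermitian_mat A \<Longrightarrow> adj A = A" "hermitian_mat A \<Longrightarrow> dim_col A = dim_row A"
  by (auto simp: hermitian_mat_def)

lemma hermitian_matI: "adj A = A \<Longrightarrow> hermitian_mat A"
  unfolding hermitian_mat_def by (metis dim_adj(1) square_mat.simps)

text \<open>The bridge from quadratic forms of vectors to traces: summed over the columns of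
  \<open>B\<close> it yields \<open>tr (adj B * A * B)\<close>, so positivity can be handled by the
  algebra of traces.\<close>

lemma quad_form_col:
  assumes "dim_col A = dim_row B" "j < dim_col B"  "dim_row A = dim_row B"
  shows "(adj B * A * B) $$ (j, j) = (A *\<^sub>v col B j) \<bullet>c col B j"
proof -
  have "(adj B * A * B) $$ (j, j) = (adj B * (A * B)) $$ (j, j)"
    using assms by (simp add: mat_assoc)
  also have "\<dots> = (\<Sum>k<dim_row B. (A * B) $$ (k, j) * cnj (B $$ (k, j)))"
    using assms by (simp add: index_mult[of j "adj B"] mult.commute)
  also have "\<dots> = (A *\<^sub>v col B j) \<bullet>c col B j"
    using assms by (simp add: index_mult_mat(1) scalar_prod_def[of _ "conjugate _"] atLeast0LessThan)
  finally show ?thesis .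
qed

lemma pos_semidef_tr:
  assumes "pos_semidef_mat A" "dim_row A = dim_row B"
  shows "0 \<le> Re (tr (adj B * A * B))"
proof -
  have "dim_col A = dim_row B" using assms by (auto simp: pos_semidef_mat_def hermitian_mat_def)
  then show ?thesis using assms
    unfolding mat_trace_def Re_sum
    by (intro sum_nonneg) (auto simp: quad_form_col pos_semidef_mat_def)
qed

lemma pos_def_imp_semidef: "pos_def_mat A \<Longrightarrow> pos_semidef_mat A"
  unfolding pos_def_mat_def pos_semidef_mat_def
proof (intro conjI ballI; elim conjE)
  fix v :: "complex vec" assume h: "hermitian_mat A" and p: "\<forall>v\<in>carrier_vec (dim_row A). v \<noteq> 0\<^sub>v (dim_row A) \<longrightarrow> 0 < Re ((A *\<^sub>v v) \<bullet>c v)"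
    and v: "v \<in> carrier_vec (dim_row A)"
  show "0 \<le> Re ((A *\<^sub>v v) \<bullet>c v)"
    using p v by (cases "v = 0\<^sub>v (dim_row A)") (auto intro: less_imp_le simp: scalar_prod_def)
qed

lemma pos_def_tr:
  assumes "pos_def_mat A" "dim_row A = dim_row B" "B \<noteq> 0\<^sub>m (dim_row B) (dim_col B)"
  shows "0 < Re (tr (adj B * A * B))"
proof -
  have c: "dim_col A = dim_row B" using assms by (auto simp: pos_def_mat_def hermitian_mat_def)
  obtain i j where ij: "i < dim_row B" "j < dim_col B" "B $$ (i, j) \<noteq> 0"
    using assms(3) by (auto simp: mat_eq_iff)
  have "col B j \<noteq> 0\<^sub>v (dim_row A)"
    using ij assms(2) by (metis index_col index_zero_vec(1))
  then have "0 < Re ((A *\<^sub>v col B j) \<bullet>c col B j)"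
    using assms c ij unfolding pos_def_mat_def by (metis col_dim)
  moreover have "0 \<le> Re ((A *\<^sub>v col B k) \<bullet>c col B k)" for k
    using pos_def_imp_semidef[OF assms(1)] assms(2) by (auto simp: pos_semidef_mat_def)
  ultimately show ?thesis
    using assms c ij unfolding mat_trace_def Re_sum
    by (intro sum_pos2[where i=j]) (auto simp: quad_form_col)
qed

lemma quad_form_vec:
  assumes "dim_col A = n" "dim_row A = n" "v \<in> carrier_vec n"
  defines "B \<equiv> mat n 1 (\<lambda>(i, _). v $ i)"
  shows "(A *\<^sub>v v) \<bullet>c v = tr (adj B * A * B)"
proof -
  have "col B 0 = v" using assms by (auto simp: B_def)
  then show ?thesis
    using quad_form_col[of A B 0] assms by (simp add: mat_trace_def B_def)
qed

lemma pos_semidefI: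
  assumes "adj A = A" "\<And>B. dim_row B = dim_row A \<Longrightarrow> 0 \<le> Re (tr (adj B * A * B))"
  shows "pos_semidef_mat A"
  using assms(2)[of "mat (dim_row A) 1 _"] quad_form_vec[of A "dim_row A"] hermitian_matI[OF assms(1)]
  unfolding pos_semidef_mat_def by (auto simp: hermitian_mat_def)

lemma pos_defI:
  assumes "adj A = A"
    "\<And>B. dim_row B = dim_row A \<Longrightarrow> B \<noteq> 0\<^sub>m (dim_row B) (dim_col B) \<Longrightarrow> 0 < Re (tr (adj B * A * B))"
  shows "pos_def_mat A"
  unfolding pos_def_mat_def
proof (intro conjI ballI impI)
  show h: "hermitian_mat A" by (rule hermitian_matI[OF assms(1)])
  fix v :: "complex vec" assume v: "v \<in> carrier_vec (dim_row A)" "v \<noteq> 0\<^sub>v (dim_row A)"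
  define B :: "complex mat" where "B = mat (dim_row A) 1 (\<lambda>(i, _). v $ i)"
  obtain i where "i < dim_row A" "v $ i \<noteq> 0"
    using v by (metis carrier_vecD eq_vecI index_zero_vec(1) index_zero_vec(2))
  then have "B \<noteq> 0\<^sub>m (dim_row B) (dim_col B)" by (auto simp: B_def mat_eq_iff)
  then have "0 < Re (tr (adj B * A * B))" by (intro assms(2)) (auto simp: B_def)
  then show "0 < Re ((A *\<^sub>v v) \<bullet>c v)"
    using h v by (simp add: quad_form_vec[of A "dim_row A"] B_def hermitian_mat_def)
qed

lemma pos_semidef_adj: "pos_semidef_mat A \<Longrightarrow> adj A = A" "pos_semidef_mat A \<Longrightarrow> dim_col A = dim_row A"
  by (auto simp: pos_semidef_mat_def hermitian_mat_def)

lemma pos_def_adj: "pos_def_mat A \<Longrightarrow> adj A = A" "pos_def_mat A \<Longrightarrow> dim_col A = dim_row A"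
  by (auto simp: pos_def_mat_def hermitian_mat_def)

lemma pos_semidef_congruence:
  assumes "pos_semidef_mat A" "dim_col B = dim_row A"
  shows "pos_semidef_mat (B * A * adj B)"
proof (rule pos_semidefI)
  note [simp] = pos_semidef_adj[OF assms(1)] assms(2)
  show "adj (B * A * adj B) = B * A * adj B" by (simp add: mat_simps)
  fix C :: "complex mat" assume [simp]: "dim_row C = dim_row (B * A * adj B)"
  show "0 \<le> Re (tr (adj C * (B * A * adj B) * C))"
    using pos_semidef_tr[OF assms(1), of "adj B * C"] by (simp add: mat_simps)
qed

lemma pos_semidef_add:
  assumes "pos_semidef_mat A" "pos_semidef_mat B" "dim_row A = dim_row B"
  shows "pos_semidef_mat (A + B)"
proof (rule pos_semidefI)
  note [simp] = pos_semidef_adj[OF assms(1)] pos_semidef_adj[OF assms(2)] assms(3)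
  show "adj (A + B) = A + B" by simp
  fix C :: "complex mat" assume [simp]: "dim_row C = dim_row (A + B)"
  show "0 \<le> Re (tr (adj C * (A + B) * C))"
    using pos_semidef_tr[OF assms(1), of C] pos_semidef_tr[OF assms(2), of C]
    by (simp add: mat_simps tr_add)
qed

lemma pos_def_add_semidef:
  assumes "pos_def_mat A" "pos_semidef_mat B" "dim_row A = dim_row B"
  shows "pos_def_mat (A + B)"
proof (rule pos_defI)
  note [simp] = pos_def_adj[OF assms(1)] pos_semidef_adj[OF assms(2)] assms(3)
  show "adj (A + B) = A + B" by simp
  fix C :: "complex mat" assume [simp]: "dim_row C = dim_row (A + B)" and n: "C \<noteq> 0\<^sub>m (dim_row C) (dim_col C)"
  show "0 < Re (tr (adj C * (A + B) * C))"
    using pos_def_tr[OF assms(1) _ n] pos_semidef_tr[OF assms(2), of C]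
    by (simp add: mat_simps tr_add)
qed

lemma pos_semidef_smult:
  assumes "pos_semidef_mat A" "0 \<le> c"
  shows "pos_semidef_mat (complex_of_real c \<cdot>\<^sub>m A)"
proof (rule pos_semidefI)
  note [simp] = pos_semidef_adj[OF assms(1)]
  show "adj (complex_of_real c \<cdot>\<^sub>m A) = complex_of_real c \<cdot>\<^sub>m A" by simp
  fix C :: "complex mat" assume [simp]: "dim_row C = dim_row (complex_of_real c \<cdot>\<^sub>m A)"
  show "0 \<le> Re (tr (adj C * (complex_of_real c \<cdot>\<^sub>m A) * C))"
    using pos_semidef_tr[OF assms(1), of C] assms(2)
    by (simp add: mat_simps tr_smult)
qed

lemma pos_semidef_zero: "pos_semidef_mat (0\<^sub>m n n)"
  by (rule pos_semidefI) (auto simp: mat_simps)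

lemma pos_def_one: "pos_def_mat (1\<^sub>m n)"
  by (rule pos_defI) (auto simp: mat_simps fnorm2_tr fnorm2_eq_0 order_less_le)

lemma mat_inv_exists:
  assumes "A \<in> carrier_mat n n" "det A \<noteq> 0"
  shows "A * mat_inv A = 1\<^sub>m n" "mat_inv A * A = 1\<^sub>m n" "mat_inv A \<in> carrier_mat n n"
proof -
  obtain B where "mat_inverse A = Some B"
    using mat_inverse(1)[OF assms(1), of "undefined :: unit"] det_non_zero_imp_unit[OF assms, of "undefined :: unit"] by blast
  with mat_inverse(2)[OF assms(1) this]
  show "A * mat_inv A = 1\<^sub>m n" "mat_inv A * A = 1\<^sub>m n" "mat_inv A \<in> carrier_mat n n"
    by (auto simp: mat_inv_def)
qed

section \<open>Determinants of positive definite matrices\<close>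

text \<open>Schur triangularisation: determinant and trace are similarity invariants and can be read
  off the diagonal of the triangular form. Having one list for both reduces inequalities between
  determinant and trace to inequalities between numbers.\<close>

lemma eigenvalue_list_exists:
  fixes A :: "complex mat"
  assumes A: "A \<in> carrier_mat n n"
  obtains as where "length as = n" "det A = prod_list as" "tr A = sum_list as" "\<forall>a\<in>set as. eigenvalue A a"
proof -
  obtain as where cp: "char_poly A = (\<Prod>a\<leftarrow>as. [:- a, 1:])" and len: "length as = n"
    using char_poly_factorized[OF A] by blast
  obtain B P Q where s: "schur_decomposition A as = (B, P, Q)" by (cases "schur_decomposition A as") auto
  from schur_decomposition[OF A cp s]
  have wit: "similar_mat_wit A B P Q" and ut: "upper_triangular B" and dg: "diag_mat B = as" by auto
  note w = similar_mat_witD2[OF A wit]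
  have B: "B \<in> carrier_mat n n" using w by auto
  have "det A = det B"
    by (rule det_similar) (use wit in \<open>auto simp: similar_mat_def\<close>)
  also have "\<dots> = prod_list as"
    using det_upper_triangular[OF ut B] dg by simp
  finally have d: "det A = prod_list as" .
  have dims: "dim_row P = n" "dim_col P = n" "dim_row Q = n" "dim_col Q = n" "dim_row B = n" "dim_col B = n"
    using w by auto
  have "A = P * (B * Q)" using w(3) dims by (simp add: mat_simps)
  then have "tr A = tr (P * (B * Q))" by (rule arg_cong)
  also have "\<dots> = tr (B * Q * P)" using dims by (intro tr_comm) auto
  also have "\<dots> = tr B" using w(2) dims by (simp add: mat_simps)
  also have "\<dots> = sum_list as"
    unfolding dg[symmetric] diag_mat_def mat_trace_def using dims
    by (simp add: interv_sum_list_conv_sum_set_nat atLeast0LessThan)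
  finally have t: "tr A = sum_list as" .
  have "eigenvalue A a" if "a \<in> set as" for a
    using that eigenvalue_root_char_poly[OF A] linear_poly_root[OF that] by (simp add: cp)
  then have "\<forall>a\<in>set as. eigenvalue A a" by (intro ballI)
  from that[OF len d t this] show thesis .
qed

lemma tr_hermitian_real: "adj A = A \<Longrightarrow> tr A = of_real (Re (tr A))"
proof -
  assume "adj A = A"
  moreover from this have "dim_col A = dim_row A" by (metis dim_adj(1))
  ultimately have "cnj (tr A) = tr A" using tr_adj[of A] by simp
  then show ?thesis by (simp add: complex_eq_iff)
qed

text \<open>Eigenvectors are wanted as one-column matrices so that the trace calculus applies to
  them.\<close>

lemma eigenvalue_imp_mat:
  fixes A :: "complex mat"
  assumes A: "A \<in> carrier_mat n n" and e: "eigenvalue A \<mu>"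
  obtains V where "V \<in> carrier_mat n 1" "V \<noteq> 0\<^sub>m n 1" "A * V = \<mu> \<cdot>\<^sub>m V"
proof -
  note [simp] = carrier_matD[OF A]
  obtain v where v: "v \<in> carrier_vec n" "v \<noteq> 0\<^sub>v n" "A *\<^sub>v v = \<mu> \<cdot>\<^sub>v v"
    using e by (auto simp: eigenvalue_def eigenvector_def)
  define V where "V = mat n 1 (\<lambda>(i, _). v $ i)"
  have [simp]: "dim_row V = n" "dim_col V = 1" by (simp_all add: V_def)
  have nz: "V \<noteq> 0\<^sub>m n 1"
    using v by (auto simp: V_def mat_eq_iff vec_eq_iff)
  have "A * V = \<mu> \<cdot>\<^sub>m V"
  proof (rule eq_matI)
    fix i j assume ij: "i < dim_row (\<mu> \<cdot>\<^sub>m V)" "j < dim_col (\<mu> \<cdot>\<^sub>m V)"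
    then have "col V j = v" using v(1) by (auto simp: V_def)
    then have "(A * V) $$ (i, j) = (A *\<^sub>v v) $ i" using ij by (simp add: index_mult_mat(1))
    also have "\<dots> = \<mu> * v $ i" using v ij by simp
    finally show "(A * V) $$ (i, j) = (\<mu> \<cdot>\<^sub>m V) $$ (i, j)" using ij by (simp add: V_def)
  qed auto
  with nz show thesis by (intro that[of V]) auto
qed

text \<open>\<open>X\<close> is the inverse of \<open>A\<close>. The product \<open>X * B\<close>
  need not be Hermitian, but \<open>X * B * V = \<mu> V\<close> means
  \<open>B * V = \<mu> A * V\<close>, so \<mu> is the quotient of the real forms of \<open>B\<close>
  and \<open>A\<close> at \<open>V\<close>. No square root of \<open>A\<close> is involved.\<close>

lemma pos_def_pencil_eigenvalue:
  assumes A: "pos_def_mat A" "A \<in> carrier_mat n n" and X: "X \<in> carrier_mat n n" "A * X = 1\<^sub>m n"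
    and B: "pos_semidef_mat B" "B \<in> carrier_mat n n" and e: "eigenvalue (X * B) \<mu>"
  shows "\<mu> = of_real (Re \<mu>)" "0 \<le> Re \<mu>" "pos_def_mat B \<Longrightarrow> 0 < Re \<mu>"
proof -
  note [simp] = carrier_matD[OF A(2)] carrier_matD[OF X(1)] carrier_matD[OF B(2)]
  have XB: "X * B \<in> carrier_mat n n" by auto
  obtain V where V: "V \<in> carrier_mat n 1" "V \<noteq> 0\<^sub>m n 1" "X * B * V = \<mu> \<cdot>\<^sub>m V"
    by (rule eigenvalue_imp_mat[OF XB e])
  note [simp] = carrier_matD[OF V(1)]
  have nz: "V \<noteq> 0\<^sub>m (dim_row V) (dim_col V)" using V by simp
  from V(3)
have "A * (X * B * V) = \<mu> \<cdot>\<^sub>m (A * V)" by (simp add: mat_simps)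
  moreover have "A * (X * B * V) = (A * X) * (B * V)" by (simp add: mat_assoc)
  ultimately have "B * V = \<mu> \<cdot>\<^sub>m (A * V)" using X by (simp add: mat_simps)
  then have eq: "tr (adj V * B * V) = \<mu> * tr (adj V * A * V)" by (simp add: mat_simps tr_smult)
  have "tr (adj V * B * V) = of_real (Re (tr (adj V * B * V)))" "tr (adj V * A * V) = of_real (Re (tr (adj V * A * V)))"
    using pos_def_adj[OF A(1)] pos_semidef_adj[OF B(1)] by (auto intro!: tr_hermitian_real simp: mat_assoc)
  then obtain a b where ab: "tr (adj V * B * V) = of_real b" "tr (adj V * A * V) = of_real a" by metis
  have "0 < a" using pos_def_tr[OF A(1) _ nz] ab by simp
  with eq ab have \<mu>: "\<mu> = of_real (b / a)" by (simp add: field_simps)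
  have "0 \<le> b" using pos_semidef_tr[OF B(1), of V] ab by simp
  then show "\<mu> = of_real (Re \<mu>)" "0 \<le> Re \<mu>" using \<open>0 < a\<close> unfolding \<mu> by simp_all
  assume "pos_def_mat B"
  from pos_def_tr[OF this _ nz] ab \<mu> \<open>0 < a\<close> show "0 < Re \<mu>" by simp
qed

lemma tr_inverse_semidef_nonneg:
  assumes A: "pos_def_mat A" "A \<in> carrier_mat n n" and X: "X \<in> carrier_mat n n" "A * X = 1\<^sub>m n"
    and B: "pos_semidef_mat B" "B \<in> carrier_mat n n"
  shows "0 \<le> Re (tr (X * B))"
proof -
  have XB: "X * B \<in> carrier_mat n n" using X B by auto
  obtain as where as: "tr (X * B) = sum_list as" "\<forall>a\<in>set as. eigenvalue (X * B) a"
    using eigenvalue_list_exists[OF XB] by metis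
  have "0 \<le> Re (sum_list as)"
    using as(2) pos_def_pencil_eigenvalue(2)[OF A X B] by (induction as) auto
  then show ?thesis using as by simp
qed

text \<open>The scalar bound \<open>ln a <= a - 1\<close>, summed. Reality and positivity of the
  product are carried through the induction because \<open>ln\<close> is applied to a real
  part.\<close>

lemma ln_prod_list_le:
  assumes "\<forall>a\<in>set as. (a::complex) = of_real (Re a) \<and> 0 < Re a"
  shows "prod_list as = of_real (Re (prod_list as)) \<and> 0 < Re (prod_list as) \<and>
    ln (Re (prod_list as)) \<le> Re (sum_list as) - length as"
  using assms
proof (induction as)
  case (Cons a as)
  then have IH: "prod_list as = of_real (Re (prod_list as))" "0 < Re (prod_list as)"
      "ln (Re (prod_list as)) \<le> Re (sum_list as) - length as" and a: "a = of_real (Re a)" "0 < Re a" by auto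
  have p: "prod_list (a # as) = of_real (Re a * Re (prod_list as))"
    using arg_cong2[OF a(1) IH(1), of "(*)"] by simp
  then have "Re (prod_list (a # as)) = Re a * Re (prod_list as)" using arg_cong[OF p, of Re] by simp
  moreover have "ln (Re a * Re (prod_list as)) = ln (Re a) + ln (Re (prod_list as))"
    using a IH by (simp add: ln_mult)
  moreover have "ln (Re a) \<le> Re a - 1" by (rule ln_le_minus_one[OF a(2)])
  ultimately show ?case using p a IH
    by (smt (verit) Re_complex_of_real length_Cons mult_pos_pos of_nat_Suc plus_complex.sel(1) sum_list.Cons)
qed simp

lemma pos_def_pencil_det:
  assumes A: "pos_def_mat A" "A \<in> carrier_mat n n" and X: "X \<in> carrier_mat n n" "A * X = 1\<^sub>m n"
    and B: "pos_def_mat B" "B \<in> carrier_mat n n"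
  shows "det (X * B) = of_real (Re (det (X * B)))" "0 < Re (det (X * B))"
    "ln (Re (det (X * B))) \<le> Re (tr (X * B)) - n"
proof -
  have XB: "X * B \<in> carrier_mat n n" using X B by auto
  obtain as where as: "length as = n" "det (X * B) = prod_list as" "tr (X * B) = sum_list as" "\<forall>a\<in>set as. eigenvalue (X * B) a"
    using eigenvalue_list_exists[OF XB] by metis
  have "\<forall>a\<in>set as. a = of_real (Re a) \<and> 0 < Re a"
    using as(4) pos_def_pencil_eigenvalue(1,3)[OF A X pos_def_imp_semidef[OF B(1)] B(2)] B(1) by auto
  from ln_prod_list_le[OF this]
  show "det (X * B) = of_real (Re (det (X * B)))" "0 < Re (det (X * B))"
    "ln (Re (det (X * B))) \<le> Re (tr (X * B)) - n" using as by auto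
qed

lemma pos_def_det:
  assumes "pos_def_mat A" "A \<in> carrier_mat n n"
  shows "det A = of_real (Re (det A))" "0 < Re (det A)" "det A \<noteq> 0"
proof -
  \<comment> \<open>The pencil with the identity, its own inverse, has \<open>A\<close> itself as
    product.\<close>
  have o: "1\<^sub>m n * 1\<^sub>m n = (1\<^sub>m n :: complex mat)" by simp
  have *: "1\<^sub>m n * A = A" using assms by (simp add: mat_simps)
  show "det A = of_real (Re (det A))" "0 < Re (det A)"
    using pos_def_pencil_det(1,2)[OF pos_def_one one_carrier_mat one_carrier_mat o assms] * by auto
  then show "det A \<noteq> 0" by auto
qed

lemma pos_def_inv:
  assumes "pos_def_mat A" "A \<in> carrier_mat n n"
  shows "A * mat_inv A = 1\<^sub>m n" "mat_inv A * A = 1\<^sub>m n" "mat_inv A \<in> carrier_mat n n"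
  using mat_inv_exists[OF assms(2) pos_def_det(3)[OF assms]] by auto

lemma mat_inv_dim [simp]:
  assumes "pos_def_mat A"
  shows "dim_row (mat_inv A) = dim_row A" "dim_col (mat_inv A) = dim_row A"
proof -
  have "A \<in> carrier_mat (dim_row A) (dim_row A)" by (rule carrier_matI) (simp_all add: pos_def_adj(2)[OF assms])
  from pos_def_inv(3)[OF assms this]
  show "dim_row (mat_inv A) = dim_row A" "dim_col (mat_inv A) = dim_row A" by (rule carrier_matD)+
qed

lemma adj_mat_inv:
  assumes "pos_def_mat A"
  shows "adj (mat_inv A) = mat_inv A"
proof -
  have A: "A \<in> carrier_mat (dim_row A) (dim_row A)" by (rule carrier_matI) (simp_all add: pos_def_adj(2)[OF assms])
  note i = pos_def_inv[OF assms A]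
  note [simp] = mat_inv_dim[OF assms] pos_def_adj[OF assms]
  have "adj (mat_inv A) * A = 1\<^sub>m (dim_row A)"
    using arg_cong[OF i(1), of adj] by simp
  then have "adj (mat_inv A) * A * mat_inv A = mat_inv A" by (simp add: mat_simps)
  then show ?thesis using i(1) by (simp add: mat_simps)
qed

lemma pos_def_mat_inv:
  assumes "pos_def_mat A"
  shows "pos_def_mat (mat_inv A)"
proof (rule pos_defI)
  have A: "A \<in> carrier_mat (dim_row A) (dim_row A)" by (rule carrier_matI) (simp_all add: pos_def_adj(2)[OF assms])
  note i = pos_def_inv[OF assms A]
  note [simp] = mat_inv_dim[OF assms] pos_def_adj[OF assms] adj_mat_inv[OF assms]
  show "adj (mat_inv A) = mat_inv A" by simp
  fix B :: "complex mat" assume B [simp]: "dim_row B = dim_row (mat_inv A)" and nz: "B \<noteq> 0\<^sub>m (dim_row B) (dim_col B)"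
  \<comment> \<open>Substituting \<open>B = A * ?C\<close> turns the form of the inverse at
    \<open>B\<close> into the form of \<open>A\<close> at \<open>?C\<close>.\<close>
  let ?C = "mat_inv A * B"
  have AC: "A * ?C = B" using i(1) B mat_assoc[of A "mat_inv A" B] by (simp add: mat_simps)
  have "?C \<noteq> 0\<^sub>m (dim_row ?C) (dim_col ?C)"
    using AC nz by (metis B mat_inv_dim[OF assms] mat_mult_zero index_mult_mat(2,3) pos_def_adj(2)[OF assms])
  then have "0 < Re (tr (adj ?C * A * ?C))" by (intro pos_def_tr[OF assms]) auto
  also have "adj ?C * A * ?C = adj B * mat_inv A * B"
    using AC by (simp add: mat_assoc)
  finally show "0 < Re (tr (adj B * mat_inv A * B))" .
qed

text \<open>The tangent inequality expressing concavity of \<open>ln det\<close>. Factoring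
  \<open>A\<close> out leaves \<open>ln det (A^-1 B) <= tr (A^-1 B) - n\<close>, which is the bound
  for the eigenvalues of the pencil.\<close>

lemma ln_det_diff_le:
  assumes A: "pos_def_mat A" "A \<in> carrier_mat n n" and B: "pos_def_mat B" "B \<in> carrier_mat n n"
  shows "ln (Re (det B)) - ln (Re (det A)) \<le> Re (tr (mat_inv A * (B - A)))"
proof -
  note i = pos_def_inv[OF A]
  note [simp] = carrier_matD[OF A(2)] carrier_matD[OF B(2)]  carrier_matD[OF i(3)]
  have "det A * det (mat_inv A) = 1" using det_mult[OF A(2) i(3)] i(1) by simp
  then have "det A * det (mat_inv A * B) = det B"
    using det_mult[OF i(3) B(2)] by (metis mult.assoc mult_1)
  moreover have dr: "det (mat_inv A * B) = of_real (Re (det (mat_inv A * B)))" "0 < Re (det (mat_inv A * B))"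
    "ln (Re (det (mat_inv A * B))) \<le> Re (tr (mat_inv A * B)) - n"
    using pos_def_pencil_det[OF A i(3) i(1) B] by auto
  ultimately have "of_real (Re (det A)) * of_real (Re (det (mat_inv A * B))) = det B"
    using pos_def_det(1)[OF A] by simp
  from arg_cong[OF this, of Re] have "Re (det B) = Re (det A) * Re (det (mat_inv A * B))" by simp
  then have "ln (Re (det B)) - ln (Re (det A)) = ln (Re (det (mat_inv A * B)))"
    using pos_def_det(2)[OF A] \<open>0 < Re (det (mat_inv A * B))\<close> by (simp add: ln_mult)
  also have "\<dots> \<le> Re (tr (mat_inv A * B)) - n" by fact
  also have "\<dots> = Re (tr (mat_inv A * (B - A)))" using i by (simp add: mat_simps tr_minus)
  finally show ?thesis .
qed

text \<open>Sylvester's determinant identity. The block matrix \<open>?M\<close> is reduced to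
  triangular form in two ways, by left factors \<open>?U\<close> and \<open>?L\<close> of
  determinant 1.\<close>

lemma det_one_plus_mult_commute:
  fixes A B :: "complex mat"
  assumes A: "A \<in> carrier_mat n m" and B: "B \<in> carrier_mat m n"
  shows "det (1\<^sub>m n + A * B) = det (1\<^sub>m m + B * A)"
proof -
  let ?M = "four_block_mat (1\<^sub>m n) (- A) B (1\<^sub>m m)"
  have c: "- A \<in> carrier_mat n m" "A * B \<in> carrier_mat n n" "B * A \<in> carrier_mat m m" using A B by auto
  let ?U = "four_block_mat (1\<^sub>m n) A (0\<^sub>m m n) (1\<^sub>m m)"
  let ?L = "four_block_mat (1\<^sub>m n) (0\<^sub>m n m) (- B) (1\<^sub>m m)"
  have cU: "?U \<in> carrier_mat (n + m) (n + m)" "?L \<in> carrier_mat (n + m) (n + m)" "?M \<in> carrier_mat (n + m) (n + m)"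
    using A B by (auto intro!: four_block_carrier_mat)
  have zA: "- A + A = 0\<^sub>m n m" "A + - A = 0\<^sub>m n m" "-B + B = 0\<^sub>m m n" using A B by (auto intro!: eq_matI)
  have "?U * ?M = four_block_mat (1\<^sub>m n + A * B) (0\<^sub>m n m) B (1\<^sub>m m)"
    by (subst mult_four_block_mat[of _ n n _ m _ m _ _ n _ m]) (use A B zA c in \<open>auto simp: mat_simps\<close>)
  then have 1: "det ?U * det ?M = det (1\<^sub>m n + A * B)"
    using det_four_block_mat_upper_right_zero[of "1\<^sub>m n + A * B" n "0\<^sub>m n m" m B "1\<^sub>m m"] det_mult[OF cU(1,3)] A B by simp
  have "- B * - A = B * A" using A B by (auto intro!: eq_matI)
  then have "?L * ?M = four_block_mat (1\<^sub>m n) (- A) (0\<^sub>m m n) (1\<^sub>m m + B * A)"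
    by (subst mult_four_block_mat[of _ n n _ m _ m _ _ n _ m]) (use A B zA c comm_add_mat[of "B * A" m m "1\<^sub>m m"] in \<open>auto simp: mat_simps\<close>)
  then have 2: "det ?L * det ?M = det (1\<^sub>m m + B * A)"
    using det_four_block_mat_lower_left_zero[of "1\<^sub>m n" n "- A" m "0\<^sub>m m n" "1\<^sub>m m + B * A"] det_mult[OF cU(2,3)] A B by simp
  have "det ?U = 1" "det ?L = 1"
    using det_four_block_mat_lower_left_zero[of "1\<^sub>m n" n A m "0\<^sub>m m n" "1\<^sub>m m"]
      det_four_block_mat_upper_right_zero[of "1\<^sub>m n" n "0\<^sub>m n m" m "- B" "1\<^sub>m m"] A B by auto
  with 1 2 show ?thesis by simp
qed

section \<open>Generalized inverses\<close>

text \<open>Wedderburn's rank reduction: subtracting \<open>A X A\<close>, with \<open>X\<close> supported at one nonzero entry of \<open>A\<close>,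
  clears a row, and regularity of \<open>A - A X A\<close> implies regularity of \<open>A\<close>.\<close>
lemma generalized_inverse_exists:
  fixes A :: "complex mat"
  shows "\<exists>G\<in>carrier_mat (dim_col A) (dim_row A). A * G * A = A"
proof (induction "card {i. i < dim_row A \<and> (\<exists>j<dim_col A. A $$ (i, j) \<noteq> 0)}" arbitrary: A rule: less_induct)
  case less
  let ?n = "dim_row A" let ?m = "dim_col A"
  show ?case
  proof (cases "A = 0\<^sub>m ?n ?m")
    case True
    have "A * 0\<^sub>m ?m ?n * A = A" by (subst (4) True) (simp add: mat_simps)
    then show ?thesis by (intro bexI[of _ "0\<^sub>m ?m ?n"]) auto
  next
    case False
    then obtain i j where ij: "i < ?n" "j < ?m" "A $$ (i, j) \<noteq> 0" by (auto simp: mat_eq_iff)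
    define X where "X = mat ?m ?n (\<lambda>p. if p = (j, i) then 1 / A $$ (i, j) else 0)"
    have [simp]: "dim_row X = ?m" "dim_col X = ?n" by (auto simp: X_def)
    define B where "B = A - A * X * A"
    have [simp]: "dim_row B = ?n" "dim_col B = ?m" by (auto simp: B_def)
    have AX: "(A * X) $$ (k, l) = (if l = i then A $$ (k, j) / A $$ (i, j) else 0)" if "k < ?n" "l < ?n" for k l
    proof -
      have "(A * X) $$ (k, l) = (\<Sum>a<?m. A $$ (k, a) * X $$ (a, l))"
        using that by (simp add: index_mult)
      also have "\<dots> = (\<Sum>a<?m. if a = j then (if l = i then A $$ (k, j) / A $$ (i, j) else 0) else 0)"
        using that by (intro sum.cong) (auto simp: X_def)
      finally show ?thesis using ij by simp
    qed
    have Bkl: "B $$ (k, l) = A $$ (k, l) - A $$ (k, j) * A $$ (i, l) / A $$ (i, j)" if "k < ?n" "l < ?m" for k l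
    proof -
      have "(A * X * A) $$ (k, l) = (\<Sum>a<?n. (A * X) $$ (k, a) * A $$ (a, l))"
        using that by (simp add: index_mult)
      also have "\<dots> = (\<Sum>a<?n. if a = i then A $$ (k, j) / A $$ (i, j) * A $$ (i, l) else 0)"
        using that by (intro sum.cong) (auto simp: AX)
      finally show ?thesis using ij that by (simp add: B_def)
    qed
    let ?Z = "\<lambda>A. {i. i < dim_row A \<and> (\<exists>j<dim_col A. A $$ (i, j) \<noteq> 0)}"
    \<comment> \<open>The measure is the number of nonzero rows. Entries of row \<open>k\<close> of
      \<open>B\<close> combine entries of row \<open>k\<close> of \<open>A\<close>, so zero rows
      stay zero, while row \<open>i\<close> is cleared.\<close>
    have "?Z B \<subset> ?Z A"
    proof (rule psubsetI)
      show "?Z B \<subseteq> ?Z A"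
      proof
        fix k assume "k \<in> ?Z B"
        then obtain l where "k < ?n" "l < ?m" "B $$ (k, l) \<noteq> 0" by auto
        then have "A $$ (k, l) \<noteq> 0 \<or> A $$ (k, j) \<noteq> 0" using Bkl by auto
        then show "k \<in> ?Z A" using \<open>k < ?n\<close> \<open>l < ?m\<close> ij by auto
      qed
      have "i \<in> ?Z A" "i \<notin> ?Z B" using Bkl ij by auto
      then show "?Z B \<noteq> ?Z A" by blast
    qed
    then have "card (?Z B) < card (?Z A)" by (intro psubset_card_mono) auto
    from less[OF this] obtain G where G: "G \<in> carrier_mat ?m ?n" "B * G * B = B" by auto
    note [simp] = carrier_matD[OF G(1)]
    \<comment> \<open>Since \<open>A (1 - X A)\<close> and \<open>(1 - A X) A\<close> both equal
      \<open>B\<close>, the first summand contributes \<open>B G B = B\<close> between two factors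
      \<open>A\<close>, and the second restores the subtracted \<open>A X A\<close>.\<close>
    let ?G = "(1\<^sub>m ?m - X * A) * G * (1\<^sub>m ?n - A * X) + X"
    have "A * ((1\<^sub>m ?m - X * A) * G * (1\<^sub>m ?n - A * X)) * A = B * G * B"
    proof -
      have "A * (1\<^sub>m ?m - X * A) = B" "(1\<^sub>m ?n - A * X) * A = B" by (simp_all add: B_def mat_simps)
      moreover have "A * ((1\<^sub>m ?m - X * A) * G * (1\<^sub>m ?n - A * X)) * A =
          (A * (1\<^sub>m ?m - X * A)) * G * ((1\<^sub>m ?n - A * X) * A)" by (simp add: mat_assoc)
      ultimately show ?thesis by simp
    qed
    then have "A * ?G * A = B + A * X * A" using G(2) by (simp add: mat_add_mult mat_mult_add)
    also have "\<dots> = A" unfolding B_def by (rule eq_matI) auto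
    finally show ?thesis by (intro bexI[of _ ?G]) auto
  qed
qed

text \<open>The form of \<open>R\<close> at \<open>A * W\<close> vanishes because it is
  \<open>adj W\<close> times the hypothesis. This allows the left factor \<open>adj A * R\<close> to
  be cancelled even when \<open>A\<close> has a kernel.\<close>

lemma weighted_gram_cancel:
  assumes R: "pos_def_mat R" "dim_row R = dim_row A" and d: "dim_row W = dim_col A"
    and z: "adj A * R * (A * W) = 0\<^sub>m (dim_col A) (dim_col W)"
  shows "A * W = 0\<^sub>m (dim_row A) (dim_col W)"
proof (rule ccontr)
  assume n: "A * W \<noteq> 0\<^sub>m (dim_row A) (dim_col W)"
  note [simp] = R(2) d pos_def_adj[OF R(1)]
  have "0 < Re (tr (adj (A * W) * R * (A * W)))"
    by (rule pos_def_tr[OF R(1)]) (use n in auto)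
  also have "adj (A * W) * R * (A * W) = adj W * (adj A * R * (A * W))"
    by (simp add: mat_assoc)
  finally show False using z by (simp add: mat_simps)
qed

text \<open>\<open>A * G * adj A\<close> is the orthogonal projection onto the range of
  \<open>A\<close>, for any generalized inverse \<open>G\<close> of the Gram matrix. The adjoint of
  \<open>G\<close> is such an inverse as well, which gives the symmetry.\<close>

lemma gram_projection_exists:
  fixes A :: "complex mat"
  obtains G where "G \<in> carrier_mat (dim_col A) (dim_col A)"
    "A * G * adj A * A = A" "adj (A * G * adj A) = A * G * adj A"
proof -
  obtain G where G: "G \<in> carrier_mat (dim_col A) (dim_col A)" "(adj A * A) * G * (adj A * A) = adj A * A"
    using generalized_inverse_exists[of "adj A * A"] by auto
  note [simp] = carrier_matD[OF G(1)]
  have gfix: "A * K * adj A * A = A" if K: "K \<in> carrier_mat (dim_col A) (dim_col A)" "(adj A * A) * K * (adj A * A) = adj A * A" for K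
  proof -
    note [simp] = carrier_matD[OF K(1)]
    have "A * (K * (adj A * A) - 1\<^sub>m (dim_col A)) = 0\<^sub>m (dim_row A) (dim_col A)"
      using weighted_gram_cancel[OF pos_def_one[of "dim_row A"], of A "K * (adj A * A) - 1\<^sub>m (dim_col A)"] K(2)
      by (simp add: mat_simps mat_minus_self)
    then have "A * (K * (adj A * A)) = A"
      by (auto simp: mat_simps dest!: mat_minus_eq_zeroD)
    then show ?thesis by (simp add: mat_assoc)
  qed
  have GH: "A * adj G * adj A * A = A"
    using arg_cong[OF G(2), of adj] by (intro gfix) (auto simp: mat_assoc)
  let ?E = "A * G * adj A"
  have "adj ?E * ?E = ?E"
  proof -
    have "adj ?E * ?E = (A * adj G * adj A * A) * (G * adj A)" by (simp add: mat_assoc)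
    also have "\<dots> = ?E" unfolding GH by (simp add: mat_assoc)
    finally show ?thesis .
  qed
  \<comment> \<open>The left side of \<open>adj ?E * ?E = ?E\<close> is Hermitian, hence so is
    \<open>?E\<close>.\<close>
  then have "adj ?E = ?E" by (metis adj_adj adj_mult dim_adj(2))
  then show thesis by (intro that[OF G(1) gfix[OF G]])
qed

text \<open>With \<open>E\<close> and \<open>F\<close> the orthogonal projections onto the column
  space and the row space, \<open>X\<close> has two expressions: one shows \<open>A * X = E\<close>,
  the other \<open>X * A = F\<close>. The Penrose equations are then properties of
  projections.\<close>

lemma pseudoinverse_exists: "\<exists>X. is_pseudoinverse A X"
proof -
  obtain G where G: "G \<in> carrier_mat (dim_col A) (dim_col A)"
    "A * G * adj A * A = A" "adj (A * G * adj A) = A * G * adj A"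
    by (rule gram_projection_exists)
  obtain K where K: "K \<in> carrier_mat (dim_row A) (dim_row A)"
    "adj A * K * A * adj A = adj A" "adj (adj A * K * A) = adj A * K * A"
    using gram_projection_exists[of "adj A"] by auto
  note [simp] = carrier_matD[OF G(1)] carrier_matD[OF K(1)]
  define E where "E = A * G * adj A"
  define F where "F = adj A * K * A"
  have [simp]: "dim_row E = dim_row A" "dim_col E = dim_row A" "dim_row F = dim_col A" "dim_col F = dim_col A"
    by (simp_all add: E_def F_def)
  have EA: "E * A = A" and E: "adj E = E" and F: "adj F = F" and FA: "F * adj A = adj A"
    using G K by (simp_all add: E_def F_def)
  have AF: "A * F = A" using arg_cong[OF FA, of adj] F by simp
  have FF: "F * F = F"
    using mat_assoc_eq[OF FA, of "K * A"] by (simp add: F_def mat_assoc)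
  define X where "X = F * G * adj A"
  have X: "X = adj A * K * E" by (simp add: X_def E_def F_def mat_assoc)
  have [simp]: "dim_row X = dim_col A" "dim_col X = dim_row A" by (simp_all add: X_def)
  have AX: "A * X = E" using mat_assoc_eq[OF AF, of "G * adj A"] by (simp add: X_def E_def mat_assoc)
  have XA: "X * A = F" by (simp add: X F_def EA mat_assoc)
  have "X * A * X = X" unfolding XA using mat_assoc_eq[OF FF, of "G * adj A"] by (simp add: X_def mat_assoc)
  then have "is_pseudoinverse A X"
    unfolding is_pseudoinverse_def using E F EA AX XA by (auto intro!: hermitian_matI)
  then show ?thesis ..
qed

text \<open>\<open>A * X\<close> and \<open>A * Y\<close> are Hermitian projections with the same
  range, so they agree; likewise \<open>X * A\<close> and \<open>Y * A\<close>. Then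
  \<open>X = X A X = X A Y = Y A Y = Y\<close>.\<close>

lemma pseudoinverse_unique:
  assumes "is_pseudoinverse A X" "is_pseudoinverse A Y"
  shows "X = Y"
proof -
  from assms have X: "X \<in> carrier_mat (dim_col A) (dim_row A)" "A * X * A = A" "X * A * X = X" "adj (A * X) = A * X" "adj (X * A) = X * A"
    and Y: "Y \<in> carrier_mat (dim_col A) (dim_row A)" "A * Y * A = A" "Y * A * Y = Y" "adj (A * Y) = A * Y" "adj (Y * A) = Y * A"
    by (auto simp: is_pseudoinverse_def dest: hermitian_matD)
  note [simp] = carrier_matD[OF X(1)] carrier_matD[OF Y(1)]
  have 1: "A * X = A * Y"
  proof -
    have "A * Y * (A * X) = A * X" using Y(2) mat_assoc[of "A * Y" A X] by simp
    then have "adj (A * Y * (A * X)) = A * X" using X(4) by simp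
    then have "A * X * (A * Y) = A * X" using adj_mult[of "A * Y" "A * X"] unfolding X(4) Y(4) by simp
    moreover have "A * X * (A * Y) = A * Y" using X(2) mat_assoc[of "A * X" A Y] by simp
    ultimately show ?thesis by simp
  qed
  have 2: "X * A = Y * A"
  proof -
    have "X * A * (Y * A) = X * A" using Y(2) by (simp add: mat_assoc)
    then have "adj (X * A * (Y * A)) = X * A" using X(5) by simp
    then have "Y * A * (X * A) = X * A" using adj_mult[of "X * A" "Y * A"] unfolding X(5) Y(5) by simp
    moreover have "Y * A * (X * A) = Y * A" using X(2) by (simp add: mat_assoc)
    ultimately show ?thesis by simp
  qed
  have "X = X * (A * X)" using X(3) by (simp add: mat_assoc)
  also have "\<dots> = X * A * Y" unfolding 1 by (simp add: mat_assoc)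
  also have "\<dots> = Y" unfolding 2 by (rule Y(3))
  finally show ?thesis .
qed

lemma pseudoinverse:
  "A * pseudoinverse A * A = A" "pseudoinverse A * A * pseudoinverse A = pseudoinverse A"
  "adj (A * pseudoinverse A) = A * pseudoinverse A" "adj (pseudoinverse A * A) = pseudoinverse A * A"
  and pseudoinverse_dim [simp]: "dim_row (pseudoinverse A) = dim_col A" "dim_col (pseudoinverse A) = dim_row A"
proof -
  have "is_pseudoinverse A (pseudoinverse A)"
    unfolding pseudoinverse_def using pseudoinverse_exists pseudoinverse_unique by (metis theI')
  then show "A * pseudoinverse A * A = A" "pseudoinverse A * A * pseudoinverse A = pseudoinverse A"
    "adj (A * pseudoinverse A) = A * pseudoinverse A" "adj (pseudoinverse A * A) = pseudoinverse A * A"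
    "dim_row (pseudoinverse A) = dim_col A" "dim_col (pseudoinverse A) = dim_row A"
    by (auto simp: is_pseudoinverse_def dest: hermitian_matD)
qed

section \<open>Spectral radius and operator norm\<close>

lemma smult_pow_mat:
  fixes A :: "complex mat"
  assumes "A \<in> carrier_mat n n"
  shows "(c \<cdot>\<^sub>m A) ^\<^sub>m k = c ^ k \<cdot>\<^sub>m (A ^\<^sub>m k)"
proof (induction k)
  case 0
  show ?case using assms by (auto intro!: eq_matI)
next
  case (Suc k)
  then show ?case using assms pow_mat_dim_square[OF assms, of k] by (auto simp: mat_simps intro!: eq_matI)
qed

text \<open>Dividing by \<open>r\<close> brings the spectral radius below 1, where the powers are
  entrywise bounded.\<close>

lemma spectral_radius_power_bound:
  assumes A: "A \<in> carrier_mat n n" "n > 0" and r: "spectral_radius A < r"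
  obtains c where "\<And>k i j. i < n \<Longrightarrow> j < n \<Longrightarrow> cmod ((A ^\<^sub>m k) $$ (i, j)) \<le> c * r ^ k"
proof -
  have "0 \<le> spectral_radius A" using spectral_radius_mem_max(1)[OF A] by auto
  then have r0: "0 < r" using r by simp
  let ?B = "complex_of_real (1 / r) \<cdot>\<^sub>m A"
  have B: "?B \<in> carrier_mat n n" using A by simp
  have "spectral_radius ?B < 1"
  proof -
    obtain \<mu> where \<mu>: "spectral_radius ?B = cmod \<mu>" "eigenvalue ?B \<mu>"
      using spectral_radius_mem_max(1)[OF B A(2)] by (auto simp: spectrum_def)
    then obtain v where v: "v \<in> carrier_vec n" "v \<noteq> 0\<^sub>v n" "?B *\<^sub>v v = \<mu> \<cdot>\<^sub>v v"
      using A by (auto simp: eigenvalue_def eigenvector_def)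
    have "A *\<^sub>v v = (of_real r * \<mu>) \<cdot>\<^sub>v v"
    proof (rule eq_vecI)
      fix i assume i: "i < dim_vec ((complex_of_real r * \<mu>) \<cdot>\<^sub>v v)"
      have "(?B *\<^sub>v v) $ i = of_real (1 / r) * (A *\<^sub>v v) $ i"
        using A v(1) i by (auto simp: scalar_prod_def sum_distrib_left mult.assoc)
      then show "(A *\<^sub>v v) $ i = ((of_real r * \<mu>) \<cdot>\<^sub>v v) $ i"
        using v i r0 by (simp add: field_simps)
    qed (use A v in auto)
    then have "eigenvalue A (of_real r * \<mu>)"
      using v A by (auto simp: eigenvalue_def eigenvector_def)
    then have "cmod (of_real r * \<mu>) \<le> spectral_radius A"
      by (intro spectral_radius_mem_max(2)[OF A]) (auto simp: spectrum_def)
    then have "r * cmod \<mu> \<le> spectral_radius A" using r0 by (simp add: norm_mult)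
    then have "r * cmod \<mu> < r * 1" using r by linarith
    then have "cmod \<mu> < 1" using r0 by (simp only: mult_less_cancel_left_pos)
    then show ?thesis using \<mu>(1) by simp
  qed
  from spectral_radius_jnf_norm_bound_less_1_upper_triangular[OF B this]
  obtain c where c: "\<And>k. norm_bound (?B ^\<^sub>m k) c" by blast
  show thesis
  proof (rule that[of c])
    fix k i j assume ij: "i < n" "j < n"
    have "cmod ((1 / r) ^ k * (A ^\<^sub>m k) $$ (i, j)) \<le> c"
      using c[of k] ij A pow_mat_dim_square[OF A(1), of k] unfolding smult_pow_mat[OF A(1)] norm_bound_def
      by (auto simp: norm_mult norm_power)
    then have "cmod ((A ^\<^sub>m k) $$ (i, j)) / r ^ k \<le> c" using r0 by (simp add: norm_mult norm_power power_divide norm_divide)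
    then show "cmod ((A ^\<^sub>m k) $$ (i, j)) \<le> c * r ^ k" using r0 by (simp add: divide_le_eq)
  qed
qed

lemma pow_mat_Suc_left:
  fixes A :: "complex mat"
  assumes A: "A \<in> carrier_mat n n"
  shows "A ^\<^sub>m Suc k = A * A ^\<^sub>m k"
proof (induction k)
  case 0
  show ?case using A by (simp add: mat_simps)
next
  case (Suc k)
  have "A ^\<^sub>m Suc (Suc k) = A * A ^\<^sub>m k * A" using Suc by simp
  then show ?case using A pow_mat_dim_square[OF A, of k] by (simp add: mat_assoc)
qed

lemma fnorm2_smult: "fnorm2 (c \<cdot>\<^sub>m A) = (cmod c)\<^sup>2 * fnorm2 A"
  by (simp add: fnorm2_def norm_mult power_mult_distrib sum_distrib_left)

lemma of_real_eq_imp_cmod: "complex_of_real x = z \<Longrightarrow> 0 \<le> x \<Longrightarrow> x = cmod z"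
  by auto

lemma fnorm2_gram: "dim_col B = dim_row D \<Longrightarrow> of_real (fnorm2 (B * D)) = tr (adj D * (adj B * B * D))"
  by (simp add: fnorm2_tr[symmetric] mat_assoc)

lemma fnorm2_power_bound:
  assumes C: "C \<in> carrier_mat n n" "n > 0" and r: "spectral_radius C < r" and D: "dim_row D = n"
  obtains K where "\<And>k. fnorm2 (C ^\<^sub>m k * D) \<le> K * (r ^ k)\<^sup>2"
proof -
  obtain c where c: "\<And>k i j. i < n \<Longrightarrow> j < n \<Longrightarrow> cmod ((C ^\<^sub>m k) $$ (i, j)) \<le> c * r ^ k"
    using spectral_radius_power_bound[OF C r] by blast
  define b where "b j = (\<Sum>i<n. c * cmod (D $$ (i, j)))" for j
  show thesis
  proof (rule that[of "\<Sum>i<n. \<Sum>j<dim_col D. (b j)\<^sup>2"])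
    fix k
    have "fnorm2 (C ^\<^sub>m k * D) \<le> (\<Sum>i<n. \<Sum>j<dim_col D. (r ^ k * b j)\<^sup>2)"
      unfolding fnorm2_def index_mult_mat(2,3) pow_mat_dim_square[OF C(1), of k]
    proof (intro sum_mono power_mono)
      fix i j assume ij: "i \<in> {..<n}" "j \<in> {..<dim_col D}"
      have "cmod ((C ^\<^sub>m k * D) $$ (i, j)) \<le> (\<Sum>l<n. cmod ((C ^\<^sub>m k) $$ (i, l)) * cmod (D $$ (l, j)))"
        using ij D pow_mat_dim_square[OF C(1), of k]
        by (subst index_mult) (auto simp: norm_mult intro!: order_trans[OF norm_sum])
      also have "\<dots> \<le> (\<Sum>l<n. c * r ^ k * cmod (D $$ (l, j)))"
        using ij by (intro sum_mono mult_right_mono c) auto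
      also have "\<dots> = r ^ k * b j" by (simp add: b_def sum_distrib_left mult_ac)
      finally show "cmod ((C ^\<^sub>m k * D) $$ (i, j)) \<le> r ^ k * b j" .
    qed auto
    also have "\<dots> = (\<Sum>i<n. \<Sum>j<dim_col D. (b j)\<^sup>2) * (r ^ k)\<^sup>2"
      by (simp add: power_mult_distrib sum_distrib_left sum_distrib_right mult_ac)
    finally show "fnorm2 (C ^\<^sub>m k * D) \<le> (\<Sum>i<n. \<Sum>j<dim_col D. (b j)\<^sup>2) * (r ^ k)\<^sup>2" .
  qed
qed

text \<open>The sequence \<open>\<parallel>C ^ k D\<parallel>\<close> with \<open>C = B\<^sup>H B\<close> is log-convex, so an initial growth ratio
  exceeding the spectral radius of \<open>C\<close> would persist and contradict the growth of the powers of \<open>C\<close>.\<close>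
lemma fnorm2_mult_le_spectral_radius:
  assumes d: "dim_col B = dim_row D" "dim_row D > 0"
  shows "fnorm2 (B * D) \<le> spectral_radius (adj B * B) * fnorm2 D"
proof (rule ccontr)
  define C where "C = adj B * B"
  define n where "n = dim_row D"
  have C: "C \<in> carrier_mat n n" "n > 0" using d by (auto simp: C_def n_def)
  have CH: "adj C = C" by (simp add: C_def)
  let ?\<rho> = "spectral_radius C"
  have \<rho>0: "0 \<le> ?\<rho>" using spectral_radius_mem_max(1)[OF C] by auto
  assume "\<not> fnorm2 (B * D) \<le> spectral_radius (adj B * B) * fnorm2 D"
  then have gt: "?\<rho> * fnorm2 D < fnorm2 (B * D)" by (simp add: C_def)
  define g where "g k = sqrt (fnorm2 (C ^\<^sub>m k * D))" for k
  have g0: "g 0 = sqrt (fnorm2 D)" using C by (simp add: g_def n_def mat_simps)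
  have "C ^\<^sub>m 1 = C" using C(1) by (simp add: mat_one_mult)
  then have g1: "g 1 = sqrt (fnorm2 (C * D))" by (simp only: g_def)
  have g_nonneg [simp]: "0 \<le> g k" for k by (simp add: g_def)
  have Y: "C ^\<^sub>m Suc k * D = C * (C ^\<^sub>m k * D)" for k
    using C(1) pow_mat_dim_square[OF C(1), of k] unfolding pow_mat_Suc_left[OF C(1)] by (simp add: mat_assoc n_def)
  \<comment> \<open>Log-convexity is Cauchy-Schwarz: \<open>C\<close> is Hermitian, so the squared
    norm of \<open>C Z\<close> is the inner product of \<open>Z\<close> with
    \<open>C (C Z)\<close>.\<close>
  have conv: "(g (Suc k))\<^sup>2 \<le> g k * g (Suc (Suc k))" for k
  proof -
    define Z where "Z = C ^\<^sub>m k * D"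
    have [simp]: "dim_row Z = n" "dim_col Z = dim_col D" "dim_row C = n" "dim_col C = n"
      using C(1) pow_mat_dim_square[OF C(1), of k] by (auto simp: Z_def)
    have "of_real (fnorm2 (C * Z)) = tr (adj Z * (C * (C * Z)))"
      using fnorm2_gram[of C Z] CH by (simp add: mat_assoc)
    then have "fnorm2 (C * Z) = cmod (tr (adj Z * (C * (C * Z))))"
      by (rule of_real_eq_imp_cmod) simp
    also have "\<dots> \<le> sqrt (fnorm2 Z) * sqrt (fnorm2 (C * (C * Z)))"
      by (rule tr_cauchy_schwarz) auto
    finally show ?thesis unfolding g_def Y by (simp add: Z_def[symmetric])
  qed
  \<comment> \<open>The same argument with \<open>C = adj B * B\<close> bounds the squared norm of
    \<open>B D\<close> by \<open>g 0 * g 1\<close>, so a violation of the claim makes the first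
    ratio exceed the spectral radius.\<close>
  have "fnorm2 (B * D) \<le> g 0 * g 1"
  proof -
    have "of_real (fnorm2 (B * D)) = tr (adj D * (C * D))"
      using d by (simp add: fnorm2_gram C_def)
    then have "fnorm2 (B * D) = cmod (tr (adj D * (C * D)))"
      by (rule of_real_eq_imp_cmod) simp
    also have "\<dots> \<le> sqrt (fnorm2 D) * sqrt (fnorm2 (C * D))"
      using C(1) by (intro tr_cauchy_schwarz) (auto simp: n_def)
    finally show ?thesis by (simp only: g0 g1)
  qed
  with gt have *: "?\<rho> * (g 0)\<^sup>2 < g 0 * g 1" by (simp add: g0)
  have gp: "0 < g 0" using * by (cases "g 0 = 0") (auto simp: order_less_le)
  define s where "s = g 1 / g 0"
  have s: "?\<rho> < s" using * gp by (simp add: s_def field_simps power2_eq_square)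
  have grow: "0 < g k \<and> s * g k \<le> g (Suc k)" for k
  proof (induction k)
    case 0
    then show ?case using gp by (simp add: s_def)
  next
    case (Suc k)
    then have k: "0 < g k" "s * g k \<le> g (Suc k)" by auto
    have p: "0 < g (Suc k)" using k(2) mult_pos_pos[OF order_le_less_trans[OF \<rho>0 s] k(1)] by linarith
    have "s * g k * g (Suc k) \<le> g (Suc k) * g (Suc k)" using k(2) p by (intro mult_right_mono) auto
    also have "\<dots> \<le> g k * g (Suc (Suc k))" using conv[of k] by (simp add: power2_eq_square)
    finally have "g k * (s * g (Suc k)) \<le> g k * g (Suc (Suc k))" by (simp add: mult_ac)
    then show ?case using k(1) p by simp
  qed
  have s0: "0 < s" using s \<rho>0 by simp
  have lower: "s ^ k * g 0 \<le> g k" for k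
  proof (induction k)
    case (Suc k)
    have "s ^ Suc k * g 0 = s * (s ^ k * g 0)" by simp
    also have "\<dots> \<le> s * g k" using Suc s0 by (intro mult_left_mono) auto
    also have "\<dots> \<le> g (Suc k)" using grow by blast
    finally show ?case .
  qed simp
  \<comment> \<open>The powers are controlled only at rates strictly above the spectral radius; a
    rate that is still below \<open>s\<close> leaves room for the contradiction.\<close>
  obtain r where r: "?\<rho> < r" "r < s" using s dense by blast
  then have r0: "0 < r" using \<rho>0 by simp
  obtain K where K: "\<And>k. fnorm2 (C ^\<^sub>m k * D) \<le> K * (r ^ k)\<^sup>2"
    using fnorm2_power_bound[OF C r(1), of D] n_def by blast
  have "((s / r)\<^sup>2) ^ k * (g 0)\<^sup>2 \<le> K" for k
  proof -
    have "(s ^ k * g 0)\<^sup>2 \<le> (g k)\<^sup>2" using lower[of k] s0 by (intro power_mono) auto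
    also have "\<dots> \<le> K * (r ^ k)\<^sup>2" using K by (simp add: g_def)
    finally show ?thesis using r0
      by (simp add: power_mult_distrib power_divide divide_le_eq power_mult[symmetric] mult.commute)
  qed
  moreover have "1 < (s / r)\<^sup>2" using r r0 by (simp add: one_less_power)
  then obtain k where "K / (g 0)\<^sup>2 < ((s / r)\<^sup>2) ^ k" using real_arch_pow by blast
  then have "K < ((s / r)\<^sup>2) ^ k * (g 0)\<^sup>2" using gp by (simp add: divide_less_eq)
  ultimately show False by (simp add: not_less[symmetric])
qed

text \<open>At a normalised eigenvector of an eigenvalue of largest modulus, the eigenvalue equals
  the squared norm of \<open>B V\<close>, so it is its own modulus. This supplies nonnegativity of
  the spectral radius and turns its maximization into one over unit vectors.\<close>

lemma spectral_radius_gram_attained: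
  assumes "dim_col B > 0"
  obtains V where "V \<in> carrier_mat (dim_col B) 1" "fnorm2 V = 1" "fnorm2 (B * V) = spectral_radius (adj B * B)"
proof -
  let ?C = "adj B * B" let ?n = "dim_col B"
  have C: "?C \<in> carrier_mat ?n ?n" by auto
  obtain \<mu> where \<mu>: "spectral_radius ?C = cmod \<mu>" "eigenvalue ?C \<mu>"
    using spectral_radius_mem_max(1)[OF C assms] by (auto simp: spectrum_def)
  obtain V where V: "V \<in> carrier_mat ?n 1" "V \<noteq> 0\<^sub>m ?n 1" "?C * V = \<mu> \<cdot>\<^sub>m V"
    by (rule eigenvalue_imp_mat[OF C \<mu>(2)])
  note [simp] = carrier_matD[OF V(1)]
  have f: "0 < fnorm2 V" using V fnorm2_eq_0[of V] by (simp add: order_less_le)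
  define W where "W = complex_of_real (1 / sqrt (fnorm2 V)) \<cdot>\<^sub>m V"
  have [simp]: "dim_row W = ?n" "dim_col W = 1" by (auto simp: W_def)
  have W1: "fnorm2 W = 1" using f unfolding W_def fnorm2_smult by (simp add: norm_divide power_divide)
  have CW: "?C * W = \<mu> \<cdot>\<^sub>m W"
    unfolding W_def by (subst mat_mult_smult) (auto simp: V(3) intro!: eq_matI)
  have "complex_of_real (fnorm2 (B * W)) = \<mu> * of_real (fnorm2 W)"
    by (subst fnorm2_gram) (simp_all add: CW mat_mult_smult tr_smult fnorm2_tr)
  then have "complex_of_real (fnorm2 (B * W)) = \<mu>" using W1 by simp
  then have "fnorm2 (B * W) = cmod \<mu>" by (rule of_real_eq_imp_cmod) simp
  then show thesis using W1 \<mu>(1) by (intro that[of W]) auto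
qed

text \<open>Nonnegativity of \<open>s\<close> allows \<open>e <= S e\<close> to be iterated to
  \<open>e <= S^k e\<close>, and the powers of \<open>S\<close> decay geometrically.\<close>

lemma nonneg_subinvariant_eq_0:
  fixes s :: "nat \<Rightarrow> nat \<Rightarrow> real" and e :: "nat \<Rightarrow> real"
  assumes \<rho>: "spectral_radius (mat n n (\<lambda>(i, j). complex_of_real (s i j))) < 1"
    and s: "\<And>i j. i < n \<Longrightarrow> j < n \<Longrightarrow> 0 \<le> s i j"
    and e: "\<And>i. i < n \<Longrightarrow> 0 \<le> e i" and le: "\<And>i. i < n \<Longrightarrow> e i \<le> (\<Sum>j<n. s i j * e j)"
    and i: "i < n"
  shows "e i = 0"
proof -
  define S where "S = mat n n (\<lambda>(i, j). complex_of_real (s i j))"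
  have S: "S \<in> carrier_mat n n" "n > 0" using i by (auto simp: S_def)
  have "0 \<le> spectral_radius S" using spectral_radius_mem_max(1)[OF S] by auto
  moreover have "spectral_radius S < 1" using \<rho> unfolding S_def .
  moreover define r where "r = (spectral_radius S + 1) / 2"
  ultimately have r: "spectral_radius S < r" "r < 1" "0 < r" by auto
  obtain c where c: "\<And>k i j. i < n \<Longrightarrow> j < n \<Longrightarrow> cmod ((S ^\<^sub>m k) $$ (i, j)) \<le> c * r ^ k"
    using spectral_radius_power_bound[OF S r(1)] by blast
  define v where "v = mat n 1 (\<lambda>(i, _). complex_of_real (e i))"
  have [simp]: "dim_row v = n" "dim_col v = 1" "dim_row S = n" "dim_col S = n" by (auto simp: v_def S_def)
  have P [simp]: "dim_row (S ^\<^sub>m k) = n" "dim_col (S ^\<^sub>m k) = n" for k using pow_mat_dim_square[OF S(1)] by auto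
  have below: "e i \<le> Re ((S ^\<^sub>m k * v) $$ (i, 0))" if "i < n" for k i
    using that
  proof (induction k arbitrary: i)
    case 0
    then show ?case by (simp add: mat_simps v_def)
  next
    case (Suc k)
    have "e i \<le> (\<Sum>j<n. s i j * e j)" using le Suc by blast
    also have "\<dots> \<le> (\<Sum>j<n. s i j * Re ((S ^\<^sub>m k * v) $$ (j, 0)))"
      using Suc s by (intro sum_mono mult_left_mono) auto
    also have "\<dots> = Re ((S * (S ^\<^sub>m k * v)) $$ (i, 0))"
      using Suc.prems by (subst index_mult[of i S]) (auto simp: S_def)
    also have "S * (S ^\<^sub>m k * v) = S ^\<^sub>m Suc k * v" unfolding pow_mat_Suc_left[OF S(1)] by (simp add: mat_assoc)
    finally show ?case .
  qed
  have above: "Re ((S ^\<^sub>m k * v) $$ (i, 0)) \<le> c * (\<Sum>j<n. e j) * r ^ k" for k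
  proof -
    have "Re ((S ^\<^sub>m k * v) $$ (i, 0)) \<le> cmod ((S ^\<^sub>m k * v) $$ (i, 0))" by (rule complex_Re_le_cmod)
    also have "\<dots> \<le> (\<Sum>j<n. cmod ((S ^\<^sub>m k) $$ (i, j)) * e j)"
      using i e by (subst index_mult) (auto simp: v_def norm_mult intro!: order_trans[OF norm_sum] sum_mono)
    also have "\<dots> \<le> (\<Sum>j<n. (c * r ^ k) * e j)" using i c e by (intro sum_mono mult_right_mono) auto
    finally show ?thesis by (simp add: sum_distrib_left mult_ac)
  qed
  have b: "e i \<le> c * (\<Sum>j<n. e j) * r ^ k" for k by (rule order_trans[OF below[OF i] above])
  have "(\<lambda>k. c * (\<Sum>j<n. e j) * r ^ k) \<longlonglongrightarrow> c * (\<Sum>j<n. e j) * 0"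
    using r by (intro tendsto_intros LIMSEQ_power_zero) auto
  from tendsto_lowerbound[OF this, of "e i"] have "e i \<le> 0" using b by simp
  then show ?thesis using e[OF i] by simp
qed

section \<open>Brouwer's theorem and variational inequalities\<close>

lemma tendsto_fun_iff: "(f \<longlongrightarrow> l) F \<longleftrightarrow> (\<forall>i. ((\<lambda>x. f x i) \<longlongrightarrow> l i) F)"
  for f :: "'a \<Rightarrow> 'b \<Rightarrow> 'c::topological_space"
  using limitin_componentwise[of "\<lambda>_. euclidean" UNIV f l F]
  by (simp add: euclidean_product_topology)

lemma compact_function_box:
  fixes S :: "'b \<Rightarrow> 'c::topological_space set"
  assumes "\<And>i. compact (S i)"
  shows "compact {x. \<forall>i. x i \<in> S i}"
proof -
  have "compactin (product_topology (\<lambda>_. euclidean) UNIV) (PiE UNIV S)"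
    using assms by (subst compactin_PiE) simp
  then show ?thesis by (simp add: euclidean_product_topology PiE_UNIV_domain Pi_def)
qed

text \<open>Coordinates from \<open>n\<close> on are pinned to 0, which keeps \<open>C\<close>
  compact in the product topology. On the grid of mesh \<open>1 / Suc k\<close>, Kuhn's lemma finds
  a small box in which every coordinate occurs with both labels, that is, with \<open>f\<close>
  moving it up and down. Limits of such boxes are fixed points.\<close>

lemma brouwer_cube_coordinates:
  fixes f :: "(nat \<Rightarrow> real) \<Rightarrow> nat \<Rightarrow> real" and n :: nat
  defines "C \<equiv> {x. \<forall>i. x i \<in> (if i < n then {0..1} else {0})}"
  assumes cont: "\<And>i. i < n \<Longrightarrow> continuous_on C (\<lambda>x. f x i)"
    and f: "\<And>x i. x \<in> C \<Longrightarrow> i < n \<Longrightarrow> f x i \<in> {0..1}"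
  shows "\<exists>x\<in>C. \<forall>i<n. f x i = x i"
proof -
  define emb where "emb k x = (\<lambda>i. if i < n then real (x i) / real (Suc k) else 0)" for k and x :: "nat \<Rightarrow> nat"
  have embC: "emb k x \<in> C" if "\<forall>i<n. x i \<le> Suc k" for k x
    using that by (auto simp: emb_def C_def divide_le_eq)
  \<comment> \<open>The faces get the labels that Kuhn's lemma requires: 0 where the coordinate
    vanishes, 1 where it is maximal. Elsewhere 0 means that \<open>f\<close> increases the
    coordinate strictly.\<close>
  define label where "label k x i = (if x i = 0 \<or> (x i < Suc k \<and> emb k x i < f (emb k x) i) then 0 else 1 :: nat)" for k x i
  have label0: "emb k x i \<le> f (emb k x) i" if "label k x i = 0" "\<forall>i<n. x i \<le> Suc k" "i < n" for k x i
    using that f[OF embC[OF that(2)] that(3)] by (auto simp: label_def emb_def split: if_splits)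
  have label1: "f (emb k x) i \<le> emb k x i" if "label k x i \<noteq> 0" "\<forall>i<n. x i \<le> Suc k" "i < n" for k x i
  proof (cases "x i = Suc k")
    case True
    then show ?thesis using f[OF embC[OF that(2)] that(3)] that(3) by (simp add: emb_def)
  next
    case False
    then show ?thesis using that by (auto simp: label_def le_less split: if_splits)
  qed
  define box where "box k q r \<longleftrightarrow> (\<forall>j<n. q j \<le> r j \<and> r j \<le> q j + 1)" for k :: nat and q r :: "nat \<Rightarrow> nat"
  have "\<exists>q. (\<forall>i<n. q i < Suc k) \<and> (\<forall>i<n. \<exists>r s. box k q r \<and> box k q s \<and> label k r i \<noteq> label k s i)" for k
  proof -
    have 1: "\<forall>x. (\<forall>i<n. x i \<le> Suc k) \<longrightarrow> (\<forall>i<n. label k x i = 0 \<or> label k x i = 1)"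
      "\<forall>x. (\<forall>i<n. x i \<le> Suc k) \<longrightarrow> (\<forall>i<n. x i = 0 \<longrightarrow> label k x i = 0)"
      "\<forall>x. (\<forall>i<n. x i \<le> Suc k) \<longrightarrow> (\<forall>i<n. x i = Suc k \<longrightarrow> label k x i = 1)"
      by (auto simp: label_def)
    show ?thesis by (rule kuhn_lemma[OF zero_less_Suc 1]) (unfold box_def, blast)
  qed
  then obtain q where q: "\<And>k. \<forall>i<n. q k i < Suc k"
      and qrs: "\<And>k. \<forall>i<n. \<exists>r s. box k (q k) r \<and> box k (q k) s \<and> label k r i \<noteq> label k s i"
    by metis
  \<comment> \<open>Orders the two vertices by label, so that one sequence yields the lower and the
    other the upper estimate.\<close>
  have qrs': "\<exists>r s. box k (q k) r \<and> box k (q k) s \<and> label k r i = 0 \<and> label k s i \<noteq> 0" if i: "i < n" for k i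
  proof -
    obtain r s where rs: "box k (q k) r" "box k (q k) s" "label k r i \<noteq> label k s i"
      using qrs i by blast
    show ?thesis
    proof (cases "label k r i = 0")
      case True
      then show ?thesis using rs by metis
    next
      case False
      then have "label k s i = 0" using rs(3) by (auto simp: label_def split: if_splits)
      then show ?thesis using False rs by blast
    qed
  qed
  have cC: "compact C" unfolding C_def by (rule compact_function_box) auto
  have "seq_compact C" using cC by (rule compact_imp_seq_compact)
  moreover have "\<forall>k. emb k (q k) \<in> C" using q by (auto intro!: embC less_imp_le)
  ultimately obtain x \<sigma> where x: "x \<in> C" and \<sigma>: "strict_mono (\<sigma> :: nat \<Rightarrow> nat)" and lim: "((\<lambda>k. emb k (q k)) \<circ> \<sigma>) \<longlonglongrightarrow> x"
    by (rule seq_compactE)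
  \<comment> \<open>The mesh tends to 0, so every choice of vertices from the boxes has the same
    limit.\<close>
  have near: "(\<lambda>k. emb (\<sigma> k) (r k)) \<longlonglongrightarrow> x"
    if r: "\<And>k. box (\<sigma> k) (q (\<sigma> k)) (r k)" for r
    unfolding tendsto_fun_iff
  proof
    fix j
    have a: "(\<lambda>k. emb (\<sigma> k) (q (\<sigma> k)) j) \<longlonglongrightarrow> x j" using lim by (simp add: tendsto_fun_iff o_def)
    have "(\<lambda>k. 1 / real (Suc k)) \<longlonglongrightarrow> 0" using LIMSEQ_inverse_real_of_nat by (simp add: inverse_eq_divide)
    then have b: "(\<lambda>k. 1 / real (Suc (\<sigma> k))) \<longlonglongrightarrow> 0"
      using LIMSEQ_subseq_LIMSEQ[OF _ \<sigma>] by (fastforce simp: o_def)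
    have "(\<lambda>k. emb (\<sigma> k) (r k) j - emb (\<sigma> k) (q (\<sigma> k)) j) \<longlonglongrightarrow> 0"
    proof (rule tendsto_sandwich[OF _ _ tendsto_const b])
      have "0 \<le> emb (\<sigma> k) (r k) j - emb (\<sigma> k) (q (\<sigma> k)) j \<and>
         emb (\<sigma> k) (r k) j - emb (\<sigma> k) (q (\<sigma> k)) j \<le> 1 / real (Suc (\<sigma> k))" for k
      proof (cases "j < n")
        case True
        then have "real (q (\<sigma> k) j) \<le> real (r k j)" "real (r k j) \<le> real (q (\<sigma> k) j) + 1" using r[of k] by (auto simp: box_def)
        then show ?thesis using True
          unfolding emb_def by (simp add: diff_divide_distrib[symmetric] divide_right_mono)
      qed (simp add: emb_def)
      then show "\<forall>\<^sub>F k in sequentially. 0 \<le> emb (\<sigma> k) (r k) j - emb (\<sigma> k) (q (\<sigma> k)) j"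
        "\<forall>\<^sub>F k in sequentially. emb (\<sigma> k) (r k) j - emb (\<sigma> k) (q (\<sigma> k)) j \<le> 1 / real (Suc (\<sigma> k))" by simp_all
    qed
    from tendsto_add[OF this a] show "(\<lambda>k. emb (\<sigma> k) (r k) j) \<longlonglongrightarrow> x j" by simp
  qed
  have "f x i = x i" if i: "i < n" for i
  proof -
    obtain r s where rs: "\<And>k. box k (q k) (r k)" "\<And>k. box k (q k) (s k)"
        "\<And>k. label k (r k) i = 0" "\<And>k. label k (s k) i \<noteq> 0"
      using qrs'[OF i] by metis
    have le: "\<forall>i<n. r k i \<le> Suc k" "\<forall>i<n. s k i \<le> Suc k" for k
      using rs(1,2)[of k] q[of k] by (fastforce simp: box_def)+
    have nr: "(\<lambda>k. emb (\<sigma> k) (r (\<sigma> k))) \<longlonglongrightarrow> x" and ns: "(\<lambda>k. emb (\<sigma> k) (s (\<sigma> k))) \<longlonglongrightarrow> x"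
      using rs(1,2) by (auto intro!: near)
    have lim_f: "(\<lambda>k. f (emb (\<sigma> k) (t (\<sigma> k))) i) \<longlonglongrightarrow> f x i"
      if "(\<lambda>k. emb (\<sigma> k) (t (\<sigma> k))) \<longlonglongrightarrow> x" "\<And>k. \<forall>i<n. t k i \<le> Suc k" for t
      by (rule continuous_on_tendsto_compose[OF cont[OF i] that(1) x]) (use that(2) embC in auto)
    have "x i \<le> f x i"
    proof (rule LIMSEQ_le[OF _ lim_f[OF nr le(1)]])
      show "(\<lambda>k. emb (\<sigma> k) (r (\<sigma> k)) i) \<longlonglongrightarrow> x i" using nr by (simp add: tendsto_fun_iff)
    qed (intro exI allI impI label0 rs(3) le(1) i)
    moreover have "f x i \<le> x i"
    proof (rule LIMSEQ_le[OF lim_f[OF ns le(2)]])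
      show "(\<lambda>k. emb (\<sigma> k) (s (\<sigma> k)) i) \<longlonglongrightarrow> x i" using ns by (simp add: tendsto_fun_iff)
    qed (intro exI allI impI label1 rs(4) le(2) i)
    ultimately show ?thesis by simp
  qed
  then show ?thesis using x by blast
qed

text \<open>Brouwer's theorem is applied to Nash's map on the simplex of weights \<open>t\<close>. The simplex is the image
  of the cube \<open>C\<close> under normalisation by \<open>max 1 (\<Sum> s)\<close>, the last weight being the slack.\<close>
lemma variational_inequality_finite:
  fixes K :: "('b \<Rightarrow> complex) set" and \<phi> :: "('b \<Rightarrow> complex) \<Rightarrow> ('b \<Rightarrow> complex) \<Rightarrow> real" and y :: "nat \<Rightarrow> 'b \<Rightarrow> complex"
  defines "comb \<equiv> \<lambda>n (t :: nat \<Rightarrow> real) y p. \<Sum>i\<le>n. of_real (t i) * (y i p :: complex)"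
  assumes conv: "\<And>t. (\<And>i. i \<le> n \<Longrightarrow> 0 \<le> t i) \<Longrightarrow> (\<Sum>i\<le>n. t i) = 1 \<Longrightarrow> comb n t y \<in> K"
    and cont: "\<And>i. i \<le> n \<Longrightarrow> continuous_on K (\<lambda>x. \<phi> x (y i))"
    and affine: "\<And>x t. x \<in> K \<Longrightarrow> (\<And>i. i \<le> n \<Longrightarrow> 0 \<le> t i) \<Longrightarrow> (\<Sum>i\<le>n. t i) = 1 \<Longrightarrow>
        \<phi> x (comb n t y) = (\<Sum>i\<le>n. t i * \<phi> x (y i))"
    and diag: "\<And>x. x \<in> K \<Longrightarrow> \<phi> x x = 0"
  shows "\<exists>x\<in>K. \<forall>i\<le>n. \<phi> x (y i) \<le> 0"
proof -
  define C where "C = {x :: nat \<Rightarrow> real. \<forall>i. x i \<in> (if i < n then {0..1} else {0})}"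
  define t where "t s i = (if i < n then s i / max 1 (\<Sum>j<n. s j) else 1 - (\<Sum>j<n. s j / max 1 (\<Sum>j<n. s j)))"
    for s :: "nat \<Rightarrow> real" and i
  have sumt: "(\<Sum>i\<le>n. t s i) = 1" for s
    unfolding lessThan_Suc_atMost[symmetric] by (simp add: t_def)
  have t0: "0 \<le> t s i" if "s \<in> C" "i \<le> n" for s i
  proof -
    have s0: "0 \<le> s j" for j using that(1) by (cases "j < n") (auto simp: C_def dest: spec[of _ j])
    have "(\<Sum>j<n. s j / max 1 (\<Sum>j<n. s j)) = (\<Sum>j<n. s j) / max 1 (\<Sum>j<n. s j)"
      by (simp add: sum_divide_distrib)
    also have "\<dots> \<le> 1" by (simp add: divide_le_eq)
    finally show ?thesis using s0 by (auto simp: t_def)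
  qed
  define X where "X s = comb n (t s) y" for s
  have XK: "X s \<in> K" if "s \<in> C" for s using conv[of "t s"] t0[OF that] sumt by (simp add: X_def)
  define g where "g s i = max 0 (\<phi> (X s) (y i))" for s i
  define D where "D s = 1 + (\<Sum>i\<le>n. g s i)" for s
  have g0: "0 \<le> g s i" for s i by (simp add: g_def)
  have D1: "1 \<le> D s" for s by (simp add: D_def g0 sum_nonneg)
  \<comment> \<open>Each weight is increased by the positive part of the gain of its vertex, then
    all are renormalised.\<close>
  define f where "f s i = (t s i + g s i) / D s" for s i
  have coord: "continuous_on C (\<lambda>s. s i)" for i :: nat
    by (rule continuous_on_subset[OF continuous_on_product_coordinates]) simp
  have ct: "continuous_on C (\<lambda>s. t s i)" for i
  proof -
    have "max 1 (\<Sum>j<n. s j) \<noteq> 0" for s :: "nat \<Rightarrow> real" by linarith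
    then show ?thesis unfolding t_def
      by (cases "i < n") (auto intro!: continuous_intros coord)
  qed
  have cX: "continuous_on C X"
    unfolding X_def comb_def
    by (rule continuous_on_coordinatewise_then_product) (intro continuous_intros ct)
  have cg: "continuous_on C (\<lambda>s. g s i)" if "i \<le> n" for i
    unfolding g_def
    by (intro continuous_intros continuous_on_compose2[OF cont[OF that] cX]) (use XK in auto)
  have cf: "continuous_on C (\<lambda>s. f s i)" if "i < n" for i
  proof -
    have "D s \<noteq> 0" for s using D1[of s] by linarith
    then show ?thesis unfolding f_def using that
      by (intro continuous_intros ct cg) (auto simp: D_def intro!: continuous_intros cg)
  qed
  have f0: "0 \<le> f s i" if "s \<in> C" "i \<le> n" for s i
    using t0[OF that] g0[of s i] D1[of s] by (simp add: f_def)
  have sumf: "(\<Sum>i\<le>n. f s i) = 1" for s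
    using D1[of s] by (simp add: f_def sum_divide_distrib[symmetric] sum.distrib sumt D_def[symmetric])
  have f1: "f s i \<le> 1" if "s \<in> C" "i \<le> n" for s i
    using member_le_sum[of i "{..n}" "f s"] that f0 sumf by auto
  obtain s where s: "s \<in> C" "\<forall>i<n. f s i = s i"
    using brouwer_cube_coordinates[of n f] cf f0 f1 unfolding C_def[symmetric] by force
  have sums: "(\<Sum>i<n. s i) \<le> 1"
  proof -
    have "(\<Sum>i<n. s i) = (\<Sum>i<n. f s i)" using s by simp
    also have "\<dots> \<le> (\<Sum>i\<le>n. f s i)" by (rule sum_mono2) (use f0 s in auto)
    finally show ?thesis using sumf by simp
  qed
  \<comment> \<open>At the fixed point the normalisation is inactive, so the weights
    \<open>t s\<close> are the coordinates of \<open>s\<close> and are themselves fixed.\<close>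
  then have m1: "max 1 (\<Sum>i<n. s i) = 1" by simp
  have tf: "t s i = f s i" if "i \<le> n" for i
  proof (cases "i < n")
    case True
    then show ?thesis using s by (simp add: t_def m1)
  next
    case False
    then have i: "i = n" using that by simp
    have "(\<Sum>i<n. t s i) = (\<Sum>i<n. f s i)" using s by (simp add: t_def m1)
    moreover have "(\<Sum>i<n. t s i) + t s n = 1" "(\<Sum>i<n. f s i) + f s n = 1"
      using sumt[of s] sumf[of s] unfolding lessThan_Suc_atMost[symmetric] by simp_all
    ultimately show ?thesis using i by simp
  qed
  define G where "G = (\<Sum>i\<le>n. g s i)"
  have tG: "t s i * G = g s i" if "i \<le> n" for i
  proof -
    have "t s i * D s = t s i + g s i" using tf[OF that] D1[of s] by (simp add: f_def field_simps)
    then show ?thesis by (simp add: D_def G_def algebra_simps)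
  qed
  \<comment> \<open>A fixed point has \<open>t i * G = g i\<close>. If \<open>G > 0\<close>, every
    vertex of positive weight has positive gain, and averaging gives
    \<open>0 = \<phi> x x = G * (sum of squared weights)\<close>, which is impossible for weights of
    sum 1.\<close>
  have "G = 0"
  proof (rule ccontr)
    assume "G \<noteq> 0"
    then have Gp: "0 < G" using g0 by (simp add: G_def order_less_le sum_nonneg)
    have "0 = \<phi> (X s) (X s)" using diag XK[OF s(1)] by simp
    also have "\<dots> = (\<Sum>i\<le>n. t s i * \<phi> (X s) (y i))"
      using affine[OF XK[OF s(1)], of "t s"] t0[OF s(1)] sumt by (simp add: X_def)
    also have "\<dots> = (\<Sum>i\<le>n. t s i * (t s i * G))"
    proof (rule sum.cong)
      fix i assume "i \<in> {..n}"
      then have i: "i \<le> n" by simp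
      show "t s i * \<phi> (X s) (y i) = t s i * (t s i * G)"
      proof (cases "t s i = 0")
        case False
        then have "0 < g s i" using tG[OF i] t0[OF s(1) i] Gp by (metis mult_pos_pos order_less_le)
        then show ?thesis using tG[OF i] by (simp add: g_def max_def split: if_splits)
      qed simp
    qed simp
    also have "\<dots> = G * (\<Sum>i\<le>n. (t s i)\<^sup>2)" by (simp add: sum_distrib_left power2_eq_square mult_ac)
    finally have "(\<Sum>i\<le>n. (t s i)\<^sup>2) = 0" using Gp by simp
    then have "\<forall>i\<le>n. t s i = 0" by (subst (asm) sum_nonneg_eq_0_iff) auto
    then show False using sumt[of s] by simp
  qed
  then have "\<forall>i\<le>n. g s i = 0" using tG by simp
  moreover have "\<phi> (X s) (y i) \<le> g s i" for i by (simp add: g_def)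
  ultimately have "\<forall>i\<le>n. \<phi> (X s) (y i) \<le> 0" by metis
  then show ?thesis using XK[OF s(1)] by blast
qed

text \<open>Each test point \<open>y\<close> cuts out a closed subset of \<open>K\<close>. Finitely
  many of them meet by the preceding lemma, hence all of them meet by compactness.\<close>

lemma variational_inequality:
  fixes K :: "('b::countable \<Rightarrow> complex) set" and \<phi> :: "('b \<Rightarrow> complex) \<Rightarrow> ('b \<Rightarrow> complex) \<Rightarrow> real"
  defines "comb \<equiv> \<lambda>n (t :: nat \<Rightarrow> real) y p. \<Sum>i\<le>n. of_real (t i) * (y i p :: complex)"
  assumes K: "compact K" "K \<noteq> {}"
    and conv: "\<And>n t y. (\<And>i. i \<le> n \<Longrightarrow> y i \<in> K) \<Longrightarrow> (\<And>i. i \<le> n \<Longrightarrow> 0 \<le> t i) \<Longrightarrow> (\<Sum>i\<le>n. t i) = 1 \<Longrightarrow> comb n t y \<in> K"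
    and cont: "\<And>y. y \<in> K \<Longrightarrow> continuous_on K (\<lambda>x. \<phi> x y)"
    and affine: "\<And>x n t y. x \<in> K \<Longrightarrow> (\<And>i. i \<le> n \<Longrightarrow> y i \<in> K) \<Longrightarrow> (\<And>i. i \<le> n \<Longrightarrow> 0 \<le> t i) \<Longrightarrow> (\<Sum>i\<le>n. t i) = 1 \<Longrightarrow>
        \<phi> x (comb n t y) = (\<Sum>i\<le>n. t i * \<phi> x (y i))"
    and diag: "\<And>x. x \<in> K \<Longrightarrow> \<phi> x x = 0"
  shows "\<exists>x\<in>K. \<forall>y\<in>K. \<phi> x y \<le> 0"
proof -
  have "K \<inter> (\<Inter>y\<in>K. {x \<in> K. \<phi> x y \<le> 0}) \<noteq> {}"
  proof (rule compact_imp_fip_image[OF K(1)])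
    fix y assume "y \<in> K"
    then show "closed {x \<in> K. \<phi> x y \<le> 0}"
      by (intro continuous_on_closed_Collect_le cont compact_imp_closed K(1) continuous_intros)
  next
    fix Y assume Y: "finite Y" "Y \<subseteq> K"
    show "K \<inter> (\<Inter>y\<in>Y. {x \<in> K. \<phi> x y \<le> 0}) \<noteq> {}"
    proof (cases "Y = {}")
      case False
      obtain y m where "Y = y ` {i. i < (m :: nat)}" using finite_imp_nat_seg_image_inj_on[OF Y(1)] by metis
      then obtain n where y: "Y = y ` {..n}" using False by (cases m) (auto simp: lessThan_Suc_atMost[symmetric] lessThan_def)
      then have yK: "\<And>i. i \<le> n \<Longrightarrow> y i \<in> K" using Y by auto
      have "\<exists>x\<in>K. \<forall>i\<le>n. \<phi> x (y i) \<le> 0"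
        by (rule variational_inequality_finite) (use yK conv cont affine diag in \<open>auto simp: comb_def\<close>)
      then show ?thesis using y by auto
    qed (use K in auto)
  qed
  then show ?thesis by blast
qed

section \<open>Continuous families of matrices\<close>

text \<open>Dimensions are not part of the type, so a constant size is part of the notion and
  continuity is that of the entries.\<close>

definition continuous_mat_on :: "'a::topological_space set \<Rightarrow> nat \<Rightarrow> nat \<Rightarrow> ('a \<Rightarrow> complex mat) \<Rightarrow> bool" where
  "continuous_mat_on S n m A \<longleftrightarrow> (\<forall>x\<in>S. A x \<in> carrier_mat n m) \<and>
     (\<forall>i<n. \<forall>j<m. continuous_on S (\<lambda>x. A x $$ (i, j)))"

lemma continuous_mat_onI:
  "(\<And>x. x \<in> S \<Longrightarrow> A x \<in> carrier_mat n m) \<Longrightarrow>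
    (\<And>i j. i < n \<Longrightarrow> j < m \<Longrightarrow> continuous_on S (\<lambda>x. A x $$ (i, j))) \<Longrightarrow> continuous_mat_on S n m A"
  by (simp add: continuous_mat_on_def)

lemma continuous_mat_onD:
  assumes "continuous_mat_on S n m A"
  shows "x \<in> S \<Longrightarrow> A x \<in> carrier_mat n m" "i < n \<Longrightarrow> j < m \<Longrightarrow> continuous_on S (\<lambda>x. A x $$ (i, j))"
    "x \<in> S \<Longrightarrow> dim_row (A x) = n" "x \<in> S \<Longrightarrow> dim_col (A x) = m"
  using assms unfolding continuous_mat_on_def by (auto dest: carrier_matD)

lemma continuous_mat_on_const: "A \<in> carrier_mat n m \<Longrightarrow> continuous_mat_on S n m (\<lambda>_. A)"
  by (simp add: continuous_mat_on_def)

lemma continuous_mat_on_mult: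
  assumes A: "continuous_mat_on S n m A" and B: "continuous_mat_on S m k B"
  shows "continuous_mat_on S n k (\<lambda>x. A x * B x)"
proof (rule continuous_mat_onI)
  fix i j assume ij: "i < n" "j < k"
  have "continuous_on S (\<lambda>x. \<Sum>l<m. A x $$ (i, l) * B x $$ (l, j))"
    by (intro continuous_intros continuous_mat_onD(2)[OF A] continuous_mat_onD(2)[OF B]) (use ij in auto)
  then show "continuous_on S (\<lambda>x. (A x * B x) $$ (i, j))"
    by (rule continuous_on_eq) (use ij in \<open>simp add: index_mult continuous_mat_onD(3,4)[OF A] continuous_mat_onD(3,4)[OF B]\<close>)
qed (auto simp: continuous_mat_onD(3,4)[OF A] continuous_mat_onD(3,4)[OF B])

lemma continuous_mat_on_add:
  assumes A: "continuous_mat_on S n m A" and B: "continuous_mat_on S n m B"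
  shows "continuous_mat_on S n m (\<lambda>x. A x + B x)"
proof (rule continuous_mat_onI)
  fix i j assume ij: "i < n" "j < m"
  have "continuous_on S (\<lambda>x. A x $$ (i, j) + B x $$ (i, j))"
    by (intro continuous_intros continuous_mat_onD(2)[OF A] continuous_mat_onD(2)[OF B]) (use ij in auto)
  then show "continuous_on S (\<lambda>x. (A x + B x) $$ (i, j))"
    by (rule continuous_on_eq) (use ij in \<open>simp add: continuous_mat_onD(3,4)[OF A] continuous_mat_onD(3,4)[OF B]\<close>)
qed (auto simp: continuous_mat_onD(3,4)[OF A] continuous_mat_onD(3,4)[OF B])

lemma continuous_mat_on_smult:
  assumes A: "continuous_mat_on S n m A" and c: "continuous_on S c"
  shows "continuous_mat_on S n m (\<lambda>x. c x \<cdot>\<^sub>m A x)"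
proof (rule continuous_mat_onI)
  fix i j assume ij: "i < n" "j < m"
  have "continuous_on S (\<lambda>x. c x * A x $$ (i, j))"
    by (intro continuous_intros continuous_mat_onD(2)[OF A] c) (use ij in auto)
  then show "continuous_on S (\<lambda>x. (c x \<cdot>\<^sub>m A x) $$ (i, j))"
    by (rule continuous_on_eq) (use ij in \<open>simp add: continuous_mat_onD(3,4)[OF A]\<close>)
qed (auto simp: continuous_mat_onD(3,4)[OF A])

lemma continuous_on_det:
  assumes A: "continuous_mat_on S n n A"
  shows "continuous_on S (\<lambda>x. det (A x))"
proof -
  have "continuous_on S (\<lambda>x. \<Sum>p\<in>{p. p permutes {0..<n}}. signof p * (\<Prod>i=0..<n. A x $$ (i, p i)))"
    by (intro continuous_intros continuous_mat_onD(2)[OF A]) (auto simp: permutes_in_image)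
  then show ?thesis by (rule continuous_on_eq) (simp add: det_def'[OF continuous_mat_onD(1)[OF A]])
qed

lemma continuous_on_tr:
  assumes A: "continuous_mat_on S n n A"
  shows "continuous_on S (\<lambda>x. tr (A x))"
proof -
  have "continuous_on S (\<lambda>x. \<Sum>i<n. A x $$ (i, i))"
    by (intro continuous_intros continuous_mat_onD(2)[OF A]) auto
  then show ?thesis by (rule continuous_on_eq) (simp add: mat_trace_def continuous_mat_onD(3)[OF A])
qed

lemma continuous_on_fnorm2:
  assumes A: "continuous_mat_on S n m A"
  shows "continuous_on S (\<lambda>x. fnorm2 (A x))"
proof -
  have "continuous_on S (\<lambda>x. \<Sum>i<n. \<Sum>j<m. (cmod (A x $$ (i, j)))\<^sup>2)"
    by (intro continuous_intros continuous_mat_onD(2)[OF A]) auto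
  then show ?thesis by (rule continuous_on_eq) (simp add: fnorm2_def continuous_mat_onD(3,4)[OF A])
qed

text \<open>Cramer's rule, which reduces continuity of the inverse to continuity of
  determinants.\<close>

lemma mat_inv_cofactor:
  assumes A: "A \<in> carrier_mat n n" "det A \<noteq> 0" and ij: "i < n" "j < n"
  shows "mat_inv A $$ (i, j) = cofactor A j i / det A"
proof -
  note i = mat_inv_exists[OF A]
  note a = adj_mat[OF A(1)]
  note [simp] = carrier_matD[OF A(1)] carrier_matD[OF i(3)] carrier_matD[OF a(1)]
  have "mat_inv A * (A * adj_mat A) = adj_mat A"
    using mat_assoc_eq[OF i(2), of "adj_mat A"] by (simp add: mat_simps)
  then have "adj_mat A = det A \<cdot>\<^sub>m mat_inv A" unfolding a(2) by (simp add: mat_simps)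
  from arg_cong[OF this, of "\<lambda>M. M $$ (i, j)"] ij A(2) show ?thesis
    by (simp add: adj_mat_def field_simps)
qed

lemma continuous_mat_on_inv:
  assumes A: "continuous_mat_on S n n A" and d: "\<And>x. x \<in> S \<Longrightarrow> det (A x) \<noteq> 0"
  shows "continuous_mat_on S n n (\<lambda>x. mat_inv (A x))"
proof (rule continuous_mat_onI)
  fix i j assume ij: "i < n" "j < n"
  have "continuous_mat_on S (n - 1) (n - 1) (\<lambda>x. mat_delete (A x) j i)"
  proof (rule continuous_mat_onI)
    fix k l assume kl: "k < n - 1" "l < n - 1"
    let ?k = "if k < j then k else Suc k" and ?l = "if l < i then l else Suc l"
    have "?k < n" "?l < n" using kl by auto
    from continuous_mat_onD(2)[OF A this]
    show "continuous_on S (\<lambda>x. mat_delete (A x) j i $$ (k, l))"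
      by (rule continuous_on_eq) (use kl in \<open>simp add: mat_delete_def continuous_mat_onD(3,4)[OF A]\<close>)
  qed (simp add: mat_delete_def continuous_mat_onD(3,4)[OF A])
  from continuous_on_det[OF this]
  have "continuous_on S (\<lambda>x. (-1) ^ (j + i) * det (mat_delete (A x) j i) / det (A x))"
    by (intro continuous_intros continuous_on_det[OF A]) (use d in auto)
  then show "continuous_on S (\<lambda>x. mat_inv (A x) $$ (i, j))"
    by (rule continuous_on_eq) (use ij d in \<open>simp add: mat_inv_cofactor[OF continuous_mat_onD(1)[OF A]] cofactor_def\<close>)
qed (rule mat_inv_exists(3)[OF continuous_mat_onD(1)[OF A] d])

section \<open>Rate maximization for one user\<close>

definition psd_trace :: "nat \<Rightarrow> real \<Rightarrow> complex mat set" where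
  "psd_trace n p = {X \<in> carrier_mat n n. pos_semidef_mat X \<and> tr X = complex_of_real p}"

definition total_cov :: "complex mat \<Rightarrow> complex mat \<Rightarrow> complex mat \<Rightarrow> complex mat" where
  "total_cov H R X = R + H * X * adj H"

text \<open>The rate of one user as a function of the own strategy, with the strategies of the
  others absorbed into \<open>R\<close>.\<close>

definition gain :: "complex mat \<Rightarrow> complex mat \<Rightarrow> complex mat \<Rightarrow> real" where
  "gain H R X = ln (Re (det (1\<^sub>m (dim_col H) + adj H * mat_inv R * H * X)))"

definition grad :: "complex mat \<Rightarrow> complex mat \<Rightarrow> complex mat \<Rightarrow> complex mat" where
  "grad H R X = adj H * mat_inv (total_cov H R X) * H"

lemma psd_traceD:
  assumes "X \<in> psd_trace n p"
  shows "pos_semidef_mat X" "tr X = of_real p" "dim_row X = n" "dim_col X = n" "adj X = X" "X \<in> carrier_mat n n"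
  using assms by (auto simp: psd_trace_def pos_semidef_adj)

lemma psd_trace_convex:
  assumes X: "X \<in> psd_trace n p" and Y: "Y \<in> psd_trace n p" and t: "0 \<le> t" "t \<le> 1"
  shows "of_real (1 - t) \<cdot>\<^sub>m X + of_real t \<cdot>\<^sub>m Y \<in> psd_trace n p"
proof -
  note [simp] = psd_traceD(2-4)[OF X] psd_traceD(2-4)[OF Y]
  have "pos_semidef_mat (of_real (1 - t) \<cdot>\<^sub>m X + of_real t \<cdot>\<^sub>m Y)"
    using t by (intro pos_semidef_add pos_semidef_smult psd_traceD(1)[OF X] psd_traceD(1)[OF Y]) auto
  moreover have "tr (of_real (1 - t) \<cdot>\<^sub>m X + of_real t \<cdot>\<^sub>m Y) = of_real p"
    by (simp add: tr_add tr_smult algebra_simps)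
  ultimately show ?thesis unfolding psd_trace_def by (intro CollectI conjI carrier_matI) auto
qed

lemma total_cov:
  assumes H: "H \<in> carrier_mat m n" and R: "pos_def_mat R" "R \<in> carrier_mat m m" and X: "X \<in> psd_trace n p"
  shows "pos_def_mat (total_cov H R X)" "total_cov H R X \<in> carrier_mat m m"
proof -
  note [simp] = psd_traceD(2-4)[OF X] carrier_matD[OF H] carrier_matD[OF R(2)]
  show "pos_def_mat (total_cov H R X)" unfolding total_cov_def
    by (intro pos_def_add_semidef R pos_semidef_congruence psd_traceD(1)[OF X]) auto
  show "total_cov H R X \<in> carrier_mat m m" by (rule carrier_matI) (auto simp: total_cov_def)
qed

text \<open>Sylvester's identity moves the determinant to the receiver side, where multiplication by
  \<open>R\<close> completes the total covariance.\<close>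

lemma gain_eq:
  assumes H: "H \<in> carrier_mat m n" and R: "pos_def_mat R" "R \<in> carrier_mat m m" and X: "X \<in> psd_trace n p"
  shows "gain H R X = ln (Re (det (total_cov H R X))) - ln (Re (det R))"
proof -
  note T = total_cov[OF H R X]
  note i = pos_def_inv[OF R]
  note [simp] = psd_traceD(2-4)[OF X] carrier_matD[OF H] carrier_matD[OF R(2)] carrier_matD[OF i(3)]
  let ?A = "adj H * mat_inv R" and ?B = "H * X"
  have c: "?A \<in> carrier_mat n m" "?B \<in> carrier_mat m n" "1\<^sub>m m + ?B * ?A \<in> carrier_mat m m" by auto
  have "(1\<^sub>m m + ?B * ?A) * R = total_cov H R X"
    using i by (simp add: total_cov_def mat_simps)
  then have "det (1\<^sub>m m + ?B * ?A) * det R = det (total_cov H R X)"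
    using det_mult[OF c(3) R(2)] by simp
  moreover have "1\<^sub>m (dim_col H) + adj H * mat_inv R * H * X = 1\<^sub>m n + ?A * ?B" by (simp add: mat_assoc)
  ultimately have d: "det (1\<^sub>m (dim_col H) + adj H * mat_inv R * H * X) * det R = det (total_cov H R X)"
    using det_one_plus_mult_commute[OF c(1,2)] by simp
  note dR = pos_def_det[OF R] and dT = pos_def_det[OF T]
  have "det (1\<^sub>m (dim_col H) + adj H * mat_inv R * H * X) = det (total_cov H R X) / det R"
    using d dR(3) by (simp add: field_simps)
  also have "\<dots> = of_real (Re (det (total_cov H R X)) / Re (det R))"
    by (subst dR(1), subst dT(1)) simp
  finally show ?thesis unfolding gain_def using dR(2) dT(2) by (simp add: ln_div)
qed

lemma grad:
  assumes H: "H \<in> carrier_mat m n" and R: "pos_def_mat R" "R \<in> carrier_mat m m" and X: "X \<in> psd_trace n p"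
  shows "dim_row (grad H R X) = n" "dim_col (grad H R X) = n" "adj (grad H R X) = grad H R X"
proof -
  note T = total_cov[OF H R X]
  note i = pos_def_inv[OF T] adj_mat_inv[OF T(1)]
  note [simp] = carrier_matD[OF H] carrier_matD[OF i(3)]
  show "dim_row (grad H R X) = n" "dim_col (grad H R X) = n" "adj (grad H R X) = grad H R X"
    by (simp_all add: grad_def i(4) mat_assoc)
qed

lemma gain_diff_le:
  assumes H: "H \<in> carrier_mat m n" and R: "pos_def_mat R" "R \<in> carrier_mat m m"
    and X: "X \<in> psd_trace n p" and Y: "Y \<in> psd_trace n p"
  shows "gain H R Y - gain H R X \<le> Re (tr (grad H R X * (Y - X)))"
proof -
  note TX = total_cov[OF H R X] and TY = total_cov[OF H R Y]
  note i = pos_def_inv[OF TX]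
  note [simp] = psd_traceD(2-4)[OF X] psd_traceD(2-4)[OF Y] carrier_matD[OF H] carrier_matD[OF R(2)] carrier_matD[OF i(3)]
  have "gain H R Y - gain H R X \<le> Re (tr (mat_inv (total_cov H R X) * (total_cov H R Y - total_cov H R X)))"
    unfolding gain_eq[OF H R X] gain_eq[OF H R Y] using ln_det_diff_le[OF TX TY] by simp
  also have "total_cov H R Y - total_cov H R X = H * (Y - X) * adj H"
    unfolding total_cov_def by (simp add: mat_simps) (auto intro!: eq_matI)
  also have "tr (mat_inv (total_cov H R X) * (H * (Y - X) * adj H)) = tr ((mat_inv (total_cov H R X) * H * (Y - X)) * adj H)"
    by (simp add: mat_assoc)
  also have "\<dots> = tr (adj H * (mat_inv (total_cov H R X) * H * (Y - X)))"
    by (rule tr_comm) auto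
  also have "\<dots> = tr (grad H R X * (Y - X))"
    by (simp add: grad_def mat_assoc)
  finally show ?thesis .
qed

text \<open>Sufficiency is the tangent inequality at \<open>X\<close>. For necessity no derivative
  is taken: the tangent inequality at \<open>Z t\<close> on the segment from \<open>X\<close> to
  \<open>Y\<close>, evaluated at the maximizer \<open>X\<close>, has the right sign after division
  by \<open>t\<close>, and the gradient is continuous as \<open>t\<close> tends to 0.\<close>

lemma gain_maximal_iff:
  assumes H: "H \<in> carrier_mat m n" and R: "pos_def_mat R" "R \<in> carrier_mat m m"
    and X: "X \<in> psd_trace n p"
  shows "(\<forall>Y\<in>psd_trace n p. gain H R Y \<le> gain H R X) \<longleftrightarrow>
    (\<forall>Y\<in>psd_trace n p. Re (tr (grad H R X * (Y - X))) \<le> 0)"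
proof (intro iffI ballI)
  fix Y assume "\<forall>Y\<in>psd_trace n p. Re (tr (grad H R X * (Y - X))) \<le> 0" and Y: "Y \<in> psd_trace n p"
  then show "gain H R Y \<le> gain H R X" using gain_diff_le[OF H R X Y] by force
next
  fix Y assume opt: "\<forall>Y\<in>psd_trace n p. gain H R Y \<le> gain H R X" and Y: "Y \<in> psd_trace n p"
  note [simp] = psd_traceD(2-4)[OF X] psd_traceD(2-4)[OF Y] carrier_matD[OF H] carrier_matD[OF R(2)]
  define Z where "Z t = of_real (1 - t) \<cdot>\<^sub>m X + of_real t \<cdot>\<^sub>m Y" for t :: real
  have Z: "Z t \<in> psd_trace n p" if "t \<in> {0..1}" for t unfolding Z_def using that by (intro psd_trace_convex X Y) auto
  have Z0: "Z 0 = X" unfolding Z_def by (auto intro!: eq_matI)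
  have le: "Re (tr (grad H R (Z t) * (Y - X))) \<le> 0" if t: "t \<in> {0<..1}" for t
  proof -
    have tt: "t \<in> {0..1}" using t by auto
    have "0 \<le> gain H R X - gain H R (Z t)" using opt Z[OF tt] by simp
    also have "\<dots> \<le> Re (tr (grad H R (Z t) * (X - Z t)))" by (rule gain_diff_le[OF H R Z[OF tt] X])
    also have "X - Z t = of_real (- t) \<cdot>\<^sub>m (Y - X)"
      unfolding Z_def by (auto intro!: eq_matI simp: algebra_simps)
    also have "Re (tr (grad H R (Z t) * (of_real (- t) \<cdot>\<^sub>m (Y - X)))) = - t * Re (tr (grad H R (Z t) * (Y - X)))"
      using grad[OF H R Z[OF tt]] by (simp add: mat_mult_smult tr_smult)
    finally show ?thesis using t by (simp add: mult_le_0_iff)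
  qed
  have cZ: "continuous_mat_on {0..1} n n Z" unfolding Z_def
    by (intro continuous_mat_on_add continuous_mat_on_smult continuous_mat_on_const continuous_intros psd_traceD(6)[OF X] psd_traceD(6)[OF Y])
  have cT: "continuous_mat_on {0..1} m m (\<lambda>t. total_cov H R (Z t))" unfolding total_cov_def
    by (rule continuous_mat_on_add[OF continuous_mat_on_const[OF R(2)]])
       (rule continuous_mat_on_mult[OF continuous_mat_on_mult[OF continuous_mat_on_const[OF H] cZ] continuous_mat_on_const[OF adj_carrier[OF H]]])
  have cI: "continuous_mat_on {0..1} m m (\<lambda>t. mat_inv (total_cov H R (Z t)))"
    by (rule continuous_mat_on_inv[OF cT]) (use pos_def_det(3)[OF total_cov[OF H R Z]] in auto)
  have c: "continuous_on {0..1} (\<lambda>t. tr (grad H R (Z t) * (Y - X)))"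
    unfolding grad_def
    by (rule continuous_on_tr[of _ n], rule continuous_mat_on_mult[of _ n n],
       rule continuous_mat_on_mult[OF continuous_mat_on_mult[OF continuous_mat_on_const[OF adj_carrier[OF H]] cI] continuous_mat_on_const[OF H]],
       rule continuous_mat_on_const) auto
  have l: "(\<lambda>k. 1 / real (Suc k)) \<longlonglongrightarrow> 0" using LIMSEQ_inverse_real_of_nat by (simp add: inverse_eq_divide)
  have "(\<lambda>k. tr (grad H R (Z (1 / real (Suc k))) * (Y - X))) \<longlonglongrightarrow> tr (grad H R (Z 0) * (Y - X))"
    by (rule continuous_on_tendsto_compose[OF c l]) auto
  then have "(\<lambda>k. Re (tr (grad H R (Z (1 / real (Suc k))) * (Y - X)))) \<longlonglongrightarrow> Re (tr (grad H R (Z 0) * (Y - X)))"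
    by (rule tendsto_Re)
  from tendsto_upperbound[OF this, of 0] show "Re (tr (grad H R X * (Y - X))) \<le> 0"
    using le by (simp add: Z0)
qed

section \<open>Multiplier of the trace constraint\<close>

lemma nonneg_if_perturbed_nonneg:
  fixes a b :: real
  assumes "\<And>\<delta>. 0 < \<delta> \<Longrightarrow> 0 \<le> a + \<delta> * b"
  shows "0 \<le> a"
proof (rule ccontr)
  assume a: "\<not> 0 \<le> a"
  \<comment> \<open>Small enough that the perturbation takes up at most half of the gap below
    0.\<close>
  define \<delta> where "\<delta> = - a / (2 * (\<bar>b\<bar> + 1))"
  have \<delta>: "0 < \<delta>" unfolding \<delta>_def using a by (intro divide_pos_pos) auto
  have "\<delta> * b \<le> \<delta> * (\<bar>b\<bar> + 1)" using \<delta> by (intro mult_left_mono) auto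
  also have "\<dots> = - a / 2" by (simp add: \<delta>_def field_simps)
  finally show False using assms[OF \<delta>] a by simp
qed

lemma linear_coeff_zero_if_nonneg:
  fixes a c :: real
  assumes "\<And>\<epsilon>. 0 \<le> \<epsilon> * a + \<epsilon>\<^sup>2 * c"
  shows "a = 0"
proof -
  have "0 \<le> a"
  proof (rule nonneg_if_perturbed_nonneg)
    fix \<delta> :: real assume "0 < \<delta>"
    then show "0 \<le> a + \<delta> * c" using assms[of \<delta>]
      by (simp add: power2_eq_square mult.assoc distrib_left[symmetric] zero_le_mult_iff)
  qed
  moreover have "0 \<le> - a"
  proof (rule nonneg_if_perturbed_nonneg)
    fix \<delta> :: real assume "0 < \<delta>"
    moreover have "0 \<le> \<delta> * (- a + \<delta> * c)" using assms[of "- \<delta>"] by (simp add: power2_eq_square algebra_simps)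
    ultimately show "0 \<le> - a + \<delta> * c" by (simp add: zero_le_mult_iff)
  qed
  ultimately show ?thesis by simp
qed

text \<open>The multiplier \<open>\<mu>\<close> of the trace constraint. Complementary slackness is extracted by testing
  with \<open>(1 + \<epsilon>K) X (1 + \<epsilon>K)\<^sup>H\<close>, which avoids matrix square roots.\<close>
lemma gradient_kkt:
  assumes G: "adj G = G" "dim_row G = n" and X: "X \<in> psd_trace n p" and p: "0 < p" and n: "0 < n"
    and vi: "\<And>Y. Y \<in> psd_trace n p \<Longrightarrow> Re (tr (G * (Y - X))) \<le> 0"
  obtains \<mu> :: real where "G * X = of_real \<mu> \<cdot>\<^sub>m X"
    "\<And>Y. pos_semidef_mat Y \<Longrightarrow> Y \<in> carrier_mat n n \<Longrightarrow> 0 \<le> Re (tr ((of_real \<mu> \<cdot>\<^sub>m 1\<^sub>m n - G) * Y))"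
proof -
  note XD = psd_traceD[OF X]
  have Gc: "dim_col G = n" using G by (metis dim_adj(1))
  note [simp] = XD(2-5) G Gc
  \<comment> \<open>The value for which \<open>tr (N * X)\<close> has real part 0, since
    \<open>X\<close> has trace \<open>p\<close>.\<close>
  define \<mu> where "\<mu> = Re (tr (G * X)) / p"
  define N where "N = complex_of_real \<mu> \<cdot>\<^sub>m 1\<^sub>m n - G"
  have [simp]: "dim_row N = n" "dim_col N = n" "adj N = N" by (simp_all add: N_def)
  have trN: "Re (tr (N * Y)) = \<mu> * Re (tr Y) - Re (tr (G * Y))" if "Y \<in> carrier_mat n n" for Y
    using that by (simp add: N_def mat_simps tr_minus tr_smult)
  \<comment> \<open>Rescaled to trace \<open>p\<close>, \<open>Y\<close> becomes a competitor in the
    variational inequality.\<close>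
  have pos: "0 \<le> Re (tr (N * Y))" if Y: "pos_semidef_mat Y" "Y \<in> carrier_mat n n" and \<tau>: "0 < Re (tr Y)" for Y
  proof -
    note [simp] = carrier_matD[OF Y(2)]
    let ?c = "p / Re (tr Y)"
    have "tr Y = of_real (Re (tr Y))" by (rule tr_hermitian_real[OF pos_semidef_adj(1)[OF Y(1)]])
    then have "tr (of_real ?c \<cdot>\<^sub>m Y) = of_real ?c * of_real (Re (tr Y))" by (simp add: tr_smult)
    also have "\<dots> = of_real p" unfolding of_real_mult[symmetric] using \<tau> by simp
    finally have "of_real ?c \<cdot>\<^sub>m Y \<in> psd_trace n p"
      unfolding psd_trace_def using \<tau> p Y by (auto intro!: pos_semidef_smult simp del: of_real_divide)
    from vi[OF this] have "?c * Re (tr (G * Y)) \<le> Re (tr (G * X))"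
      by (simp add: mat_simps tr_minus tr_smult del: of_real_divide)
    then have "Re (tr (G * Y)) \<le> \<mu> * Re (tr Y)" using \<tau> p by (simp add: \<mu>_def field_simps)
    then show ?thesis using trN[OF Y(2)] by simp
  qed
  \<comment> \<open>Rescaling needs a positive trace, so a multiple of the identity is added first
    and then let go to 0.\<close>
  have psd: "0 \<le> Re (tr (N * Y))" if Y: "pos_semidef_mat Y" "Y \<in> carrier_mat n n" for Y
  proof (rule nonneg_if_perturbed_nonneg)
    fix \<delta> :: real assume \<delta>: "0 < \<delta>"
    note [simp] = carrier_matD[OF Y(2)]
    have "0 \<le> Re (tr Y)" using pos_semidef_tr[OF Y(1), of "1\<^sub>m n"] by (simp add: mat_simps)
    then have "0 < Re (tr (Y + of_real \<delta> \<cdot>\<^sub>m 1\<^sub>m n))" using \<delta> n by (simp add: tr_add tr_smult add_nonneg_pos)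
    then have "0 \<le> Re (tr (N * (Y + of_real \<delta> \<cdot>\<^sub>m 1\<^sub>m n)))"
      using \<delta> by (intro pos pos_semidef_add Y pos_semidef_smult pos_def_imp_semidef pos_def_one) auto
    then show "0 \<le> Re (tr (N * Y)) + \<delta> * Re (tr N)" by (simp add: mat_simps tr_add tr_smult)
  qed
  have NX: "Re (tr (N * X)) = 0" using trN[OF XD(6)] p by (simp add: \<mu>_def)
  \<comment> \<open>This direction makes the first-order term a norm: both mixed terms have the real
    part of \<open>tr (N K X)\<close>, and \<open>tr (N K X) = tr (X N K) = tr (adj K * K)\<close>.
    Its vanishing forces \<open>N * X = 0\<close>.\<close>
  define K where "K = N * X"
  have [simp]: "dim_row K = n" "dim_col K = n" by (simp_all add: K_def)
  have "Re (tr (N * K * X)) = 0"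
  proof -
    have "2 * Re (tr (N * K * X)) = 0"
    proof (rule linear_coeff_zero_if_nonneg)
      fix \<epsilon> :: real
      let ?B = "1\<^sub>m n + of_real \<epsilon> \<cdot>\<^sub>m K"
      have "0 \<le> Re (tr (N * (?B * X * adj ?B)))"
        by (intro psd pos_semidef_congruence XD) auto
      also have "?B * X * adj ?B = X + of_real \<epsilon> \<cdot>\<^sub>m (K * X + X * adj K) + of_real (\<epsilon>\<^sup>2) \<cdot>\<^sub>m (K * X * adj K)"
        by (simp add: mat_simps) (auto intro!: eq_matI simp: power2_eq_square algebra_simps)
      also have "Re (tr (N * \<dots>)) = Re (tr (N * X)) + \<epsilon> * (Re (tr (N * (K * X))) + Re (tr (N * (X * adj K)))) + \<epsilon>\<^sup>2 * Re (tr (N * (K * X * adj K)))"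
        by (simp add: mat_mult_add mat_mult_smult tr_add tr_smult del: of_real_power)
      also have "tr (N * (X * adj K)) = tr (adj (N * K * X))"
      proof -
        have "tr (adj (N * K * X)) = tr (X * adj K * N)" by (simp add: mat_assoc)
        also have "\<dots> = tr (N * (X * adj K))" by (intro tr_comm) auto
        finally show ?thesis ..
      qed
      also have "Re (tr (adj (N * K * X))) = Re (tr (N * K * X))" by (subst tr_adj) auto
      finally show "0 \<le> \<epsilon> * (2 * Re (tr (N * K * X))) + \<epsilon>\<^sup>2 * Re (tr (N * (K * X * adj K)))"
        by (simp add: NX mat_assoc)
    qed
    then show ?thesis by simp
  qed
  also have "tr (N * K * X) = tr (X * (N * K))" by (intro tr_comm) auto
  also have "X * (N * K) = adj K * K" by (simp add: K_def mat_assoc)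
  finally have "fnorm2 K = 0" by (simp add: fnorm2_tr)
  then have "N * X = 0\<^sub>m n n" by (simp add: fnorm2_eq_0 K_def)
  then have "of_real \<mu> \<cdot>\<^sub>m X - G * X = 0\<^sub>m n n" by (simp add: N_def mat_simps)
  then have "of_real \<mu> \<cdot>\<^sub>m X = G * X" by (rule mat_minus_eq_zeroD) simp_all
  from that[OF this[symmetric] psd[unfolded N_def]] show thesis .
qed

section \<open>Oblique projections and the waterfilling map\<close>

lemma mat_eq_if_mult_vec_eq:
  fixes A B :: "complex mat"
  assumes "dim_row A = n" "dim_row B = n" "dim_col A = m" "dim_col B = m"
    and e: "\<And>v. v \<in> carrier_vec m \<Longrightarrow> A *\<^sub>v v = B *\<^sub>v v"
  shows "A = B"
proof (rule eq_matI)
  fix i j assume ij: "i < dim_row B" "j < dim_col B"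
  have "(A *\<^sub>v unit_vec m j) $ i = (B *\<^sub>v unit_vec m j) $ i" by (simp add: e)
  then show "A $$ (i, j) = B $$ (i, j)" using assms(1-4) ij by (simp add: scalar_prod_right_unit)
qed (use assms in auto)

lemma mat_mult_vec_assoc: "dim_col A = dim_row B \<Longrightarrow> v \<in> carrier_vec (dim_col B) \<Longrightarrow> (A * B) *\<^sub>v v = A *\<^sub>v (B *\<^sub>v v)"
  for A :: "complex mat"
  by (rule assoc_mult_mat_vec[of _ "dim_row A" "dim_col A" _ "dim_col B"]) auto

text \<open>The constraints of the coupling maximization for a given covariance \<open>R\<close>:
  \<open>Pr\<close> projects onto the range of \<open>H\<close> along the kernel of
  \<open>H^H R^-1\<close>.\<close>

definition is_oblique :: "complex mat \<Rightarrow> complex mat \<Rightarrow> complex mat \<Rightarrow> bool" where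
  "is_oblique H R Pr \<longleftrightarrow> Pr \<in> carrier_mat (dim_row H) (dim_row H) \<and> Pr = Pr * Pr \<and>
     mat_range Pr = mat_range H \<and> mat_kernel Pr = mat_kernel (adj H * mat_inv R)"

text \<open>\<open>P\<close> fixes \<open>P' v\<close>, which lies in the common range, and
  annihilates \<open>v - P' v\<close>, which lies in the common kernel; hence
  \<open>P v = P' v\<close>.\<close>

lemma is_oblique_unique:
  assumes P: "is_oblique H R P" and P': "is_oblique H R P'"
  shows "P = P'"
proof -
  let ?m = "dim_row H"
  have c: "P \<in> carrier_mat ?m ?m" "P' \<in> carrier_mat ?m ?m" and i: "P = P * P" "P' = P' * P'"
    and r: "mat_range P' = mat_range P" and k: "mat_kernel P' = mat_kernel P"
    using P P' by (auto simp: is_oblique_def)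
  note [simp] = carrier_matD[OF c(1)] carrier_matD[OF c(2)]
  show ?thesis
  proof (rule mat_eq_if_mult_vec_eq[of _ ?m _ ?m])
    fix v :: "complex vec" assume v: "v \<in> carrier_vec ?m"
    have "P' *\<^sub>v v \<in> mat_range P'" using v by (auto simp: mat_range_def)
    then have "P' *\<^sub>v v \<in> mat_range P" unfolding r .
    then obtain w where w: "w \<in> carrier_vec ?m" "P' *\<^sub>v v = P *\<^sub>v w" by (auto simp: mat_range_def)
    have PP': "P *\<^sub>v (P' *\<^sub>v v) = P' *\<^sub>v v"
    proof -
      have "P *\<^sub>v (P *\<^sub>v w) = (P * P) *\<^sub>v w" using w by (simp add: mat_mult_vec_assoc)
      then show ?thesis using i(1) w by simp
    qed
    have cv: "P' *\<^sub>v v \<in> carrier_vec ?m" by (rule carrier_vecI) simp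
    have "P' *\<^sub>v (P' *\<^sub>v v) = (P' * P') *\<^sub>v v" using v by (simp add: mat_mult_vec_assoc)
    then have "P' *\<^sub>v (P' *\<^sub>v v) = P' *\<^sub>v v" using i(2) by simp
    then have "P' *\<^sub>v (v - P' *\<^sub>v v) = 0\<^sub>v ?m"
      using mult_minus_distrib_mat_vec[OF c(2) v cv] cv by simp
    then have "v - P' *\<^sub>v v \<in> mat_kernel P'" using v cv by (simp add: mat_kernel_def)
    then have "P *\<^sub>v (v - P' *\<^sub>v v) = 0\<^sub>v ?m" unfolding k by (simp add: mat_kernel_def)
    then have z: "P *\<^sub>v v - P' *\<^sub>v v = 0\<^sub>v ?m"
      using mult_minus_distrib_mat_vec[OF c(1) v cv] PP' by simp
    show "P *\<^sub>v v = P' *\<^sub>v v"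
    proof (rule eq_vecI)
      fix i assume i: "i < dim_vec (P' *\<^sub>v v)"
      with arg_cong[OF z, of "\<lambda>x. x $ i"] show "(P *\<^sub>v v) $ i = (P' *\<^sub>v v) $ i" by (simp del: index_mult_mat_vec)
    qed simp
  qed auto
qed

text \<open>\<open>E\<close> is the orthogonal projection onto the row space of \<open>H\<close>.
  The form of \<open>N\<close> is the sum of a weighted square of \<open>H B\<close> and the square
  of \<open>(1 - E) B\<close>; if \<open>H B = 0\<close> then \<open>E B = 0\<close>, so both vanish
  only for \<open>B = 0\<close>. From \<open>N E = M\<close> follows \<open>N^-1 M = E\<close>, so
  \<open>N^-1\<close> serves as a generalized inverse of the possibly singular
  \<open>M\<close>.\<close>

lemma regularized_gram_inverse:
  assumes R: "pos_def_mat R" "R \<in> carrier_mat (dim_row H) (dim_row H)"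
  defines "M \<equiv> adj H * mat_inv R * H" and "E \<equiv> pseudoinverse H * H"
  defines "N \<equiv> M + (1\<^sub>m (dim_col H) - E)"
  shows "pos_def_mat N" "N \<in> carrier_mat (dim_col H) (dim_col H)" "M * mat_inv N * M = M"
proof -
  let ?n = "dim_col H"
  note i = pos_def_inv[OF R] adj_mat_inv[OF R(1)]
  note [simp] = carrier_matD[OF R(2)] carrier_matD[OF i(3)] i(4)
  have [simp]: "dim_row M = ?n" "dim_col M = ?n" "adj M = M" by (simp_all add: M_def mat_assoc)
  have [simp]: "dim_row E = ?n" "dim_col E = ?n" "adj E = E" using pseudoinverse(4)[of H] by (simp_all add: E_def)
  have [simp]: "dim_row N = ?n" "dim_col N = ?n" "adj N = N" by (simp_all add: N_def)
  have HE: "H * E = H" using pseudoinverse(1)[of H] by (simp add: E_def mat_assoc)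
  have EE: "E * E = E" using mat_assoc_eq[OF pseudoinverse(2)[of H], of H] by (simp add: E_def mat_assoc)
  show N: "pos_def_mat N"
  proof (rule pos_defI)
    fix B :: "complex mat" assume [simp]: "dim_row B = dim_row N" and nz: "B \<noteq> 0\<^sub>m (dim_row B) (dim_col B)"
    let ?F = "(1\<^sub>m ?n - E) * B"
    have "adj ?F * ?F = adj B * ((1\<^sub>m ?n - E) * (1\<^sub>m ?n - E)) * B" by (simp add: mat_assoc)
    also have "(1\<^sub>m ?n - E) * (1\<^sub>m ?n - E) = 1\<^sub>m ?n - E" by (simp add: mat_simps EE mat_minus_self) (auto intro!: eq_matI)
    finally have F: "tr (adj B * (1\<^sub>m ?n - E) * B) = of_real (fnorm2 ?F)" by (simp flip: fnorm2_tr)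
    have eq: "tr (adj B * N * B) = tr (adj (H * B) * mat_inv R * (H * B)) + of_real (fnorm2 ?F)"
      unfolding F[symmetric] by (simp add: N_def M_def mat_mult_add mat_add_mult tr_add mat_assoc)
    show "0 < Re (tr (adj B * N * B))"
    proof (cases "H * B = 0\<^sub>m (dim_row (H * B)) (dim_col (H * B))")
      case True
      then have "E * B = 0\<^sub>m ?n (dim_col B)" by (simp add: E_def mat_assoc mat_mult_zero)
      then have "?F = B" by (simp add: mat_simps) (auto intro!: eq_matI)
      then have "0 < fnorm2 ?F" using nz by (simp add: fnorm2_eq_0 order_less_le)
      moreover have "0 \<le> Re (tr (adj (H * B) * mat_inv R * (H * B)))"
        by (rule pos_semidef_tr[OF pos_def_imp_semidef[OF pos_def_mat_inv[OF R(1)]]]) simp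
      ultimately show ?thesis unfolding eq by simp
    next
      case False
      have "0 < Re (tr (adj (H * B) * mat_inv R * (H * B)))"
        by (rule pos_def_tr[OF pos_def_mat_inv[OF R(1)] _ False]) simp
      then show ?thesis unfolding eq by (simp add: add_pos_nonneg)
    qed
  qed simp
  show Nc: "N \<in> carrier_mat ?n ?n" by (rule carrier_matI) simp_all
  note iN = pos_def_inv[OF N Nc]
  note [simp] = carrier_matD[OF iN(3)]
  have ME: "M * E = M" using HE by (simp add: M_def mat_assoc)
  have NE: "N * E = M" by (simp add: N_def mat_simps ME EE mat_minus_self) (auto intro!: eq_matI)
  then have "mat_inv N * M = E" using mat_assoc_eq[OF iN(2), of E] by (simp add: mat_simps)
  then show "M * mat_inv N * M = M" using ME by (simp add: mat_assoc)
qed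

text \<open>The weighted least squares projection. The ordinary inverse of the regularized Gram
  matrix stands where a generalized inverse of the Gram matrix is expected, so continuity in
  \<open>R\<close> is that of a matrix inverse.\<close>

definition oblique :: "complex mat \<Rightarrow> complex mat \<Rightarrow> complex mat" where
  "oblique H R = H * mat_inv (adj H * mat_inv R * H + (1\<^sub>m (dim_col H) - pseudoinverse H * H)) * (adj H * mat_inv R)"

text \<open>With \<open>K = H^H R^-1\<close>, the equations \<open>P H = H\<close> and
  \<open>K P = K\<close> give the range and the kernel. The last claim holds because
  \<open>P R = H G H^H\<close>; it says \<open>P R = R P^H\<close>, which later moves the projection
  across \<open>R\<close>.\<close>

lemma oblique:
  assumes R: "pos_def_mat R" "R \<in> carrier_mat (dim_row H) (dim_row H)"
  shows "is_oblique H R (oblique H R)" "oblique H R * H = H" "H * pseudoinverse H * oblique H R = oblique H R"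
    "adj (oblique H R * R) = oblique H R * R"
proof -
  let ?m = "dim_row H" and ?n = "dim_col H"
  note i = pos_def_inv[OF R] adj_mat_inv[OF R(1)]
  note [simp] = carrier_matD[OF R(2)] carrier_matD[OF i(3)] i(4) pos_def_adj(1)[OF R(1)]
  define M where "M = adj H * mat_inv R * H"
  have [simp]: "dim_row M = ?n" "dim_col M = ?n" by (simp_all add: M_def)
  have MH [simp]: "adj M = M" by (simp add: M_def mat_assoc)
  define G where "G = mat_inv (M + (1\<^sub>m ?n - pseudoinverse H * H))"
  note g = regularized_gram_inverse[OF R, folded M_def]
  note [simp] = carrier_matD[OF pos_def_inv(3)[OF g(1,2)], folded G_def]
  have GH [simp]: "adj G = G" unfolding G_def by (rule adj_mat_inv[OF g(1)])
  have MGM: "M * G * M = M" unfolding G_def by (rule g(3))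
  \<comment> \<open>Multiplied on the left by \<open>H^H R^-1\<close> this is
    \<open>M G M = M\<close>, and that factor can be cancelled.\<close>
  have HGM: "H * (G * M) = H"
  proof -
    have "adj H * mat_inv R * (H * (G * M - 1\<^sub>m ?n)) = M * G * M - M"
      by (simp add: M_def mat_simps)
    also have "\<dots> = 0\<^sub>m ?n ?n" using MGM by (simp add: mat_minus_self)
    finally have "H * (G * M - 1\<^sub>m ?n) = 0\<^sub>m ?m ?n"
      using weighted_gram_cancel[OF pos_def_mat_inv[OF R(1)], of H "G * M - 1\<^sub>m ?n"] by simp
    then have "H * (G * M) - H = 0\<^sub>m ?m ?n" by (simp add: mat_simps)
    then show ?thesis by (rule mat_minus_eq_zeroD) simp_all
  qed
  have MGH: "M * (G * adj H) = adj H" using arg_cong[OF HGM, of adj] by (simp add: mat_assoc)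
  define K where "K = adj H * mat_inv R"
  define P where "P = oblique H R"
  note P_eq = P_def
  have P_def: "P = H * G * K" by (simp add: P_def oblique_def G_def M_def K_def)
  have [simp]: "dim_row K = ?n" "dim_col K = ?m" by (simp_all add: K_def)
  have [simp]: "dim_row P = ?m" "dim_col P = ?m" by (simp_all add: P_def)
  have KH: "K * H = M" by (simp add: K_def M_def)
  have PH: "P * H = H" unfolding P_def using HGM KH by (simp add: mat_assoc)
  have P': "P = H * (G * K)" by (simp add: P_def mat_assoc)
  have PP: "P * P = P"
  proof -
    have "P * P = P * (H * (G * K))" using P' by (rule arg_cong)
    also have "\<dots> = H * (G * K)" by (rule mat_assoc_eq[OF PH]) simp_all
    finally show ?thesis unfolding P' .
  qed
  have KP: "K * P = K"
  proof -
    have "K * P = M * (G * adj H) * mat_inv R" using mat_assoc_eq[OF KH, of "G * K"] by (simp add: P_def K_def mat_assoc)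
    then show ?thesis using MGH by (simp add: K_def)
  qed
  have rng: "mat_range P = mat_range H"
  proof
    show "mat_range P \<subseteq> mat_range H"
    proof
      fix w assume "w \<in> mat_range P"
      then obtain v where v: "v \<in> carrier_vec ?m" "w = P *\<^sub>v v" by (auto simp: mat_range_def)
      have "w = H *\<^sub>v ((G * K) *\<^sub>v v)" using v by (simp add: P_def mat_assoc mat_mult_vec_assoc[symmetric])
      then show "w \<in> mat_range H" unfolding mat_range_def by (auto intro!: carrier_vecI)
    qed
    show "mat_range H \<subseteq> mat_range P"
    proof
      fix w assume "w \<in> mat_range H"
      then obtain v where v: "v \<in> carrier_vec ?n" "w = H *\<^sub>v v" by (auto simp: mat_range_def)
      have "w = P *\<^sub>v (H *\<^sub>v v)" using v PH by (simp add: mat_mult_vec_assoc[symmetric])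
      then show "w \<in> mat_range P" unfolding mat_range_def by (auto intro!: carrier_vecI)
    qed
  qed
  have z: "A *\<^sub>v 0\<^sub>v (dim_col A) = 0\<^sub>v (dim_row A)" for A :: "complex mat" by (auto intro!: eq_vecI simp: scalar_prod_def)
  have ker: "mat_kernel P = mat_kernel K"
  proof (rule subset_antisym; rule subsetI)
    fix v assume "v \<in> mat_kernel P"
    then have v: "v \<in> carrier_vec ?m" "P *\<^sub>v v = 0\<^sub>v ?m" by (auto simp: mat_kernel_def)
    then have "(K * P) *\<^sub>v v = K *\<^sub>v (P *\<^sub>v v)" by (intro mat_mult_vec_assoc) auto
    then have "K *\<^sub>v v = K *\<^sub>v (P *\<^sub>v v)" unfolding KP .
    then show "v \<in> mat_kernel K" using v z[of K] by (simp add: mat_kernel_def)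
  next
    fix v assume "v \<in> mat_kernel K"
    then have v: "v \<in> carrier_vec ?m" "K *\<^sub>v v = 0\<^sub>v ?n" by (auto simp: mat_kernel_def)
    have "P *\<^sub>v v = (H * G) *\<^sub>v (K *\<^sub>v v)" using v by (simp add: P_def mat_mult_vec_assoc)
    then show "v \<in> mat_kernel P" using v z[of "H * G"] by (simp add: mat_kernel_def)
  qed
  have ob: "is_oblique H R P" unfolding is_oblique_def using rng ker PP by (auto simp: K_def)
  have HP: "H * pseudoinverse H * P = P"
    using mat_assoc_eq[OF pseudoinverse(1)[of H], of "G * K"] by (simp add: P_def mat_assoc)
  have "P * R = H * G * adj H" using i(2) by (simp add: P_def K_def mat_simps)
  then have "adj (P * R) = P * R" by (simp add: mat_assoc)
  with ob PH HP show "is_oblique H R (oblique H R)" "oblique H R * H = H" "H * pseudoinverse H * oblique H R = oblique H R"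
    "adj (oblique H R * R) = oblique H R * R" unfolding P_eq by auto
qed

section \<open>Channels of full row rank\<close>

lemma (in vec_space) full_rank_cols_basis:
  assumes A: "A \<in> carrier_mat n nc" and r: "rank A = n"
  obtains B where "B \<in> carrier_mat n n" "det B \<noteq> 0" "set (cols B) \<subseteq> set (cols A)"
proof -
  have "lin_indpt {}" by (simp add: lin_dep_def)
  then obtain S where m: "maximal S (\<lambda>T. T \<subseteq> set (cols A) \<and> lin_indpt T)" and fin: "finite S"
    using maximal_exists_superset[of "set (cols A)" "(\<lambda>T. T \<subseteq> set (cols A) \<and> lin_indpt T)" "{}"] by auto
  then have S: "S \<subseteq> set (cols A)" "lin_indpt S" "card S = n"
    using rank_card_indpt[OF A m] r by (auto simp: maximal_def)
  obtain bs where bs: "set bs = S" "distinct bs" using finite_distinct_list[OF fin] by blast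
  have len: "length bs = n" using bs S(3) distinct_card by fastforce
  have car: "set bs \<subseteq> carrier_vec n" using S(1) bs(1) cols_dim[of A] A by auto
  have cB: "cols (mat_of_cols n bs) = bs" using car by simp
  have B: "mat_of_cols n bs \<in> carrier_mat n n" using len by auto
  have "rank (mat_of_cols n bs) = n"
    by (rule lin_indpt_full_rank[OF B]) (use cB bs S in auto)
  with that[OF B] B cB bs S show thesis by (simp add: det_rank_iff)
qed

text \<open>The columns of \<open>H\<close> contain a basis, on which \<open>P\<close> acts as the
  identity. Applied to the oblique projection, it explains why no projection occurs in the full-rank
  case of the coupling matrix.\<close>

lemma full_rank_left_identity:
  fixes H :: "complex mat"
  assumes P: "P \<in> carrier_mat (dim_row H) (dim_row H)" "P * H = H" and r: "vec_space.rank (dim_row H) H = dim_row H"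
  shows "P = 1\<^sub>m (dim_row H)"
proof -
  let ?m = "dim_row H"
  have "H \<in> carrier_mat ?m (dim_col H)" by simp
  then obtain B where B: "B \<in> carrier_mat ?m ?m" "det B \<noteq> 0" "set (cols B) \<subseteq> set (cols H)"
    using vec_space.full_rank_cols_basis[OF _ r] by metis
  note [simp] = carrier_matD[OF P(1)] carrier_matD[OF B(1)]
  have "P * B = B"
  proof (rule mat_col_eqI)
    fix j assume j: "j < dim_col B"
    then have "col B j \<in> set (cols B)" unfolding cols_def by auto
    then obtain k where k: "k < dim_col H" "col B j = col H k" using B(3) by (auto simp: cols_def)
    have "col (P * B) j = P *\<^sub>v col B j" using j by (auto simp: index_mult_mat(1))
    also have "\<dots> = col (P * H) k" using k by (auto simp: index_mult_mat(1))
    also have "\<dots> = col B j" using P(2) k by simp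
    finally show "col (P * B) j = col B j" .
  qed auto
  then have "P * B * mat_inv B = B * mat_inv B" by simp
  then show ?thesis using mat_inv_exists[OF B(1,2)] by (simp add: mat_simps)
qed

text \<open>\<open>L\<close> is the left inverse of \<open>H\<close> on its row space adapted to \<open>R\<close>; the matrix \<open>L R L\<^sup>H\<close> is the
  pseudoinverse of \<open>H\<^sup>H R\<^sup>-\<^sup>1 H\<close>.\<close>
definition adapted_inverse :: "complex mat \<Rightarrow> complex mat \<Rightarrow> complex mat \<Rightarrow> bool" where
  "adapted_inverse H R L \<longleftrightarrow> dim_row L = dim_col H \<and> dim_col L = dim_row H \<and>
     L * H = pseudoinverse H * H \<and> pseudoinverse H * H * L = L \<and> L * R = L * R * adj L * adj H"

text \<open>For \<open>L = H^# P\<close>, the product \<open>L R L^H H^H\<close> is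
  \<open>H^# P R P^H\<close> because \<open>H H^# P = P\<close>. Then \<open>R P^H = P R\<close> and
  \<open>P P = P\<close> reduce it to \<open>L R\<close>.\<close>

lemma adapted_inverse_oblique:
  assumes R: "pos_def_mat R" "R \<in> carrier_mat (dim_row H) (dim_row H)"
  shows "adapted_inverse H R (pseudoinverse H * oblique H R)"
proof -
  define P where "P = oblique H R"
  have P: "is_oblique H R P" and PH: "P * H = H" and HP: "H * pseudoinverse H * P = P" and PR: "adj (P * R) = P * R"
    unfolding P_def by (rule oblique[OF R])+
  have c: "P \<in> carrier_mat (dim_row H) (dim_row H)" and PP: "P * P = P" using P by (auto simp: is_oblique_def)
  note [simp] = carrier_matD[OF c] carrier_matD[OF R(2)] pos_def_adj(1)[OF R(1)]
  let ?L = "pseudoinverse H * P"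
  have RP: "R * adj P = P * R" using PR by simp
  have "?L * R * adj ?L * adj H = ?L * R * adj (H * pseudoinverse H * P)" by (simp add: mat_assoc)
  also have "\<dots> = pseudoinverse H * (P * (R * adj P))" unfolding HP by (simp add: mat_assoc)
  also have "\<dots> = pseudoinverse H * (P * P * R)" unfolding RP by (simp add: mat_assoc)
  also have "\<dots> = ?L * R" unfolding PP by (simp add: mat_assoc)
  finally have "?L * R = ?L * R * adj ?L * adj H" ..
  moreover have "?L * H = pseudoinverse H * H" using PH by (simp add: mat_assoc)
  moreover have "pseudoinverse H * H * ?L = ?L"
    using mat_assoc_eq[OF pseudoinverse(2)[of H], of P] by (simp add: mat_assoc)
  ultimately show ?thesis unfolding P_def[symmetric] by (simp add: adapted_inverse_def)
qed

text \<open>The mixed products collapse: \<open>L R L'^H = L R L^H\<close> and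
  \<open>L R' L'^H = L' R' L'^H\<close>. Both follow because \<open>L\<close> and \<open>L'\<close>
  invert \<open>H\<close> to the same row space projection, whatever the covariance.\<close>

lemma adapted_inverse_difference:
  assumes R: "adj R = R" "dim_row R = dim_row H" and R': "adj R' = R'" "dim_row R' = dim_row H"
    and L: "adapted_inverse H R L" and L': "adapted_inverse H R' L'"
  shows "L * R * adj L - L' * R' * adj L' = L * (R - R') * adj L'"
proof -
  have [simp]: "dim_col R = dim_row H" "dim_col R' = dim_row H" using R R' by (metis dim_adj(1))+
  have [simp]: "dim_row L = dim_col H" "dim_col L = dim_row H" "dim_row L' = dim_col H" "dim_col L' = dim_row H"
    using L L' by (auto simp: adapted_inverse_def)
  note [simp] = R R'
  let ?E = "pseudoinverse H * H"
  have LH: "L * H = ?E" "L' * H = ?E" and PL: "?E * L = L" "?E * L' = L'"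
    and LR: "L * R = L * R * adj L * adj H" "L' * R' = L' * R' * adj L' * adj H"
    using L L' by (auto simp: adapted_inverse_def)
  have adjL: "adj L * ?E = adj L" using arg_cong[OF PL(1), of adj] pseudoinverse(4)[of H] by simp
  have HL: "adj H * adj L' = ?E" using arg_cong[OF LH(2), of adj] pseudoinverse(4)[of H] by simp
  have 1: "L * R * adj L' = L * R * adj L"
  proof -
    have "L * R * adj L' = (L * R * adj L * adj H) * adj L'" using LR(1) by simp
    also have "\<dots> = L * R * (adj L * ?E)" using HL by (simp add: mat_assoc)
    finally show ?thesis unfolding adjL .
  qed
  have RL: "R' * adj L' = H * (L' * R' * adj L')"
    using arg_cong[OF LR(2), of adj] by (simp add: mat_assoc)
  have 2: "L * R' * adj L' = L' * R' * adj L'"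
  proof -
    have "L * R' * adj L' = (L * H) * (L' * R' * adj L')" using RL by (simp add: mat_assoc)
    also have "\<dots> = ?E * L' * R' * adj L'" unfolding LH by (simp add: mat_assoc)
    finally show ?thesis unfolding PL .
  qed
  show ?thesis using 1 2 by (simp add: mat_minus_mult mat_mult_minus)
qed

text \<open>Positivity of the multiplier makes \<open>X\<close> a multiple of \<open>G X\<close>,
  and the range of \<open>G = H^H T^-1 H\<close> lies in the row space of \<open>H\<close>.\<close>

lemma gradient_eigen_row_space:
  assumes H: "H \<in> carrier_mat m n" and R: "pos_def_mat R" "R \<in> carrier_mat m m" and X: "X \<in> psd_trace n p"
    and kkt: "grad H R X * X = of_real \<mu> \<cdot>\<^sub>m X" and \<mu>: "0 < \<mu>"
  shows "pseudoinverse H * H * X = X"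
proof -
  note T = total_cov[OF H R X]
  note i = pos_def_inv[OF T]
  note [simp] = carrier_matD[OF H] carrier_matD[OF i(3)] psd_traceD(3,4)[OF X]
  let ?G = "grad H R X"
  have [simp]: "dim_row ?G = n" "dim_col ?G = n" using grad[OF H R X] by auto
  have PiH: "pseudoinverse H * H * adj H = adj H"
    using arg_cong[OF pseudoinverse(1)[of H], of adj] pseudoinverse(4)[of H] by (simp add: mat_assoc)
  have PiG: "pseudoinverse H * H * ?G = ?G"
    using mat_assoc_eq[OF PiH, of "mat_inv (total_cov H R X) * H"] by (simp add: grad_def mat_assoc)
  have Xe: "X = of_real (1 / \<mu>) \<cdot>\<^sub>m (?G * X)"
    unfolding kkt using \<mu> by (auto intro!: eq_matI)
  have "pseudoinverse H * H * X = of_real (1 / \<mu>) \<cdot>\<^sub>m (pseudoinverse H * H * (?G * X))"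
    by (subst Xe) (simp add: mat_simps)
  also have "pseudoinverse H * H * (?G * X) = ?G * X"
    using mat_assoc_eq[OF PiG, of X] by simp
  finally show ?thesis using Xe by simp
qed

text \<open>The waterfilling solution is the Frobenius projection of \<open>- L R L\<^sup>H\<close> onto the strategies supported in the
  row space of \<open>H\<close>.\<close>
lemma waterfilling_projection:
  assumes H: "H \<in> carrier_mat m n" and R: "pos_def_mat R" "R \<in> carrier_mat m m"
    and X: "X \<in> psd_trace n p" and Y: "Y \<in> psd_trace n p" and YP: "pseudoinverse H * H * Y = Y"
    and L: "adapted_inverse H R L" and \<mu>: "0 < \<mu>"
    and kkt: "grad H R X * X = of_real \<mu> \<cdot>\<^sub>m X"
      "\<And>Y. pos_semidef_mat Y \<Longrightarrow> Y \<in> carrier_mat n n \<Longrightarrow> 0 \<le> Re (tr ((of_real \<mu> \<cdot>\<^sub>m 1\<^sub>m n - grad H R X) * Y))"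
  shows "0 \<le> Re (tr ((L * R * adj L + X) * (Y - X)))"
proof -
  note T = total_cov[OF H R X]
  note i = pos_def_inv[OF T] adj_mat_inv[OF T(1)]
  note XD = psd_traceD[OF X] and YD = psd_traceD[OF Y]
  define G where "G = grad H R X"
  define E where "E = pseudoinverse H * H"
  define I where "I = mat_inv (total_cov H R X)"
  define c where "c = complex_of_real (1 / \<mu>)"
  define Z where "Z = L * R * adj L + X"
  have dL [simp]: "dim_row L = n" "dim_col L = m"
    using L H by (auto simp: adapted_inverse_def)
  have [simp]: "dim_row I = m" "dim_col I = m" "adj I = I" using i by (auto simp: I_def)
  note [simp] = carrier_matD[OF i(3)]
  have [simp]: "dim_row G = n" "dim_col G = n" "adj G = G" using grad[OF H R X] by (auto simp: G_def)
  have [simp]: "dim_row E = n" "dim_col E = n" "adj E = E" using H pseudoinverse(4)[of H] by (auto simp: E_def)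
  note [simp] = carrier_matD[OF H] carrier_matD[OF R(2)] XD(3-5) YD(3-5) pos_def_adj(1)[OF R(1)]
  have [simp]: "dim_row Z = n" "dim_col Z = n" "adj Z = Z" by (simp_all add: Z_def mat_assoc)
  have LH: "L * H = E" and PL: "E * L = L" and LR: "L * R = L * R * adj L * adj H"
    using L by (auto simp: adapted_inverse_def E_def)
  have HP: "H * E = H" using pseudoinverse(1)[of H] by (simp add: E_def mat_assoc)
  have XP: "E * X = X" unfolding E_def by (rule gradient_eigen_row_space[OF H R X kkt(1) \<mu>])
  have PX: "X * E = X" using arg_cong[OF XP, of adj] by simp
  have GP: "G * E = G" using HP by (simp add: G_def grad_def mat_assoc)
  have PG: "E * G = G" using arg_cong[OF GP, of adj] by simp
  have PZ: "E * Z = Z" using mat_assoc_eq[OF PL, of "R * adj L"] XP by (simp add: Z_def mat_simps)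
  have ZP: "Z * E = Z" using arg_cong[OF PZ, of adj] by simp
  \<comment> \<open>Both summands of \<open>T L^H\<close> begin with \<open>H\<close>: the first by
    \<open>R L^H = H (L R L^H)\<close>, the second by \<open>H^H L^H = E\<close>. With
    \<open>G Z = E\<close> and \<open>Z G = E\<close> below, \<open>Z\<close> is the pseudoinverse
    of the gradient \<open>G\<close>.\<close>
  have HZ: "H * Z = total_cov H R X * adj L"
  proof -
    have "adj H * adj L = E" using arg_cong[OF LH, of adj] by simp
    then have "H * X * adj H * adj L = H * X" using PX by (simp add: mat_assoc)
    moreover have "R * adj L = H * (L * R * adj L)" using arg_cong[OF LR, of adj] by (simp add: mat_assoc)
    ultimately show ?thesis by (simp add: Z_def total_cov_def mat_add_mult mat_mult_add)
  qed
  have GZ: "G * Z = E"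
  proof -
    have "G * Z = adj H * (I * (H * Z))" by (simp add: G_def grad_def I_def[symmetric] mat_assoc)
    also have "I * (H * Z) = adj L" unfolding HZ
      using mat_assoc_eq[OF i(2), of "adj L"] T(2) by (simp add: I_def mat_simps)
    also have "adj H * adj L = E" using arg_cong[OF LH, of adj] by simp
    finally show ?thesis .
  qed
  have ZG: "Z * G = E" using arg_cong[OF GZ, of adj] by simp
  have ZX: "tr (Z * X) = c * p"
  proof -
    have "E * X = of_real \<mu> \<cdot>\<^sub>m (Z * X)"
      using mat_assoc_eq[OF ZG, of X] kkt(1) by (simp add: G_def[symmetric] mat_mult_smult)
    then have "tr (E * X) = tr (of_real \<mu> \<cdot>\<^sub>m (Z * X))" by (rule arg_cong)
    then have "tr X = of_real \<mu> * tr (Z * X)" unfolding XP by (simp add: tr_smult)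
    then show ?thesis using \<mu> XD(2) by (simp add: c_def field_simps)
  qed
  \<comment> \<open>The claim becomes nonnegativity of \<open>tr (W * Y)\<close>. The decomposition
    \<open>Weq\<close> into nonnegative parts is the matrix form of
    \<open>1/g - 1/\<mu> = g (1/g - 1/\<mu>)^2 + (\<mu> - g)/\<mu>^2\<close>, with \<open>g\<close>
    in the role of \<open>G\<close> and \<open>1/g\<close> in that of \<open>Z\<close>.\<close>
  define W where "W = Z - c \<cdot>\<^sub>m E"
  have [simp]: "dim_row W = n" "dim_col W = n" "adj W = W" by (simp_all add: W_def c_def)
  define N where "N = complex_of_real \<mu> \<cdot>\<^sub>m 1\<^sub>m n - G"
  have [simp]: "dim_row N = n" "dim_col N = n" by (simp_all add: N_def)
  have PP: "E * E = E" using pseudoinverse(1)[of H] by (simp add: E_def mat_assoc)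
  have WGW: "W * G * W = Z - c \<cdot>\<^sub>m E - c \<cdot>\<^sub>m E + (c * c) \<cdot>\<^sub>m G"
  proof -
    have "W * G * W = (E - c \<cdot>\<^sub>m G) * (Z - c \<cdot>\<^sub>m E)"
      unfolding W_def by (simp add: mat_minus_mult mat_smult_mult ZG PG)
    also have "\<dots> = Z - c \<cdot>\<^sub>m E - c \<cdot>\<^sub>m E + (c * c) \<cdot>\<^sub>m G"
      by (simp add: mat_minus_mult mat_mult_minus mat_smult_mult mat_mult_smult PZ PP GZ GP)
         (auto intro!: eq_matI simp: algebra_simps)
    finally show ?thesis .
  qed
  have PNP: "E * N * E = of_real \<mu> \<cdot>\<^sub>m E - G"
    by (simp add: N_def mat_simps PP PG GP)
  have Weq: "W = W * G * W + (c * c) \<cdot>\<^sub>m (E * N * E)"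
    unfolding WGW PNP unfolding W_def c_def using \<mu> by (auto intro!: eq_matI simp: field_simps)
  have EY: "E * Y = Y" unfolding E_def by (rule YP)
  have YE: "Y * E = Y" using arg_cong[OF EY, of adj] by simp
  note YP = EY YE
  have t1: "0 \<le> Re (tr (W * G * W * Y))"
  proof -
    have "tr (W * G * W * Y) = tr ((W * adj H) * (I * H * W * Y))" by (simp add: G_def grad_def I_def[symmetric] mat_assoc)
    also have "\<dots> = tr ((I * H * W * Y) * (W * adj H))" by (rule tr_comm) auto
    also have "\<dots> = tr (I * ((H * W) * Y * adj (H * W)))" by (simp add: mat_assoc)
    finally have eq: "tr (W * G * W * Y) = tr (I * ((H * W) * Y * adj (H * W)))" .
    have "pos_semidef_mat ((H * W) * Y * adj (H * W))" by (intro pos_semidef_congruence YD) simp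
    moreover have "(H * W) * Y * adj (H * W) \<in> carrier_mat m m" by (rule carrier_matI) simp_all
    ultimately show ?thesis unfolding eq I_def by (rule tr_inverse_semidef_nonneg[OF T i(3) i(1)])
  qed
  have t2: "0 \<le> Re (tr (E * N * E * Y))"
  proof -
    have "tr (E * N * E * Y) = tr (N * Y * E)" using YP tr_comm[of E "N * Y"] by (simp add: mat_assoc)
    also have "N * Y * E = N * Y" using YP by (simp add: mat_assoc)
    finally show ?thesis using kkt(2)[OF YD(1,6)] by (simp add: N_def G_def)
  qed
  have "tr (W * Y) = tr (W * G * W * Y) + c * c * tr (E * N * E * Y)"
    by (subst Weq) (simp add: mat_add_mult mat_smult_mult tr_add tr_smult)
  moreover have "c * c = of_real (1 / \<mu> * (1 / \<mu>))" by (simp add: c_def)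
  ultimately have "0 \<le> Re (tr (W * Y))" using t1 t2 \<mu> by simp
  moreover have "tr (W * Y) = tr (Z * Y) - c * p"
    using YP YD(2) by (simp add: W_def mat_minus_mult mat_smult_mult tr_minus tr_smult)
  ultimately have "Re (c * p) \<le> Re (tr (Z * Y))" by simp
  then have "0 \<le> Re (tr (Z * Y) - tr (Z * X))" using ZX by simp
  also have "tr (Z * Y) - tr (Z * X) = tr (Z * (Y - X))" by (simp add: mat_mult_minus tr_minus)
  finally show ?thesis by (simp add: Z_def)
qed

section \<open>Sums and bounds\<close>

definition mat_sum :: "nat \<Rightarrow> 'i set \<Rightarrow> ('i \<Rightarrow> complex mat) \<Rightarrow> complex mat" where
  "mat_sum n I f = mat n n (\<lambda>p. \<Sum>r\<in>I. f r $$ p)"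

lemma mat_sum_dim [simp]: "dim_row (mat_sum n I f) = n" "dim_col (mat_sum n I f) = n"
  by (simp_all add: mat_sum_def)

lemma mat_sum_insert:
  assumes "finite I" "r \<notin> I" "f r \<in> carrier_mat n n"
  shows "mat_sum n (insert r I) f = f r + mat_sum n I f"
  using assms by (auto simp: mat_sum_def intro!: eq_matI)

lemma mat_sum_pos_semidef:
  assumes "finite I" "\<And>r. r \<in> I \<Longrightarrow> f r \<in> carrier_mat n n" "\<And>r. r \<in> I \<Longrightarrow> pos_semidef_mat (f r)"
  shows "pos_semidef_mat (mat_sum n I f)"
  using assms
proof (induction I rule: finite_induct)
  case empty
  have "mat_sum n {} f = 0\<^sub>m n n" by (auto simp: mat_sum_def)
  then show ?case by (simp add: pos_semidef_zero)
next
  case (insert r I)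
  then have "dim_row (f r) = n" by auto
  with insert show ?case by (subst mat_sum_insert) (auto intro!: pos_semidef_add)
qed

lemma tr_mult_mat_sum:
  assumes "finite I" "\<And>r. r \<in> I \<Longrightarrow> f r \<in> carrier_mat n n"
    and [simp]: "dim_col A = n" "dim_row B = n" "dim_col B = dim_row A"
  shows "tr (A * mat_sum n I f * B) = (\<Sum>r\<in>I. tr (A * f r * B))"
  using assms(1,2)
proof (induction I rule: finite_induct)
  case empty
  have "mat_sum n {} f = 0\<^sub>m n n" by (auto simp: mat_sum_def)
  then show ?case by (simp add: mat_simps)
next
  case (insert r I)
  then have [simp]: "dim_row (f r) = n" "dim_col (f r) = n" by auto
  from insert show ?case by (subst mat_sum_insert) (simp_all add: mat_mult_add mat_add_mult tr_add)
qed

lemma mat_sum_minus: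
  assumes "\<And>r. r \<in> I \<Longrightarrow> f r \<in> carrier_mat n n" "\<And>r. r \<in> I \<Longrightarrow> g r \<in> carrier_mat n n"
  shows "mat_sum n I f - mat_sum n I g = mat_sum n I (\<lambda>r. f r - g r)"
proof (rule eq_matI)
  fix i j assume "i < dim_row (mat_sum n I (\<lambda>r. f r - g r))" "j < dim_col (mat_sum n I (\<lambda>r. f r - g r))"
  then have ij: "i < n" "j < n" by auto
  have "(\<Sum>r\<in>I. f r $$ (i, j)) - (\<Sum>r\<in>I. g r $$ (i, j)) = (\<Sum>r\<in>I. (f r - g r) $$ (i, j))"
    unfolding sum_subtractf[symmetric]
  proof (rule sum.cong)
    fix r assume "r \<in> I"
    with assms have "dim_row (g r) = n" "dim_col (g r) = n" by auto
    then show "f r $$ (i, j) - g r $$ (i, j) = (f r - g r) $$ (i, j)" using ij by simp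
  qed simp
  then show "(mat_sum n I f - mat_sum n I g) $$ (i, j) = mat_sum n I (\<lambda>r. f r - g r) $$ (i, j)"
    using ij by (simp add: mat_sum_def)
qed auto

lemma continuous_mat_on_sum:
  assumes "\<And>r. r \<in> I \<Longrightarrow> continuous_mat_on S n n (f r)"
  shows "continuous_mat_on S n n (\<lambda>x. mat_sum n I (\<lambda>r. f r x))"
proof (rule continuous_mat_onI)
  fix i j assume ij: "i < n" "j < n"
  then show "continuous_on S (\<lambda>x. mat_sum n I (\<lambda>r. f r x) $$ (i, j))"
    unfolding mat_sum_def by (simp add: continuous_on_sum continuous_mat_onD(2)[OF assms])
qed (rule carrier_matI; simp)

text \<open>Testing with a sum of two unit vectors, one turned by a phase, bounds twice the modulus
  of an entry by the sum of two diagonal entries. This places strategies in a compact box.\<close>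

lemma psd_trace_entry_bound:
  assumes X: "X \<in> psd_trace n p" and ij: "i < n" "j < n"
  shows "cmod (X $$ (i, j)) \<le> p"
proof -
  note XD = psd_traceD[OF X]
  note [simp] = XD(3,4)
  have quad: "0 \<le> Re (X $$ (k, k) + c * X $$ (k, l) + cnj c * X $$ (l, k) + cnj c * c * X $$ (l, l))"
    if kl: "k < n" "l < n" for k l c
  proof -
    let ?B = "mat n 1 (\<lambda>(a, _). (if a = k then 1 else 0) + c * (if a = l then 1 else 0))"
    have "(adj ?B * X * ?B) $$ (0, 0) = (\<Sum>a<n. \<Sum>b<n. cnj (?B $$ (b, 0)) * X $$ (b, a) * ?B $$ (a, 0))"
      by (simp add: index_mult sum_distrib_right)
    also have "\<dots> = (\<Sum>a<n. \<Sum>b<n. ((if b = k then X $$ (b, a) else 0) + (if b = l then cnj c * X $$ (b, a) else 0)) * ?B $$ (a, 0))"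
      by (intro sum.cong) (auto simp: algebra_simps)
    also have "\<dots> = (\<Sum>a<n. (X $$ (k, a) + cnj c * X $$ (l, a)) * ?B $$ (a, 0))"
      using kl by (simp add: sum_distrib_right[symmetric] sum.distrib)
    also have "\<dots> = (\<Sum>a<n. (if a = k then X $$ (k, a) + cnj c * X $$ (l, a) else 0) + (if a = l then c * (X $$ (k, a) + cnj c * X $$ (l, a)) else 0))"
      by (intro sum.cong) (auto simp: algebra_simps)
    also have "\<dots> = X $$ (k, k) + c * X $$ (k, l) + cnj c * X $$ (l, k) + cnj c * c * X $$ (l, l)"
      using kl by (simp add: sum.distrib algebra_simps)
    finally show ?thesis using pos_semidef_tr[OF XD(1), of ?B] by (simp add: mat_trace_def)
  qed
  have diag: "0 \<le> Re (X $$ (k, k))" if "k < n" for k using quad[OF that that, of 0] by simp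
  have le: "Re (X $$ (k, k)) \<le> p" if k: "k < n" for k
  proof -
    have "Re (X $$ (k, k)) \<le> (\<Sum>k<n. Re (X $$ (k, k)))"
      by (rule member_le_sum[of k "{..<n}" "\<lambda>k. Re (X $$ (k, k))"]) (use k diag in auto)
    also have "\<dots> = Re (tr X)" by (simp add: mat_trace_def)
    finally show ?thesis using XD(2) by simp
  qed
  have herm: "X $$ (j, i) = cnj (X $$ (i, j))"
    using ij index_adj[of j X i] XD(5) by simp
  define z where "z = X $$ (i, j)"
  \<comment> \<open>The phase that makes both cross terms equal to \<open>- cmod z\<close>; it is 0
    when \<open>z = 0\<close>.\<close>
  define c where "c = - cnj (sgn z)"
  have "c * z = - of_real (cmod z)"
  proof (cases "z = 0")
    case False
    have "cnj z * z = of_real (cmod z) * of_real (cmod z)"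
      using complex_norm_square[of z] by (simp add: power2_eq_square mult.commute)
    then show ?thesis using False by (simp add: c_def sgn_div_norm scaleR_conv_of_real field_simps)
  qed (simp add: c_def)
  moreover have "cnj c * cnj z = cnj (c * z)" by simp
  moreover have "Re (cnj c * c * X $$ (j, j)) \<le> Re (X $$ (j, j))"
  proof -
    have "cnj c * c = of_real ((cmod c)\<^sup>2)" by (simp add: complex_norm_square mult.commute del: of_real_power)
    moreover have "cmod c \<le> 1" by (simp add: c_def norm_sgn)
    ultimately show ?thesis using diag[OF ij(2)] by (simp add: mult_left_le_one_le power_le_one del: of_real_power)
  qed
  ultimately have "2 * cmod z \<le> Re (X $$ (i, i)) + Re (X $$ (j, j))"
    using quad[OF ij, of c] unfolding herm z_def[symmetric] by simp
  then show ?thesis using le[OF ij(1)] le[OF ij(2)] by (simp add: z_def)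
qed

lemma scaled_identity_psd_trace:
  assumes "0 < n" "0 < p"
  shows "of_real (p / n) \<cdot>\<^sub>m 1\<^sub>m n \<in> psd_trace n p"
  unfolding psd_trace_def
proof (intro CollectI conjI)
  show "pos_semidef_mat (of_real (p / n) \<cdot>\<^sub>m 1\<^sub>m n)"
    by (intro pos_semidef_smult pos_def_imp_semidef[OF pos_def_one]) (use assms in simp)
  show "tr (of_real (p / n) \<cdot>\<^sub>m 1\<^sub>m n) = of_real p" using assms by (simp add: tr_smult)
qed simp

text \<open>The left factor and, after taking the adjoint, the right factor each multiply the
  squared norm by at most \<open>s\<close>; the square root leaves a single
  \<open>s\<close>.\<close>

lemma fnorm2_sandwich_le:
  assumes d: "dim_col A = dim_row D" "dim_col D = dim_col B" and pos: "0 < dim_row D" "0 < dim_col D"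
    and A: "spectral_radius (adj A * A) \<le> s" and B: "spectral_radius (adj B * B) \<le> s"
  shows "sqrt (fnorm2 (A * D * adj B)) \<le> s * sqrt (fnorm2 D)"
proof -
  have "0 \<le> spectral_radius (adj A * A)"
    using spectral_radius_gram_attained[of A] d pos fnorm2_nonneg by metis
  then have s: "0 \<le> s" using A by simp
  have "fnorm2 (A * D * adj B) = fnorm2 (A * (D * adj B))" using d by (simp add: mat_assoc)
  also have "\<dots> \<le> s * fnorm2 (D * adj B)"
    using fnorm2_mult_le_spectral_radius[of A "D * adj B"] d pos A
    by (smt (verit) fnorm2_nonneg index_mult_mat(2) mult_right_mono)
  also have "fnorm2 (D * adj B) = fnorm2 (B * adj D)"
    using fnorm2_adj[of "D * adj B"] d by simp
  also have "s * fnorm2 (B * adj D) \<le> s * (s * fnorm2 (adj D))"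
    using fnorm2_mult_le_spectral_radius[of B "adj D"] d pos B s
    by (intro mult_left_mono) (smt (verit) fnorm2_nonneg dim_adj mult_right_mono)+
  finally have "fnorm2 (A * D * adj B) \<le> s\<^sup>2 * fnorm2 D" by (simp add: fnorm2_adj power2_eq_square mult_ac)
  then have "sqrt (fnorm2 (A * D * adj B)) \<le> sqrt (s\<^sup>2 * fnorm2 D)" by (rule real_sqrt_le_mono)
  then show ?thesis using s by (simp add: real_sqrt_mult)
qed

lemma continuous_mat_on_oblique:
  assumes H: "H \<in> carrier_mat m n" and R: "continuous_mat_on S m m R" and pd: "\<And>x. x \<in> S \<Longrightarrow> pos_def_mat (R x)"
  shows "continuous_mat_on S m m (\<lambda>x. oblique H (R x))"
proof -
  note cH = continuous_mat_on_const[OF H] and cA = continuous_mat_on_const[OF adj_carrier[OF H]]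
  note [simp] = carrier_matD[OF H]
  have Rc: "R x \<in> carrier_mat (dim_row H) (dim_row H)" if "x \<in> S" for x using continuous_mat_onD(1)[OF R that] by simp
  have iR: "continuous_mat_on S m m (\<lambda>x. mat_inv (R x))"
    by (rule continuous_mat_on_inv[OF R]) (use pos_def_det(3)[OF pd continuous_mat_onD(1)[OF R]] in auto)
  have K: "continuous_mat_on S n m (\<lambda>x. adj H * mat_inv (R x))" by (rule continuous_mat_on_mult[OF cA iR])
  have N: "continuous_mat_on S n n (\<lambda>x. adj H * mat_inv (R x) * H + (1\<^sub>m (dim_col H) - pseudoinverse H * H))"
    by (rule continuous_mat_on_add[OF continuous_mat_on_mult[OF K cH] continuous_mat_on_const]) auto
  have iN: "continuous_mat_on S n n (\<lambda>x. mat_inv (adj H * mat_inv (R x) * H + (1\<^sub>m (dim_col H) - pseudoinverse H * H)))"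
    by (rule continuous_mat_on_inv[OF N])
       (use pos_def_det(3)[OF regularized_gram_inverse(1,2)[OF pd Rc]] in auto)
  show ?thesis unfolding oblique_def by (rule continuous_mat_on_mult[OF continuous_mat_on_mult[OF cH iN] K])
qed

lemma continuous_mat_on_compose:
  assumes A: "continuous_mat_on S n m A" and g: "continuous_on T g" "g ` T \<subseteq> S"
  shows "continuous_mat_on T n m (\<lambda>x. A (g x))"
proof (rule continuous_mat_onI)
  fix i j assume "i < n" "j < m"
  from continuous_mat_onD(2)[OF A this] show "continuous_on T (\<lambda>x. A (g x) $$ (i, j))"
    by (rule continuous_on_compose2[OF _ g])
qed (use continuous_mat_onD(1)[OF A] g(2) in auto)

section \<open>Compactness of the unit sphere\<close>

definition column :: "nat \<Rightarrow> (nat \<Rightarrow> complex) \<Rightarrow> complex mat" where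
  "column n v = mat n 1 (\<lambda>(i, _). v i)"

text \<open>Unit vectors are encoded as functions to use the product topology. Pinning the
  coordinates from \<open>n\<close> on to 0 and confining the others to discs makes the set a closed
  part of a compact box.\<close>

definition unit_columns :: "nat \<Rightarrow> (nat \<Rightarrow> complex) set" where
  "unit_columns n = {v. (\<forall>i. v i \<in> (if i < n then cball 0 1 else {0})) \<and> fnorm2 (column n v) = 1}"

lemma continuous_mat_on_column: "continuous_mat_on S n 1 (column n)"
proof (rule continuous_mat_onI)
  fix i j assume "i < n" "j < (1::nat)"
  moreover have "continuous_on S (\<lambda>v :: nat \<Rightarrow> complex. v i)"
    by (rule continuous_on_subset[OF continuous_on_product_coordinates]) simp
  ultimately show "continuous_on S (\<lambda>v. column n v $$ (i, j))" by (simp add: column_def)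
qed (simp add: column_def)

lemma compact_unit_columns: "compact (unit_columns n)"
proof -
  let ?box = "{v. \<forall>i. v i \<in> (if i < n then cball 0 1 else {0 :: complex})}"
  have c: "compact ?box" by (rule compact_function_box) auto
  have "closed {v. fnorm2 (column n v) = 1}"
    by (intro closed_Collect_eq continuous_intros continuous_on_fnorm2[OF continuous_mat_on_column])
  moreover have "unit_columns n = ?box \<inter> {v. fnorm2 (column n v) = 1}" by (auto simp: unit_columns_def)
  ultimately show ?thesis using c by (simp add: compact_Int_closed)
qed

lemma unit_columns_surj:
  assumes V: "V \<in> carrier_mat n 1" "fnorm2 V = 1"
  obtains v where "v \<in> unit_columns n" "column n v = V"
proof -
  define v where "v i = (if i < n then V $$ (i, 0) else 0)" for i
  have col: "column n v = V" using V(1) by (auto simp: column_def v_def intro!: eq_matI)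
  have "cmod (v i) \<le> 1" if i: "i < n" for i
  proof -
    have "(cmod (V $$ (i, 0)))\<^sup>2 \<le> (\<Sum>i<n. (cmod (V $$ (i, 0)))\<^sup>2)"
      using i by (intro member_le_sum) auto
    also have "\<dots> = 1" using V by (simp add: fnorm2_def)
    finally show ?thesis using i by (simp add: v_def power2_le_iff_abs_le abs_square_le_1)
  qed
  then have "v \<in> unit_columns n" using V col by (auto simp: unit_columns_def v_def)
  with that col show thesis by blast
qed

section \<open>The game\<close>

locale mimo =
  fixes Q :: nat and nT nR :: "nat \<Rightarrow> nat" and H :: "nat \<Rightarrow> nat \<Rightarrow> complex mat"
    and Rn :: "nat \<Rightarrow> complex mat" and P :: "nat \<Rightarrow> real"
  assumes H: "\<And>r q. r \<in> {1..Q} \<Longrightarrow> q \<in> {1..Q} \<Longrightarrow> H r q \<in> carrier_mat (nR q) (nT r)"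
    and H_nz: "\<And>q. q \<in> {1..Q} \<Longrightarrow> H q q \<noteq> 0\<^sub>m (nR q) (nT q)"
    and Rn: "\<And>q. q \<in> {1..Q} \<Longrightarrow> Rn q \<in> carrier_mat (nR q) (nR q)"
    and Rn_pd: "\<And>q. q \<in> {1..Q} \<Longrightarrow> pos_def_mat (Rn q)"
    and P_pos: "\<And>q. q \<in> {1..Q} \<Longrightarrow> P q > 0"
begin

abbreviation "intf \<equiv> interference Q nR H Rn"

lemma strategies_eq: "strategies nT P q = psd_trace (nT q) (P q)"
  by (simp add: strategies_def psd_trace_def)

text \<open>A nonzero channel has at least one column. Without a transmit dimension no matrix would
  have the positive trace \<open>P q\<close>.\<close>

lemma nT_pos: "q \<in> {1..Q} \<Longrightarrow> 0 < nT q"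
  using H[of q q] H_nz[of q] by (auto simp: mat_eq_iff)

lemma H_dim: "r \<in> {1..Q} \<Longrightarrow> q \<in> {1..Q} \<Longrightarrow> dim_row (H r q) = nR q" "r \<in> {1..Q} \<Longrightarrow> q \<in> {1..Q} \<Longrightarrow> dim_col (H r q) = nT r"
  using H[of r q] by auto

lemma intf_eq: "intf q Y = Rn q + mat_sum (nR q) ({1..Q} - {q}) (\<lambda>r. H r q * Y r * adj (H r q))"
  by (simp add: interference_def mat_sum_def)

text \<open>Lets full profiles, restricted profiles and profiles completed at \<open>q\<close> be
  exchanged for one another.\<close>

lemma intf_cong: "(\<And>r. r \<in> {1..Q} - {q} \<Longrightarrow> Y r = Y' r) \<Longrightarrow> intf q Y = intf q Y'"
  unfolding interference_def by simp

lemma intf_term_carrier: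
  assumes "q \<in> {1..Q}" "r \<in> {1..Q}" "Y r \<in> psd_trace (nT r) (P r)"
  shows "H r q * Y r * adj (H r q) \<in> carrier_mat (nR q) (nR q)"
  using assms H_dim psd_traceD(3,4) by (intro carrier_matI) auto

lemma intf_pos_def:
  assumes q: "q \<in> {1..Q}" and Y: "\<And>r. r \<in> {1..Q} - {q} \<Longrightarrow> Y r \<in> psd_trace (nT r) (P r)"
  shows "pos_def_mat (intf q Y)" "intf q Y \<in> carrier_mat (nR q) (nR q)"
proof -
  show "pos_def_mat (intf q Y)" unfolding intf_eq
  proof (rule pos_def_add_semidef[OF Rn_pd[OF q]])
    show "pos_semidef_mat (mat_sum (nR q) ({1..Q} - {q}) (\<lambda>r. H r q * Y r * adj (H r q)))"
    proof (rule mat_sum_pos_semidef)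
      fix r assume r: "r \<in> {1..Q} - {q}"
      then show "H r q * Y r * adj (H r q) \<in> carrier_mat (nR q) (nR q)" using q Y by (intro intf_term_carrier) auto
      show "pos_semidef_mat (H r q * Y r * adj (H r q))"
        using r q Y[OF r] by (intro pos_semidef_congruence psd_traceD(1)) (auto simp: H_dim psd_traceD(3))
    qed simp
  qed (use Rn[OF q] in simp)
  show "intf q Y \<in> carrier_mat (nR q) (nR q)" unfolding intf_eq using Rn[OF q] by (intro carrier_matI) auto
qed

lemma is_NE_iff:
  "is_NE Q nT nR H Rn P X \<longleftrightarrow> X \<in> Pi\<^sub>E {1..Q} (strategies nT P) \<and>
     (\<forall>q\<in>{1..Q}. \<forall>Y\<in>psd_trace (nT q) (P q). Re (tr (grad (H q q) (intf q X) (X q) * (Y - X q))) \<le> 0)"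
proof -
  have "(\<forall>Y\<in>psd_trace (nT q) (P q). rate Q nT nR H Rn q Y (restrict X ({1..Q} - {q})) \<le> rate Q nT nR H Rn q (X q) (restrict X ({1..Q} - {q}))) \<longleftrightarrow>
     (\<forall>Y\<in>psd_trace (nT q) (P q). Re (tr (grad (H q q) (intf q X) (X q) * (Y - X q))) \<le> 0)"
    if X: "X \<in> Pi\<^sub>E {1..Q} (strategies nT P)" and q: "q \<in> {1..Q}" for q
  proof -
    have Xr: "X r \<in> psd_trace (nT r) (P r)" if "r \<in> {1..Q}" for r using X that by (auto simp: strategies_eq)
    have "intf q (restrict X ({1..Q} - {q})) = intf q X" by (rule intf_cong) simp
    then have "rate Q nT nR H Rn q Y (restrict X ({1..Q} - {q})) = gain (H q q) (intf q X) Y" for Y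
      by (simp add: rate_def gain_def H_dim[OF q q])
    then show ?thesis using gain_maximal_iff[OF H[OF q q] intf_pos_def[OF q] Xr[OF q]] Xr by simp
  qed
  then show ?thesis unfolding is_NE_def nash_equilibrium_def by (auto simp: strategies_eq)
qed

section \<open>Existence of an equilibrium\<close>

text \<open>Profiles of matrices are flattened to functions on index triples, whose type carries the product topology.\<close>
definition prof :: "(nat \<times> nat \<times> nat \<Rightarrow> complex) \<Rightarrow> nat \<Rightarrow> complex mat" where
  "prof \<xi> q = mat (nT q) (nT q) (\<lambda>(i, j). \<xi> (q, i, j))"

definition flat :: "(nat \<Rightarrow> complex mat) \<Rightarrow> nat \<times> nat \<times> nat \<Rightarrow> complex" where
  "flat X = (\<lambda>(q, i, j). if q \<in> {1..Q} \<and> i < nT q \<and> j < nT q then X q $$ (i, j) else 0)"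

text \<open>The discs, of radius \<open>P q\<close> as in \<open>psd_trace_entry_bound\<close>,
  provide compactness; the zeros elsewhere make the encoding of a profile unique.\<close>

definition profiles :: "(nat \<times> nat \<times> nat \<Rightarrow> complex) set" where
  "profiles = {\<xi>. (\<forall>p. \<xi> p \<in> (case p of (q, i, j) \<Rightarrow> if q \<in> {1..Q} \<and> i < nT q \<and> j < nT q then cball 0 (P q) else {0})) \<and>
     (\<forall>q\<in>{1..Q}. prof \<xi> q \<in> psd_trace (nT q) (P q))}"

lemma prof_dim [simp]: "dim_row (prof \<xi> q) = nT q" "dim_col (prof \<xi> q) = nT q" "prof \<xi> q \<in> carrier_mat (nT q) (nT q)"
  by (simp_all add: prof_def)

lemma prof_flat: "q \<in> {1..Q} \<Longrightarrow> X q \<in> carrier_mat (nT q) (nT q) \<Longrightarrow> prof (flat X) q = X q"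
  by (auto simp: prof_def flat_def intro!: eq_matI)

lemma flat_profiles:
  assumes X: "\<And>q. q \<in> {1..Q} \<Longrightarrow> X q \<in> psd_trace (nT q) (P q)"
  shows "flat X \<in> profiles"
  using psd_trace_entry_bound[OF X] psd_traceD(6)[OF X] X
  unfolding profiles_def by (auto simp: prof_flat) (auto simp: flat_def)

lemma profilesD: "\<xi> \<in> profiles \<Longrightarrow> q \<in> {1..Q} \<Longrightarrow> prof \<xi> q \<in> psd_trace (nT q) (P q)"
  by (simp add: profiles_def)

lemma continuous_mat_on_prof: "continuous_mat_on S (nT q) (nT q) (\<lambda>\<xi>. prof \<xi> q)"
proof (rule continuous_mat_onI)
  fix i j assume "i < nT q" "j < nT q"
  moreover have "continuous_on S (\<lambda>\<xi> :: nat \<times> nat \<times> nat \<Rightarrow> complex. \<xi> (q, i, j))"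
    by (rule continuous_on_subset[OF continuous_on_product_coordinates]) simp
  ultimately show "continuous_on S (\<lambda>\<xi>. prof \<xi> q $$ (i, j))" by (simp add: prof_def)
qed simp

text \<open>Expresses membership by linear equations and inequalities in the entries, indexed by
  fixed test matrices; both closedness and convexity can be read off.\<close>

lemma psd_trace_iff:
  "X \<in> psd_trace n p \<longleftrightarrow> X \<in> carrier_mat n n \<and> (\<forall>i<n. \<forall>j<n. cnj (X $$ (j, i)) = X $$ (i, j)) \<and>
     (\<forall>B. dim_row B = n \<longrightarrow> 0 \<le> Re (tr (adj B * X * B))) \<and> tr X = of_real p" (is "?l \<longleftrightarrow> ?r")
proof
  assume ?l
  note D = psd_traceD[OF this]
  have "cnj (X $$ (j, i)) = X $$ (i, j)" if "i < n" "j < n" for i j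
    using index_adj[of i X j] that D by simp
  then show ?r using D pos_semidef_tr[OF D(1)] by auto
next
  assume r: ?r
  then have "adj X = X" by (intro eq_matI) auto
  then have "pos_semidef_mat X" using r by (intro pos_semidefI) auto
  then show ?l using r by (simp add: psd_trace_def)
qed

lemma compact_profiles: "compact profiles"
proof -
  let ?box = "{\<xi>. \<forall>p. \<xi> p \<in> (case p of (q, i, j) \<Rightarrow> if q \<in> {1..Q} \<and> i < nT q \<and> j < nT q then cball 0 (P q) else {0 :: complex})}"
  have c: "compact ?box" by (rule compact_function_box) (auto split: prod.splits)
  let ?F = "\<lambda>q. {\<xi>. prof \<xi> q \<in> psd_trace (nT q) (P q)}"
  have cl: "closed (?F q)" for q
  proof -
    have eq: "?F q = (\<Inter>i\<in>{..<nT q}. \<Inter>j\<in>{..<nT q}. {\<xi>. cnj (prof \<xi> q $$ (j, i)) = prof \<xi> q $$ (i, j)}) \<inter>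
       (\<Inter>B\<in>{B. dim_row B = nT q}. {\<xi>. 0 \<le> Re (tr (adj B * prof \<xi> q * B))}) \<inter> {\<xi>. tr (prof \<xi> q) = of_real (P q)}"
      unfolding psd_trace_iff by auto
    note cp = continuous_mat_on_prof[of UNIV q]
    show ?thesis unfolding eq
    proof (intro closed_Int closed_INT ballI)
      fix i j assume "i \<in> {..<nT q}" "j \<in> {..<nT q}"
      then show "closed {\<xi>. cnj (prof \<xi> q $$ (j, i)) = prof \<xi> q $$ (i, j)}"
        by (intro closed_Collect_eq continuous_intros continuous_mat_onD(2)[OF cp]) auto
    next
      fix B :: "complex mat" assume "B \<in> {B. dim_row B = nT q}"
      then have B: "B \<in> carrier_mat (nT q) (dim_col B)" by auto
      have "continuous_on UNIV (\<lambda>\<xi>. tr (adj B * prof \<xi> q * B))"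
        by (rule continuous_on_tr[OF continuous_mat_on_mult[OF continuous_mat_on_mult[OF continuous_mat_on_const[OF adj_carrier[OF B]] cp] continuous_mat_on_const[OF B]]])
      then show "closed {\<xi>. 0 \<le> Re (tr (adj B * prof \<xi> q * B))}"
        by (intro closed_Collect_le continuous_intros)
    next
      show "closed {\<xi>. tr (prof \<xi> q) = of_real (P q)}"
        by (intro closed_Collect_eq continuous_intros continuous_on_tr[OF cp])
    qed
  qed
  have "profiles = ?box \<inter> (\<Inter>q\<in>{1..Q}. ?F q)" unfolding profiles_def by auto
  then show ?thesis using compact_Int_closed[OF c closed_INT[of "{1..Q}" ?F]] cl by simp
qed

lemma profiles_nonempty: "profiles \<noteq> {}"
  using flat_profiles[of "\<lambda>q. of_real (P q / nT q) \<cdot>\<^sub>m 1\<^sub>m (nT q)"] scaled_identity_psd_trace nT_pos P_pos by blast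

lemma continuous_mat_on_intf:
  assumes q: "q \<in> {1..Q}"
  shows "continuous_mat_on S (nR q) (nR q) (\<lambda>\<xi>. intf q (prof \<xi>))"
  unfolding intf_eq
proof (rule continuous_mat_on_add[OF continuous_mat_on_const[OF Rn[OF q]] continuous_mat_on_sum])
  fix r assume "r \<in> {1..Q} - {q}"
  then have Hc: "H r q \<in> carrier_mat (nR q) (nT r)" using H q by auto
  show "continuous_mat_on S (nR q) (nR q) (\<lambda>\<xi>. H r q * prof \<xi> r * adj (H r q))"
    by (rule continuous_mat_on_mult[OF continuous_mat_on_mult[OF continuous_mat_on_const[OF Hc] continuous_mat_on_prof] continuous_mat_on_const[OF adj_carrier[OF Hc]]])
qed

lemma continuous_mat_on_grad:
  assumes q: "q \<in> {1..Q}"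
  shows "continuous_mat_on profiles (nT q) (nT q) (\<lambda>\<xi>. grad (H q q) (intf q (prof \<xi>)) (prof \<xi> q))"
proof -
  note Hc = H[OF q q]
  have "continuous_mat_on profiles (nR q) (nR q) (\<lambda>\<xi>. total_cov (H q q) (intf q (prof \<xi>)) (prof \<xi> q))"
    unfolding total_cov_def
    by (rule continuous_mat_on_add[OF continuous_mat_on_intf[OF q] continuous_mat_on_mult[OF continuous_mat_on_mult[OF
          continuous_mat_on_const[OF Hc] continuous_mat_on_prof] continuous_mat_on_const[OF adj_carrier[OF Hc]]]])
  moreover have "det (total_cov (H q q) (intf q (prof \<xi>)) (prof \<xi> q)) \<noteq> 0" if \<xi>: "\<xi> \<in> profiles" for \<xi>
  proof -
    have "pos_def_mat (intf q (prof \<xi>))" "intf q (prof \<xi>) \<in> carrier_mat (nR q) (nR q)"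
      using intf_pos_def[OF q, of "prof \<xi>"] profilesD[OF \<xi>] by auto
    from pos_def_det(3)[OF total_cov[OF Hc this profilesD[OF \<xi> q]]] show ?thesis .
  qed
  ultimately have "continuous_mat_on profiles (nR q) (nR q) (\<lambda>\<xi>. mat_inv (total_cov (H q q) (intf q (prof \<xi>)) (prof \<xi> q)))"
    by (rule continuous_mat_on_inv)
  from continuous_mat_on_mult[OF continuous_mat_on_mult[OF continuous_mat_on_const[OF adj_carrier[OF Hc]] this] continuous_mat_on_const[OF Hc]]
  show ?thesis unfolding grad_def .
qed

text \<open>The gradient of player \<open>q\<close> is taken at the first profile and paired with
  that player's strategy in the second, so the second argument enters linearly.\<close>

definition pairing :: "nat \<Rightarrow> (nat \<times> nat \<times> nat \<Rightarrow> complex) \<Rightarrow> (nat \<times> nat \<times> nat \<Rightarrow> complex) \<Rightarrow> complex" where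
  "pairing q \<xi> \<eta> = tr (grad (H q q) (intf q (prof \<xi>)) (prof \<xi> q) * prof \<eta> q)"

lemma grad_prof_dim:
  assumes q: "q \<in> {1..Q}" and \<xi>: "\<xi> \<in> profiles"
  shows "dim_row (grad (H q q) (intf q (prof \<xi>)) (prof \<xi> q)) = nT q" "dim_col (grad (H q q) (intf q (prof \<xi>)) (prof \<xi> q)) = nT q"
proof -
  have "pos_def_mat (intf q (prof \<xi>))" "intf q (prof \<xi>) \<in> carrier_mat (nR q) (nR q)"
    using intf_pos_def[OF q, of "prof \<xi>"] profilesD[OF \<xi>] by auto
  from grad(1,2)[OF H[OF q q] this profilesD[OF \<xi> q]]
  show "dim_row (grad (H q q) (intf q (prof \<xi>)) (prof \<xi> q)) = nT q" "dim_col (grad (H q q) (intf q (prof \<xi>)) (prof \<xi> q)) = nT q" .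
qed

lemma pairing_comb:
  fixes t :: "nat \<Rightarrow> real"
  assumes "q \<in> {1..Q}" "\<xi> \<in> profiles"
  shows "pairing q \<xi> (\<lambda>p. \<Sum>k\<le>n. of_real (t k) * y k p) = (\<Sum>k\<le>n. of_real (t k) * pairing q \<xi> (y k))"
proof -
  define G where "G = grad (H q q) (intf q (prof \<xi>)) (prof \<xi> q)"
  have [simp]: "dim_row G = nT q" "dim_col G = nT q" using grad_prof_dim[OF assms] by (simp_all add: G_def)
  have p: "pairing q \<xi> \<eta> = (\<Sum>i<nT q. \<Sum>j<nT q. G $$ (i, j) * \<eta> (q, j, i))" for \<eta>
    unfolding pairing_def G_def[symmetric] by (simp add: mat_trace_def index_mult prof_def)
  have "pairing q \<xi> (\<lambda>p. \<Sum>k\<le>n. of_real (t k) * y k p) =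
      (\<Sum>i<nT q. \<Sum>j<nT q. \<Sum>k\<le>n. of_real (t k) * (G $$ (i, j) * y k (q, j, i)))"
    unfolding p by (simp add: sum_distrib_left mult_ac)
  also have "\<dots> = (\<Sum>i<nT q. \<Sum>k\<le>n. \<Sum>j<nT q. of_real (t k) * (G $$ (i, j) * y k (q, j, i)))"
    by (intro sum.cong refl sum.swap)
  also have "\<dots> = (\<Sum>k\<le>n. \<Sum>i<nT q. \<Sum>j<nT q. of_real (t k) * (G $$ (i, j) * y k (q, j, i)))"
    by (rule sum.swap)
  finally show ?thesis unfolding p by (simp add: sum_distrib_left)
qed

lemma profiles_convex:
  fixes t :: "nat \<Rightarrow> real"
  assumes y: "\<And>k. k \<le> n \<Longrightarrow> y k \<in> profiles" and t: "\<And>k. k \<le> n \<Longrightarrow> 0 \<le> t k" and sum: "(\<Sum>k\<le>n. t k) = 1"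
  shows "(\<lambda>p. \<Sum>k\<le>n. complex_of_real (t k) * y k p) \<in> profiles"
proof -
  let ?c = "\<lambda>p. \<Sum>k\<le>n. complex_of_real (t k) * y k p"
  have "prof ?c q \<in> psd_trace (nT q) (P q)" if q: "q \<in> {1..Q}" for q
  proof -
    have lin: "tr (A * prof ?c q * B) = (\<Sum>k\<le>n. of_real (t k) * tr (A * prof (y k) q * B))"
      if [simp]: "dim_col A = nT q" "dim_row B = nT q" "dim_col B = dim_row A" for A B
    proof -
      have m: "prof ?c q = mat_sum (nT q) {..n} (\<lambda>k. of_real (t k) \<cdot>\<^sub>m prof (y k) q)"
        by (auto simp: prof_def mat_sum_def intro!: eq_matI)
      have "tr (A * prof ?c q * B) = (\<Sum>k\<le>n. tr (A * (of_real (t k) \<cdot>\<^sub>m prof (y k) q) * B))"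
        unfolding m by (rule tr_mult_mat_sum) auto
      then show ?thesis by (simp add: mat_mult_smult mat_smult_mult tr_smult)
    qed
    have D: "prof (y k) q \<in> psd_trace (nT q) (P q)" if "k \<le> n" for k using profilesD[OF y[OF that] q] .
    show ?thesis unfolding psd_trace_iff
    proof (intro conjI allI impI)
      fix i j assume ij: "i < nT q" "j < nT q"
      have "cnj (y k (q, j, i)) = y k (q, i, j)" if "k \<le> n" for k
        using D[OF that] ij unfolding psd_trace_iff prof_def by auto
      then show "cnj (prof ?c q $$ (j, i)) = prof ?c q $$ (i, j)"
        using ij by (auto simp: prof_def intro!: sum.cong)
    next
      fix B :: "complex mat" assume B: "dim_row B = nT q"
      have "0 \<le> (\<Sum>k\<le>n. t k * Re (tr (adj B * prof (y k) q * B)))"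
        using D t B unfolding psd_trace_iff by (intro sum_nonneg mult_nonneg_nonneg) auto
      then show "0 \<le> Re (tr (adj B * prof ?c q * B))" using B by (subst lin) auto
    next
      have "tr (prof ?c q) = (\<Sum>k\<le>n. of_real (t k) * tr (prof (y k) q))"
        using lin[of "1\<^sub>m (nT q)" "1\<^sub>m (nT q)"] by (simp add: mat_simps)
      also have "\<dots> = (\<Sum>k\<le>n. of_real (t k) * of_real (P q))"
        using psd_traceD(2)[OF D] by (intro sum.cong) auto
      also have "\<dots> = of_real ((\<Sum>k\<le>n. t k) * P q)" by (simp add: sum_distrib_right)
      finally show "tr (prof ?c q) = of_real (P q)" using sum by simp
    qed simp
  qed
  then have fp: "flat (prof ?c) \<in> profiles" by (rule flat_profiles)
  \<comment> \<open>The box bounds of the combination come from \<open>flat_profiles\<close>;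
    encoding its matrices again changes nothing because all entries outside the matrices are
    0.\<close>
  have "flat (prof ?c) = ?c"
  proof
    fix p show "flat (prof ?c) p = ?c p"
    proof (cases p)
      case (fields q i j)
      show ?thesis
      proof (cases "q \<in> {1..Q} \<and> i < nT q \<and> j < nT q")
        case False
        have "y k (q, i, j) = 0" if "k \<le> n" for k
        proof -
          have "\<forall>p. y k p \<in> (case p of (q, i, j) \<Rightarrow> if q \<in> {1..Q} \<and> i < nT q \<and> j < nT q then cball 0 (P q) else {0})"
            using y[OF that] unfolding profiles_def by blast
          from spec[OF this, of "(q, i, j)"] show ?thesis unfolding prod.case if_not_P[OF False] by simp
        qed
        moreover have "flat (prof ?c) (q, i, j) = 0" unfolding flat_def prod.case if_not_P[OF False] ..
        ultimately show ?thesis using fields by simp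
      qed (use fields in \<open>simp add: flat_def prof_def\<close>)
    qed
  qed
  with fp show ?thesis by simp
qed

lemma NE_exists: "\<exists>X. is_NE Q nT nR H Rn P X"
proof -
  \<comment> \<open>The optimality conditions of all players are summed into one variational
    inequality over the product of the strategy sets.\<close>
  define \<phi> where "\<phi> \<xi> \<eta> = (\<Sum>q\<in>{1..Q}. Re (pairing q \<xi> \<eta> - pairing q \<xi> \<xi>))" for \<xi> \<eta>
  have "\<exists>\<xi>\<in>profiles. \<forall>\<eta>\<in>profiles. \<phi> \<xi> \<eta> \<le> 0"
  proof (rule variational_inequality[OF compact_profiles profiles_nonempty])
    fix n :: nat and y and t :: "nat \<Rightarrow> real"
    assume "\<And>i. i \<le> n \<Longrightarrow> y i \<in> profiles" "\<And>i. i \<le> n \<Longrightarrow> 0 \<le> t i" "(\<Sum>i\<le>n. t i) = 1"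
    then show "(\<lambda>p. \<Sum>i\<le>n. complex_of_real (t i) * y i p) \<in> profiles" by (rule profiles_convex)
  next
    fix \<eta> assume "\<eta> \<in> profiles"
    have c: "continuous_on profiles (\<lambda>\<xi>. pairing q \<xi> (\<eta> \<xi>))" if q: "q \<in> {1..Q}"
      and h: "continuous_mat_on profiles (nT q) (nT q) (\<lambda>\<xi>. prof (\<eta> \<xi>) q)" for q \<eta>
      unfolding pairing_def by (rule continuous_on_tr[OF continuous_mat_on_mult[OF continuous_mat_on_grad[OF q] h]])
    show "continuous_on profiles (\<lambda>\<xi>. \<phi> \<xi> \<eta>)"
      unfolding \<phi>_def by (intro continuous_intros c continuous_mat_on_prof continuous_mat_on_const prof_dim(3))
  next
    fix \<xi> n y and t :: "nat \<Rightarrow> real"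
    assume \<xi>: "\<xi> \<in> profiles" and sum: "(\<Sum>i\<le>n. t i) = 1"
    have "\<phi> \<xi> (\<lambda>p. \<Sum>i\<le>n. complex_of_real (t i) * y i p) =
       (\<Sum>q\<in>{1..Q}. \<Sum>i\<le>n. t i * Re (pairing q \<xi> (y i) - pairing q \<xi> \<xi>))"
      unfolding \<phi>_def
    proof (rule sum.cong)
      fix q assume q: "q \<in> {1..Q}"
      have "(\<Sum>i\<le>n. t i * Re (pairing q \<xi> (y i) - pairing q \<xi> \<xi>)) =
          (\<Sum>i\<le>n. t i * Re (pairing q \<xi> (y i))) - (\<Sum>i\<le>n. t i) * Re (pairing q \<xi> \<xi>)"
        by (simp add: right_diff_distrib sum_subtractf sum_distrib_right)
      then show "Re (pairing q \<xi> (\<lambda>p. \<Sum>i\<le>n. complex_of_real (t i) * y i p) - pairing q \<xi> \<xi>) =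
        (\<Sum>i\<le>n. t i * Re (pairing q \<xi> (y i) - pairing q \<xi> \<xi>))"
        unfolding pairing_comb[OF q \<xi>] sum by simp
    qed simp
    also have "\<dots> = (\<Sum>i\<le>n. \<Sum>q\<in>{1..Q}. t i * Re (pairing q \<xi> (y i) - pairing q \<xi> \<xi>))" by (rule sum.swap)
    finally show "\<phi> \<xi> (\<lambda>p. \<Sum>i\<le>n. complex_of_real (t i) * y i p) = (\<Sum>i\<le>n. t i * \<phi> \<xi> (y i))"
      by (simp add: \<phi>_def sum_distrib_left)
  qed (simp add: \<phi>_def)
  then obtain \<xi> where \<xi>: "\<xi> \<in> profiles" and vi: "\<And>\<eta>. \<eta> \<in> profiles \<Longrightarrow> \<phi> \<xi> \<eta> \<le> 0" by blast
  define X where "X = restrict (prof \<xi>) {1..Q}"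
  have iX: "intf q X = intf q (prof \<xi>)" for q by (rule intf_cong) (simp add: X_def)
  have "Re (tr (grad (H q q) (intf q X) (X q) * (Y - X q))) \<le> 0" if q: "q \<in> {1..Q}" and Y: "Y \<in> psd_trace (nT q) (P q)" for q Y
  proof -
    \<comment> \<open>A deviation of player \<open>q\<close> alone makes all other summands vanish,
      which recovers the condition of that player.\<close>
    define Z where "Z = (prof \<xi>)(q := Y)"
    have Zp: "Z r \<in> psd_trace (nT r) (P r)" if "r \<in> {1..Q}" for r using Y profilesD[OF \<xi> that] by (simp add: Z_def)
    have pZ: "prof (flat Z) r = Z r" if "r \<in> {1..Q}" for r by (rule prof_flat[of r Z, OF that psd_traceD(6)[OF Zp[OF that]]])
    have "\<phi> \<xi> (flat Z) = (\<Sum>r\<in>{1..Q}. if r = q then Re (pairing q \<xi> (flat Z) - pairing q \<xi> \<xi>) else 0)"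
      unfolding \<phi>_def
    proof (rule sum.cong)
      fix r assume r: "r \<in> {1..Q}"
      show "Re (pairing r \<xi> (flat Z) - pairing r \<xi> \<xi>) = (if r = q then Re (pairing q \<xi> (flat Z) - pairing q \<xi> \<xi>) else 0)"
        unfolding pairing_def pZ[OF r] pZ[OF q] by (simp add: Z_def)
    qed simp
    also have "\<dots> = Re (pairing q \<xi> (flat Z) - pairing q \<xi> \<xi>)" using q by simp
    finally have "Re (pairing q \<xi> (flat Z) - pairing q \<xi> \<xi>) \<le> 0"
      using vi[OF flat_profiles[OF Zp]] by simp
    moreover have "X q = prof \<xi> q" using q by (simp add: X_def)
    ultimately show ?thesis
      unfolding iX pairing_def pZ[OF q] using grad_prof_dim[OF q \<xi>] psd_traceD(3,4)[OF Y]
      by (simp add: Z_def mat_mult_minus tr_minus)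
  qed
  moreover have "X \<in> Pi\<^sub>E {1..Q} (strategies nT P)"
    using profilesD[OF \<xi>] by (auto simp: X_def strategies_eq)
  ultimately have "is_NE Q nT nR H Rn P X" unfolding is_NE_iff by blast
  then show ?thesis by blast
qed

section \<open>Attainment of the maximum and bounds on the couplings\<close>

definition coupling :: "nat \<Rightarrow> nat \<Rightarrow> (nat \<Rightarrow> complex mat) \<Rightarrow> complex mat" where
  "coupling q r Y = pseudoinverse (H q q) * oblique (H q q) (intf q Y) * H r q"

lemma others_psd_trace:
  "Y \<in> strategies_others Q nT P q \<Longrightarrow> r \<in> {1..Q} - {q} \<Longrightarrow> Y r \<in> psd_trace (nT r) (P r)"
  unfolding strategies_others_def strategies_eq[symmetric] by (rule PiE_mem)

lemma proj_feasible_iff: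
  assumes q: "q \<in> {1..Q}"
  shows "proj_feasible Q nT nR H Rn P q (Pr, Y) \<longleftrightarrow>
    Y \<in> strategies_others Q nT P q \<and> is_oblique (H q q) (intf q Y) Pr"
  unfolding proj_feasible_def is_oblique_def by (auto simp: H_dim[OF q q])

lemma intf_pos_def':
  assumes "q \<in> {1..Q}" "Y \<in> strategies_others Q nT P q"
  shows "pos_def_mat (intf q Y)" "intf q Y \<in> carrier_mat (dim_row (H q q)) (dim_row (H q q))"
  using intf_pos_def[OF assms(1) others_psd_trace[OF assms(2)]] H_dim[OF assms(1) assms(1)] by auto

lemma oblique_dim:
  assumes "q \<in> {1..Q}" "Y \<in> strategies_others Q nT P q"
  shows "oblique (H q q) (intf q Y) \<in> carrier_mat (nR q) (nR q)"
  using oblique(1)[OF intf_pos_def'[OF assms]] H_dim[OF assms(1) assms(1)] by (simp add: is_oblique_def)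

lemma proj_objective_eq:
  assumes q: "q \<in> {1..Q}" and r: "r \<in> {1..Q}" and Pr: "Pr \<in> carrier_mat (nR q) (nR q)"
  shows "proj_objective H r q Pr =
    spectral_radius (adj (pseudoinverse (H q q) * Pr * H r q) * (pseudoinverse (H q q) * Pr * H r q))"
  using carrier_matD[OF Pr] unfolding proj_objective_def by (simp add: H_dim[OF q q] H_dim[OF r q] mat_assoc)

text \<open>Each \<open>Y\<close> admits exactly one feasible projection, given continuously by
  \<open>oblique\<close>. Maximizing the spectral radius then amounts to maximizing the squared norm
  of \<open>A\<close> applied to a unit column, jointly over profiles and columns.\<close>

lemma arg_max_exists:
  assumes q: "q \<in> {1..Q}" and r: "r \<in> {1..Q}"
  shows "\<exists>x. is_arg_max (\<lambda>(Pr, Y). proj_objective H r q Pr) (proj_feasible Q nT nR H Rn P q) x"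
proof -
  define A where "A \<xi> = pseudoinverse (H q q) * oblique (H q q) (intf q (prof \<xi>)) * H r q" for \<xi>
  have pd: "pos_def_mat (intf q (prof \<xi>))" if "\<xi> \<in> profiles" for \<xi>
    using intf_pos_def(1)[OF q, of "prof \<xi>"] profilesD[OF that] by auto
  have pinv: "pseudoinverse (H q q) \<in> carrier_mat (nT q) (nR q)" using H_dim[OF q q] by (intro carrier_matI) auto
  have cA: "continuous_mat_on profiles (nT q) (nT r) A"
    unfolding A_def
    by (rule continuous_mat_on_mult[OF continuous_mat_on_mult[OF continuous_mat_on_const[OF pinv]
          continuous_mat_on_oblique[OF H[OF q q] continuous_mat_on_intf[OF q] pd]] continuous_mat_on_const[OF H[OF r q]]])
  let ?S = "profiles \<times> unit_columns (nT r)"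
  have "continuous_on ?S (\<lambda>p. fnorm2 (A (fst p) * column (nT r) (snd p)))"
    by (rule continuous_on_fnorm2[OF continuous_mat_on_mult[OF continuous_mat_on_compose[OF cA] continuous_mat_on_compose[OF continuous_mat_on_column]]])
       (auto intro: continuous_intros)
  moreover have "compact ?S" by (intro compact_Times compact_profiles compact_unit_columns)
  moreover have "?S \<noteq> {}"
  proof -
    obtain V :: "complex mat" where V: "V \<in> carrier_mat (dim_col (H r q)) 1" "fnorm2 V = 1"
      by (rule spectral_radius_gram_attained[of "H r q"]) (use H_dim[OF r q] nT_pos[OF r] in auto)
    then have "V \<in> carrier_mat (nT r) 1" using H_dim[OF r q] by simp
    from unit_columns_surj[OF this V(2)] obtain v where "v \<in> unit_columns (nT r)" by blast
    then show ?thesis using profiles_nonempty by auto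
  qed
  ultimately obtain p where p: "p \<in> ?S"
    and max: "\<And>p'. p' \<in> ?S \<Longrightarrow> fnorm2 (A (fst p') * column (nT r) (snd p')) \<le> fnorm2 (A (fst p) * column (nT r) (snd p))"
    using continuous_attains_sup[of ?S "\<lambda>p. fnorm2 (A (fst p) * column (nT r) (snd p))"] by blast
  obtain \<xi> v where \<xi>: "\<xi> \<in> profiles" and v: "v \<in> unit_columns (nT r)" and pe: "p = (\<xi>, v)" using p by auto
  define Y where "Y = restrict (prof \<xi>) ({1..Q} - {q})"
  have Y: "Y \<in> strategies_others Q nT P q"
    using profilesD[OF \<xi>] by (auto simp: Y_def strategies_others_def strategies_eq)
  have iY: "intf q Y = intf q (prof \<xi>)" by (rule intf_cong) (simp add: Y_def)
  have obl: "oblique (H q q) (intf q Y) \<in> carrier_mat (nR q) (nR q)" by (rule oblique_dim[OF q Y])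
  have objY: "proj_objective H r q (oblique (H q q) (intf q Y)) = spectral_radius (adj (A \<xi>) * A \<xi>)"
    using proj_objective_eq[OF q r obl] by (simp add: A_def iY)
  have bound: "fnorm2 (A \<xi> * column (nT r) v) \<le> spectral_radius (adj (A \<xi>) * A \<xi>)"
  proof -
    have "dim_row (column (nT r) v) = nT r" by (simp add: column_def)
    moreover have "fnorm2 (column (nT r) v) = 1" using v by (simp add: unit_columns_def)
    ultimately show ?thesis
      using fnorm2_mult_le_spectral_radius[of "A \<xi>" "column (nT r) v"] continuous_mat_onD(4)[OF cA \<xi>] nT_pos[OF r] by simp
  qed
  have upper: "proj_objective H r q Pr' \<le> proj_objective H r q (oblique (H q q) (intf q Y))"
    if f: "proj_feasible Q nT nR H Rn P q (Pr', Y')" for Pr' Y'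
  proof -
    have Y': "Y' \<in> strategies_others Q nT P q" and o: "is_oblique (H q q) (intf q Y') Pr'"
      using f proj_feasible_iff[OF q] by auto
    have Pr': "Pr' = oblique (H q q) (intf q Y')"
      by (rule is_oblique_unique[OF o oblique(1)[OF intf_pos_def'[OF q Y']]])
    \<comment> \<open>\<open>profiles\<close> consists of complete profiles, so the strategy of
      \<open>q\<close>, which the interference at \<open>q\<close> does not see, is filled in with a
      scaled identity.\<close>
    define Z where "Z = Y'(q := of_real (P q / nT q) \<cdot>\<^sub>m 1\<^sub>m (nT q))"
    have Z: "Z s \<in> psd_trace (nT s) (P s)" if "s \<in> {1..Q}" for s
      using others_psd_trace[OF Y', of s] that scaled_identity_psd_trace[OF nT_pos[OF q] P_pos[OF q]] by (auto simp: Z_def)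
    have fZ: "flat Z \<in> profiles" by (rule flat_profiles[OF Z])
    have "intf q (prof (flat Z)) = intf q Y'"
    proof (rule intf_cong)
      fix s assume "s \<in> {1..Q} - {q}"
      then show "prof (flat Z) s = Y' s" using prof_flat[of s Z] psd_traceD(6)[OF Z[of s]] by (simp add: Z_def)
    qed
    then have obj: "proj_objective H r q Pr' = spectral_radius (adj (A (flat Z)) * A (flat Z))"
      unfolding Pr' proj_objective_eq[OF q r oblique_dim[OF q Y']] A_def by simp
    have dc: "dim_col (A (flat Z)) = nT r" by (rule continuous_mat_onD(4)[OF cA fZ])
    obtain V where V: "V \<in> carrier_mat (dim_col (A (flat Z))) 1" "fnorm2 V = 1"
        "fnorm2 (A (flat Z) * V) = spectral_radius (adj (A (flat Z)) * A (flat Z))"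
      by (rule spectral_radius_gram_attained[of "A (flat Z)"]) (use dc nT_pos[OF r] in auto)
    obtain w where w: "w \<in> unit_columns (nT r)" "column (nT r) w = V"
      using unit_columns_surj[of V "nT r"] V dc by auto
    have "fnorm2 (A (flat Z) * V) \<le> fnorm2 (A \<xi> * column (nT r) v)"
      using max[of "(flat Z, w)"] fZ w pe by simp
    then show ?thesis using V(3) obj bound objY by simp
  qed
  have "is_arg_max (\<lambda>(Pr, Y). proj_objective H r q Pr) (proj_feasible Q nT nR H Rn P q) (oblique (H q q) (intf q Y), Y)"
    unfolding is_arg_max_def
  proof (intro conjI notI)
    show "proj_feasible Q nT nR H Rn P q (oblique (H q q) (intf q Y), Y)"
      unfolding proj_feasible_iff[OF q] using Y oblique(1)[OF intf_pos_def'[OF q Y]] by simp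
    assume "\<exists>y. proj_feasible Q nT nR H Rn P q y \<and>
        (case (oblique (H q q) (intf q Y), Y) of (Pr, Y) \<Rightarrow> proj_objective H r q Pr) < (case y of (Pr, Y) \<Rightarrow> proj_objective H r q Pr)"
    then show False using upper by (fastforce simp: not_less[symmetric])
  qed
  then show ?thesis by blast
qed

text \<open>\<open>coupling q r Y\<close> is the channel from \<open>r\<close> seen through the
  adapted inverse at \<open>q\<close>. For full row rank the oblique projection is the identity and
  equality holds; otherwise the projection at \<open>Y\<close> competes with the selected
  maximizer.\<close>

lemma coupling_le_S_tilde:
  assumes q: "q \<in> {1..Q}" and r: "r \<in> {1..Q}" "r \<noteq> q" and Y: "Y \<in> strategies_others Q nT P q"
  shows "spectral_radius (adj (coupling q r Y) * coupling q r Y) \<le> S_tilde_entry Q nT nR H Rn P q r"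
proof (cases "vec_space.rank (nR q) (H q q) = nR q")
  case True
  have "oblique (H q q) (intf q Y) = 1\<^sub>m (nR q)"
    using full_rank_left_identity[of "oblique (H q q) (intf q Y)" "H q q"] oblique_dim[OF q Y] True
      oblique(2)[OF intf_pos_def'[OF q Y]] H_dim[OF q q] by simp
  then have "coupling q r Y = pseudoinverse (H q q) * H r q"
    by (simp add: coupling_def mat_mult_one H_dim[OF q q])
  then show ?thesis using True r
    by (simp add: S_tilde_entry_def mat_assoc H_dim[OF q q] H_dim[OF r(1) q])
next
  case False
  let ?f = "\<lambda>(Pr, Y). proj_objective H r q Pr" and ?F = "proj_feasible Q nT nR H Rn P q"
  have am: "is_arg_max ?f ?F (arg_max ?f ?F)"
    unfolding arg_max_def by (rule someI_ex[OF arg_max_exists[OF q r(1)]])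
  have feas: "?F (oblique (H q q) (intf q Y), Y)"
    unfolding proj_feasible_iff[OF q] using Y oblique(1)[OF intf_pos_def'[OF q Y]] by simp
  have "proj_objective H r q (oblique (H q q) (intf q Y)) \<le> proj_objective H r q (fst (arg_max ?f ?F))"
    using am feas unfolding is_arg_max_def by (auto simp: not_less split: prod.splits)
  also have "\<dots> = S_tilde_entry Q nT nR H Rn P q r"
    using False r by (simp add: S_tilde_entry_def proj_objective_def P_star_def)
  finally show ?thesis unfolding proj_objective_eq[OF q r(1) oblique_dim[OF q Y]] coupling_def .
qed

lemma coupling_dim:
  assumes "q \<in> {1..Q}" "r \<in> {1..Q}"
  shows "dim_row (coupling q r Y) = nT q" "dim_col (coupling q r Y) = nT r"
  unfolding coupling_def by (simp_all add: H_dim[OF assms(1,1)] H_dim[OF assms(2,1)])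

text \<open>The entry dominates the spectral radius of a Gram matrix at one concrete
  profile.\<close>

lemma S_tilde_entry_nonneg:
  assumes q: "q \<in> {1..Q}" and r: "r \<in> {1..Q}"
  shows "0 \<le> S_tilde_entry Q nT nR H Rn P q r"
proof (cases "r = q")
  case False
  define Y where "Y = restrict (\<lambda>s. complex_of_real (P s / nT s) \<cdot>\<^sub>m 1\<^sub>m (nT s)) ({1..Q} - {q})"
  have Y: "Y \<in> strategies_others Q nT P q"
    using scaled_identity_psd_trace nT_pos P_pos unfolding strategies_others_def Y_def by (auto simp: strategies_eq)
  obtain V where "fnorm2 (coupling q r Y * V) = spectral_radius (adj (coupling q r Y) * coupling q r Y)"
    by (rule spectral_radius_gram_attained[of "coupling q r Y"]) (use coupling_dim[OF q r] nT_pos[OF r] in auto)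
  then have "0 \<le> spectral_radius (adj (coupling q r Y) * coupling q r Y)" by (metis fnorm2_nonneg)
  then show ?thesis using coupling_le_S_tilde[OF q r False Y] by simp
qed (simp add: S_tilde_entry_def)

section \<open>Uniqueness of the equilibrium\<close>

lemma NE_multiplier:
  assumes NE: "is_NE Q nT nR H Rn P X" and q: "q \<in> {1..Q}"
  obtains \<mu> where "0 < \<mu>" "grad (H q q) (intf q X) (X q) * X q = of_real \<mu> \<cdot>\<^sub>m X q"
    "\<And>Y. pos_semidef_mat Y \<Longrightarrow> Y \<in> carrier_mat (nT q) (nT q) \<Longrightarrow>
      0 \<le> Re (tr ((of_real \<mu> \<cdot>\<^sub>m 1\<^sub>m (nT q) - grad (H q q) (intf q X) (X q)) * Y))"
proof -
  have X: "X r \<in> psd_trace (nT r) (P r)" if "r \<in> {1..Q}" for r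
    using NE that unfolding is_NE_iff strategies_eq[symmetric] by blast
  have R: "pos_def_mat (intf q X)" "intf q X \<in> carrier_mat (nR q) (nR q)"
    using intf_pos_def[OF q, of X] X by auto
  let ?G = "grad (H q q) (intf q X) (X q)"
  note g = grad[OF H[OF q q] R X[OF q]]
  have vi: "Re (tr (?G * (Y - X q))) \<le> 0" if "Y \<in> psd_trace (nT q) (P q)" for Y
    using NE q that unfolding is_NE_iff by blast
  obtain \<mu> where \<mu>: "?G * X q = of_real \<mu> \<cdot>\<^sub>m X q"
    "\<And>Y. pos_semidef_mat Y \<Longrightarrow> Y \<in> carrier_mat (nT q) (nT q) \<Longrightarrow> 0 \<le> Re (tr ((of_real \<mu> \<cdot>\<^sub>m 1\<^sub>m (nT q) - ?G) * Y))"
    using gradient_kkt[OF g(3) g(1) X[OF q] P_pos[OF q] nT_pos[OF q] vi] by blast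
  \<comment> \<open>Testing with the identity bounds the trace of the gradient by \<mu> times the
    dimension. That trace is positive because the channel is nonzero and the inverse total
    covariance is positive definite.\<close>
  have "0 \<le> Re (tr ((of_real \<mu> \<cdot>\<^sub>m 1\<^sub>m (nT q) - ?G) * 1\<^sub>m (nT q)))"
    by (rule \<mu>(2)[OF pos_def_imp_semidef[OF pos_def_one]]) simp
  then have le: "Re (tr ?G) \<le> \<mu> * nT q" using g by (simp add: mat_simps tr_minus tr_smult)
  note T = total_cov[OF H[OF q q] R X[OF q]]
  have "0 < Re (tr ?G)" unfolding grad_def
    by (rule pos_def_tr[OF pos_def_mat_inv[OF T(1)]]) (use T(2) H_nz[OF q] H_dim[OF q q] pos_def_inv(3)[OF T] in auto)
  with le have "0 < \<mu> * nT q" by linarith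
  then have "0 < \<mu>" by (simp add: zero_less_mult_iff)
  from that[OF this \<mu>] show thesis .
qed

text \<open>Each of the two projection inequalities is tested with the other equilibrium.\<close>
lemma NE_distance_le:
  assumes NX: "is_NE Q nT nR H Rn P X" and NY: "is_NE Q nT nR H Rn P Y" and q: "q \<in> {1..Q}"
  shows "sqrt (fnorm2 (X q - Y q)) \<le>
    (\<Sum>r\<in>{1..Q}. S_tilde_entry Q nT nR H Rn P q r * sqrt (fnorm2 (X r - Y r)))"
proof -
  have psd: "X r \<in> psd_trace (nT r) (P r)" "Y r \<in> psd_trace (nT r) (P r)" if "r \<in> {1..Q}" for r
    using NX NY that unfolding is_NE_iff strategies_eq[symmetric] by blast+
  define RX where "RX = intf q X"
  define RY where "RY = intf q Y"
  have R: "pos_def_mat RX" "RX \<in> carrier_mat (nR q) (nR q)" "pos_def_mat RY" "RY \<in> carrier_mat (nR q) (nR q)"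
    unfolding RX_def RY_def using intf_pos_def[OF q, of X] intf_pos_def[OF q, of Y] psd by auto
  define LX where "LX = pseudoinverse (H q q) * oblique (H q q) RX"
  define LY where "LY = pseudoinverse (H q q) * oblique (H q q) RY"
  have "adapted_inverse (H q q) RX LX" "adapted_inverse (H q q) RY LY"
    unfolding LX_def LY_def using R H_dim[OF q q] by (auto intro!: adapted_inverse_oblique)
  note L = this
  have dL [simp]: "dim_row LX = nT q" "dim_col LX = nR q" "dim_row LY = nT q" "dim_col LY = nR q"
    using L H_dim[OF q q] by (auto simp: adapted_inverse_def)
  note dR [simp] = carrier_matD[OF R(2)] carrier_matD[OF R(4)]
  note dX [simp] = psd_traceD(3,4)[OF psd(1)[OF q]] psd_traceD(3,4)[OF psd(2)[OF q]]
  note aX [simp] = psd_traceD(5)[OF psd(1)[OF q]] psd_traceD(5)[OF psd(2)[OF q]]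
  obtain \<mu> where \<mu>: "0 < \<mu>" "grad (H q q) RX (X q) * X q = of_real \<mu> \<cdot>\<^sub>m X q"
    "\<And>Y. pos_semidef_mat Y \<Longrightarrow> Y \<in> carrier_mat (nT q) (nT q) \<Longrightarrow>
      0 \<le> Re (tr ((of_real \<mu> \<cdot>\<^sub>m 1\<^sub>m (nT q) - grad (H q q) RX (X q)) * Y))"
    using NE_multiplier[OF NX q] unfolding RX_def by blast
  obtain \<nu> where \<nu>: "0 < \<nu>" "grad (H q q) RY (Y q) * Y q = of_real \<nu> \<cdot>\<^sub>m Y q"
    "\<And>Z. pos_semidef_mat Z \<Longrightarrow> Z \<in> carrier_mat (nT q) (nT q) \<Longrightarrow>
      0 \<le> Re (tr ((of_real \<nu> \<cdot>\<^sub>m 1\<^sub>m (nT q) - grad (H q q) RY (Y q)) * Z))"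
    using NE_multiplier[OF NY q] unfolding RY_def by blast
  note sX = gradient_eigen_row_space[OF H[OF q q] R(1,2) psd(1)[OF q] \<mu>(2,1)]
  note sY = gradient_eigen_row_space[OF H[OF q q] R(3,4) psd(2)[OF q] \<nu>(2,1)]
  define mX where "mX = LX * RX * adj LX"
  define mY where "mY = LY * RY * adj LY"
  have [simp]: "dim_row mX = nT q" "dim_col mX = nT q" "dim_row mY = nT q" "dim_col mY = nT q"
    by (simp_all add: mX_def mY_def)
  have p1: "0 \<le> Re (tr ((mX + X q) * (Y q - X q)))" unfolding mX_def
    by (rule waterfilling_projection[OF H[OF q q] R(1,2) psd[OF q] sY L(1) \<mu>])
  have p2: "0 \<le> Re (tr ((mY + Y q) * (X q - Y q)))" unfolding mY_def
    by (rule waterfilling_projection[OF H[OF q q] R(3,4) psd(2)[OF q] psd(1)[OF q] sX L(2) \<nu>])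
  define E where "E = Y q - X q"
  have [simp]: "dim_row E = nT q" "dim_col E = nT q" "adj E = E" by (simp_all add: E_def)
  \<comment> \<open>In the sum of the two inequalities the own strategies contribute minus the
    squared norm of \<open>E\<close>, leaving only the difference of \<open>L R L^H\<close>.\<close>
  have e1: "tr ((mX + X q) * (Y q - X q)) + tr ((mY + Y q) * (X q - Y q)) = tr ((mX - mY) * E) - tr (adj E * E)"
    by (simp add: E_def mat_simps tr_add tr_minus algebra_simps)
  have "Re (tr ((mX + X q) * (Y q - X q))) + Re (tr ((mY + Y q) * (X q - Y q))) = Re (tr ((mX - mY) * E)) - fnorm2 E"
    using arg_cong[OF e1, of Re] unfolding fnorm2_tr by (simp only: plus_complex.sel minus_complex.sel Re_complex_of_real)
  then have e2: "fnorm2 E \<le> Re (tr ((mX - mY) * E))" using p1 p2 by linarith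
  define D where "D r = X r - Y r" for r
  let ?I = "{1..Q} - {q}"
  have dD: "dim_row (D r) = nT r" "dim_col (D r) = nT r" if "r \<in> {1..Q}" for r
    using psd_traceD(3,4)[OF psd(1)[OF that]] psd_traceD(3,4)[OF psd(2)[OF that]] by (simp_all add: D_def)
  have RD: "RX - RY = mat_sum (nR q) ?I (\<lambda>r. H r q * D r * adj (H r q))"
  proof -
    have "RX - RY = mat_sum (nR q) ?I (\<lambda>r. H r q * X r * adj (H r q)) - mat_sum (nR q) ?I (\<lambda>r. H r q * Y r * adj (H r q))"
      unfolding RX_def RY_def intf_eq using Rn[OF q] by (auto intro!: eq_matI)
    also have "\<dots> = mat_sum (nR q) ?I (\<lambda>r. H r q * X r * adj (H r q) - H r q * Y r * adj (H r q))"
      by (rule mat_sum_minus) (use intf_term_carrier[OF q] psd in auto)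
    also have "\<dots> = mat_sum (nR q) ?I (\<lambda>r. H r q * D r * adj (H r q))"
    proof -
      have "H r q * X r * adj (H r q) - H r q * Y r * adj (H r q) = H r q * D r * adj (H r q)" if "r \<in> ?I" for r
        using that psd_traceD(3,4)[OF psd(1)[of r]] psd_traceD(3,4)[OF psd(2)[of r]] H_dim[of r q] q
        by (simp add: D_def mat_mult_minus mat_minus_mult)
      then show ?thesis unfolding mat_sum_def by (intro arg_cong[of _ _ "mat (nR q) (nR q)"] ext sum.cong) auto
    qed
    finally show ?thesis .
  qed
  have "mX - mY = LX * (RX - RY) * adj LY"
    unfolding mX_def mY_def
    by (rule adapted_inverse_difference[OF _ _ _ _ L]) (use R pos_def_adj(1) H_dim[OF q q] in auto)
  then have "tr ((mX - mY) * E) = tr (LX * (RX - RY) * (adj LY * E))" by (simp add: mat_assoc)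
  also have "\<dots> = (\<Sum>r\<in>?I. tr (LX * (H r q * D r * adj (H r q)) * (adj LY * E)))"
    unfolding RD by (rule tr_mult_mat_sum) (use H_dim q in auto)
  finally have trE: "tr ((mX - mY) * E) = (\<Sum>r\<in>?I. tr (LX * (H r q * D r * adj (H r q)) * (adj LY * E)))" .
  have bnd: "cmod (tr (LX * (H r q * D r * adj (H r q)) * (adj LY * E))) \<le>
      S_tilde_entry Q nT nR H Rn P q r * sqrt (fnorm2 (D r)) * sqrt (fnorm2 E)" if r: "r \<in> ?I" for r
  proof -
    have r': "r \<in> {1..Q}" "r \<noteq> q" using r by auto
    note [simp] = H_dim[OF r'(1) q] dD[OF r'(1)]
    \<comment> \<open>\<open>A\<close> comes from \<open>X\<close> and \<open>B\<close> from
      \<open>Y\<close>: two points of the same maximization, hence bounded by the same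
      entry.\<close>
    define A where "A = LX * H r q"
    define B where "B = LY * H r q"
    have others: "restrict Z ?I \<in> strategies_others Q nT P q"
      if "\<And>r. r \<in> {1..Q} \<Longrightarrow> Z r \<in> psd_trace (nT r) (P r)" for Z
      using that by (auto simp: strategies_others_def strategies_eq)
    have iZ: "intf q (restrict Z ?I) = intf q Z" for Z by (rule intf_cong) simp
    have "A = coupling q r (restrict X ?I)" "B = coupling q r (restrict Y ?I)"
      unfolding coupling_def iZ A_def B_def LX_def LY_def RX_def RY_def by (rule refl)+
    then have sA: "spectral_radius (adj A * A) \<le> S_tilde_entry Q nT nR H Rn P q r"
      and sB: "spectral_radius (adj B * B) \<le> S_tilde_entry Q nT nR H Rn P q r"
      using coupling_le_S_tilde[OF q r'] others[of X, OF psd(1)] others[of Y, OF psd(2)] by simp_all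
    have [simp]: "dim_row A = nT q" "dim_col A = nT r" "dim_row B = nT q" "dim_col B = nT r"
      by (simp_all add: A_def B_def)
    \<comment> \<open>The double adjoint brings the trace into the shape of an inner product for
      Cauchy-Schwarz.\<close>
    have "tr (LX * (H r q * D r * adj (H r q)) * (adj LY * E)) = tr (adj (adj (A * D r * adj B)) * E)"
      by (simp add: A_def B_def mat_assoc)
    also have "cmod \<dots> \<le> sqrt (fnorm2 (adj (A * D r * adj B))) * sqrt (fnorm2 E)"
      by (rule tr_cauchy_schwarz) simp_all
    also have "\<dots> \<le> S_tilde_entry Q nT nR H Rn P q r * sqrt (fnorm2 (D r)) * sqrt (fnorm2 E)"
      unfolding fnorm2_adj using nT_pos[OF r'(1)]
      by (intro mult_right_mono fnorm2_sandwich_le sA sB) simp_all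
    finally show ?thesis .
  qed
  have "fnorm2 E \<le> cmod (tr ((mX - mY) * E))" by (rule order_trans[OF e2 complex_Re_le_cmod])
  also have "\<dots> \<le> (\<Sum>r\<in>?I. S_tilde_entry Q nT nR H Rn P q r * sqrt (fnorm2 (D r)) * sqrt (fnorm2 E))"
    unfolding trE by (rule sum_norm_le) (rule bnd)
  \<comment> \<open>The diagonal entry is 0, so the sum may run over all users, as in a matrix
    product.\<close>
  also have "\<dots> = (\<Sum>r\<in>{1..Q}. S_tilde_entry Q nT nR H Rn P q r * sqrt (fnorm2 (D r)) * sqrt (fnorm2 E))"
    by (rule sum.mono_neutral_left) (auto simp: S_tilde_entry_def)
  also have "\<dots> = (\<Sum>r\<in>{1..Q}. S_tilde_entry Q nT nR H Rn P q r * sqrt (fnorm2 (D r))) * sqrt (fnorm2 E)"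
    by (rule sum_distrib_right[symmetric])
  finally have main: "sqrt (fnorm2 E) * sqrt (fnorm2 E) \<le>
      (\<Sum>r\<in>{1..Q}. S_tilde_entry Q nT nR H Rn P q r * sqrt (fnorm2 (D r))) * sqrt (fnorm2 E)"
    by (simp only: real_sqrt_mult_self abs_of_nonneg fnorm2_nonneg)
  have nonneg: "0 \<le> (\<Sum>r\<in>{1..Q}. S_tilde_entry Q nT nR H Rn P q r * sqrt (fnorm2 (D r)))"
    by (intro sum_nonneg mult_nonneg_nonneg S_tilde_entry_nonneg q) auto
  have "sqrt (fnorm2 E) \<le> (\<Sum>r\<in>{1..Q}. S_tilde_entry Q nT nR H Rn P q r * sqrt (fnorm2 (D r)))"
  proof (cases "sqrt (fnorm2 E) = 0")
    case False
    then have "0 < sqrt (fnorm2 E)" by (simp add: order_less_le)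
    then show ?thesis using main by (simp only: mult_le_cancel_right_pos)
  qed (use nonneg in simp)
  moreover have "fnorm2 E = fnorm2 (X q - Y q)"
    unfolding fnorm2_def E_def by (simp add: norm_minus_commute)
  ultimately show ?thesis unfolding D_def by simp
qed

lemma NE_unique:
  assumes \<rho>: "spectral_radius (S_tilde Q nT nR H Rn P) < 1"
    and NX: "is_NE Q nT nR H Rn P X" and NY: "is_NE Q nT nR H Rn P Y"
  shows "X = Y"
proof (rule PiE_ext[of X "{1..Q}" "strategies nT P"])
  show XY: "X \<in> Pi\<^sub>E {1..Q} (strategies nT P)" "Y \<in> Pi\<^sub>E {1..Q} (strategies nT P)"
    using NX NY unfolding is_NE_iff by blast+
  fix q assume q: "q \<in> {1..Q}"
  define e where "e i = sqrt (fnorm2 (X (Suc i) - Y (Suc i)))" for i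
  \<comment> \<open>Players start at 1 and matrix rows at 0, so player \<open>q\<close> is row
    \<open>q - 1\<close>.\<close>
  have "e (q - 1) = 0"
  proof (rule nonneg_subinvariant_eq_0[of Q "\<lambda>i j. S_tilde_entry Q nT nR H Rn P (Suc i) (Suc j)"])
    show "spectral_radius (mat Q Q (\<lambda>(i, j). complex_of_real (S_tilde_entry Q nT nR H Rn P (Suc i) (Suc j)))) < 1"
      using \<rho> by (simp add: S_tilde_def)
    fix i assume i: "i < Q"
    have "(\<Sum>r\<in>{1..Q}. S_tilde_entry Q nT nR H Rn P (Suc i) r * sqrt (fnorm2 (X r - Y r))) =
        (\<Sum>j<Q. S_tilde_entry Q nT nR H Rn P (Suc i) (Suc j) * e j)"
      unfolding e_def by (rule sum.reindex_bij_witness[of _ Suc "\<lambda>r. r - 1"]) auto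
    then show "e i \<le> (\<Sum>j<Q. S_tilde_entry Q nT nR H Rn P (Suc i) (Suc j) * e j)"
      using NE_distance_le[OF NX NY, of "Suc i"] i by (simp add: e_def)
  qed (use q in \<open>auto simp: e_def intro!: S_tilde_entry_nonneg\<close>)
  then have "fnorm2 (X q - Y q) = 0" using q by (simp add: e_def)
  moreover have "X q \<in> psd_trace (nT q) (P q)" "Y q \<in> psd_trace (nT q) (P q)"
    using XY q unfolding strategies_eq[symmetric] by blast+
  note d = psd_traceD(3,4)[OF this(1)] psd_traceD(3,4)[OF this(2)]
  ultimately have "X q - Y q = 0\<^sub>m (nT q) (nT q)" by (simp add: fnorm2_eq_0 d)
  then show "X q = Y q" by (rule mat_minus_eq_zeroD) (simp_all add: d)
qed

end

theorem theorem9: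
  fixes Q :: nat
    and nT nR :: "nat \<Rightarrow> nat"
    and H :: "nat \<Rightarrow> nat \<Rightarrow> complex mat"
    and Rn :: "nat \<Rightarrow> complex mat"
    and P :: "nat \<Rightarrow> real"
  assumes "\<And>r q. r \<in> {1..Q} \<Longrightarrow> q \<in> {1..Q} \<Longrightarrow> H r q \<in> carrier_mat (nR q) (nT r)"
    and "\<And>q. q \<in> {1..Q} \<Longrightarrow> H q q \<noteq> 0\<^sub>m (nR q) (nT q)"
    and "\<And>q. q \<in> {1..Q} \<Longrightarrow> Rn q \<in> carrier_mat (nR q) (nR q)"
    and "\<And>q. q \<in> {1..Q} \<Longrightarrow> pos_def_mat (Rn q)"
    and "\<And>q. q \<in> {1..Q} \<Longrightarrow> P q > 0"
  shows "(\<exists>X. is_NE Q nT nR H Rn P X) \<and>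
    (spectral_radius (S_tilde Q nT nR H Rn P) < 1 \<longrightarrow> (\<exists>!X. is_NE Q nT nR H Rn P X))"
proof -
  interpret mimo Q nT nR H Rn P
    by (unfold_locales) (use assms in auto)
  obtain X where X: "is_NE Q nT nR H Rn P X" using NE_exists by blast
  then show ?thesis using NE_unique by blast
qed

end
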